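(* Assume that $a>4L_F$, where $a=\frac\alpha2-\left|\frac\alpha2-\frac{\delta K\lambda_1}{\alpha}\right|$ and $L_F=\frac{2c_2|\beta|}{\alpha}$. Then the rotation number of the coupled second order system with white noises $$d\dot u_j+\alpha\,du_j+K(Au)_j\,dt+\beta g(u_j)\,dt=f_j\,dt+\epsilon_j\,dW_j,\qquad j\in\mathbb{Z}^d_N,$$ exists; that is, there is $\rho\in\mathbb{R}$ such that for $\mathbb{P}$-a.e. $\omega\in\Omega$ and each $\phi_0=(u_0,u_1)^\top\in E$ the limit $\lim_{t\to\infty}\frac{P\phi(t,\omega,\phi_0)}{t}$ exists and equals $\rho\eta_0$.
   Context: Data. $N\ge2$, $d\ge1$ are integers, $\mathbb{Z}^d_N=\{j\in\mathbb{Z}^d:1\le j_1,\dots,j_d\le N\}$; $\alpha,K>0$, $\beta\in\mathbb{R}$, $\delta\in(0,1]$, and $f=(f_j)$, $(\epsilon_j)$ are constant vectors in $\mathbb{R}^{N^d}$ indexed by $\mathbb{Z}^d_N$. $A$ is an $N^d\times N^d$ nonnegative definite symmetric matrix with eigenvalues $0=\lambda_0<\lambda_1\le\dots\le\lambda_{N^d-1}$, with $\lambda_0=0$ algebraically simple and $(1,\dots,1)^\top$ an eigenvector for $\lambda_0$. $g\in C^1(\mathbb{R},\mathbb{R})$ satisfies $g(x+\kappa)=g(x)$, $|g(x)|\le c_1$, $|g'(x)|\le c_2$ for all $x$, where $c_1,c_2>0$ and $\kappa>0$ is the smallest positive period of $g$; $g(u)=(g(u_j))_j$ for $u\in\mathbb{R}^{N^d}$.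 Noise. $\Omega_0=\{\omega_0\in C(\mathbb{R},\mathbb{R}):\omega_0(0)=0\}$ with the compact-open topology, Borel $\sigma$-algebra and (two-sided) Wiener measure; $(\Omega,\mathcal{F},\mathbb{P})$ is the product of copies of this space over $j\in\mathbb{Z}^d_N$; $\theta_t\omega(\cdot)=\omega(\cdot+t)-\omega(t)$. $W_j(t)(\omega)=\omega_j(t)$ and $W(t)=(\epsilon_jW_j(t))_j$. $z(\theta_t\omega)=(z_j(\theta_t\omega))_j$ is the unique stationary solution of $dz+z\,dt=dW(t)$ in $\mathbb{R}^{N^d}$ (explicitly $z_j(\omega)=-\epsilon_j\int_{-\infty}^0e^s\omega_j(s)\,ds$). $\Omega$ is replaced, without change of notation, by a $\theta_t$-invariant full-measure subset on which $t\mapsto z_j(\theta_t\omega)$ is (defined and) continuous for all $j$. System and spaces. $E=\mathbb{R}^{N^d}\times\mathbb{R}^{N^d}$. With $v=\dot u-z(\theta_t\omega)$ the stochastic system becomes $\dot u=v+z(\theta_t\omega)$, $\dot v=-KAu-\alpha v+f-\beta g(u)+(1-\alpha)z(\theta_t\omega)$; $Y(t,\omega,Y_0)$, $t\ge0$, is its solution $(u,v)^\top$ with $Y(0,\omega,Y_0)=Y_0\in E$. For $\phi_0=(u_0,u_1)^\top\in E$, $\phi(t,\omega,\phi_0)=Y(t,\omega,(u_0,u_1-z(\omega))^\top)+(0,z(\theta_t\omega))^\top$ is the random dynamical system associated with the stochastic system. $\eta_0=(1,\dots,1,0,\dots,0)^\top$, $\eta_{-1}=(1,\dots,1,-\alpha,\dots,-\alpha)^\top\in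 E$ (first $N^d$ entries $1$); $E_1=\mathrm{span}\{\eta_0\}$, $E_{-1}=\mathrm{span}\{\eta_{-1}\}$, $E_{11}=E_1+E_{-1}$, $E_{22}=E_{11}^\perp$ (Euclidean orthogonal complement in $E$), $E_2=E_{-1}\oplus E_{22}$, so $E=E_1\oplus E_2$; $P$ is the projection of $E$ onto $E_1$ along $E_2$. *)

theory Defs
  imports "HOL-Analysis.Analysis" "HOL-Probability.Probability"
begin

section \<open>Two-sided Wiener measure on path space\<close>

definition path_space :: "(real \<Rightarrow> real) set" where
  "path_space = {w. continuous_on UNIV w \<and> w 0 = 0}"

definition compact_open :: "(real \<Rightarrow> real) topology" where
  "compact_open = topology_generated_by
     {{w \<in> path_space. w ` C \<subseteq> U} | C U. compact C \<and> open U}"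

definition path_borel :: "(real \<Rightarrow> real) measure" where
  "path_borel = sigma path_space {S. openin compact_open S}"

text \<open>
  Wiener measure is given by its defining property, which determines it uniquely: under it the
  coordinate process is a two-sided Brownian motion, i.e. it has independent increments over
  finite partitions of the whole line and centred Gaussian increments of variance \<open>t - s\<close>.
  (\<open>w 0 = 0\<close> and path continuity are part of \<^const>\<open>path_space\<close>; the second argument of
  \<^const>\<open>normal_density\<close> is the standard deviation.)
\<close>

definition two_sided_wiener_measure :: "(real \<Rightarrow> real) measure \<Rightarrow> bool" where
  "two_sided_wiener_measure W \<longleftrightarrow>
     prob_space W \<and> space W = path_space \<and> sets W = sets path_borel \<and>
     (\<forall>s t. s < t \<longrightarrow>
        distributed W lborel (\<lambda>w. w t - w s) (\<lambda>x. ennreal (normal_density 0 (sqrt (t - s)) x))) \<and>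
     (\<forall>(n::nat) t. strict_mono_on {..n} t \<longrightarrow>
        prob_space.indep_vars W (\<lambda>_. borel) (\<lambda>i w. w (t (Suc i)) - w (t i)) {..<n})"


section \<open>Noise\<close>

text \<open>
  Sample points are families of paths indexed by a finite type \<open>'i\<close>. The lattice
  $\mathbb{Z}^d_N$ is obtained as \<open>'i = 'n ^ 'd\<close> with \<open>N = CARD('n)\<close> and \<open>d = CARD('d)\<close>.
\<close>

definition shift :: "real \<Rightarrow> ('i \<Rightarrow> real \<Rightarrow> real) \<Rightarrow> 'i \<Rightarrow> real \<Rightarrow> real" where
  "shift t \<omega> = (\<lambda>j s. \<omega> j (s + t) - \<omega> j t)"

text \<open>The stationary Ornstein--Uhlenbeck random variable; the integral converges for all
  \<open>shift t \<omega>\<close> simultaneously outside a null set of \<open>\<omega>\<close>.\<close>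

definition ou :: "real ^ 'i \<Rightarrow> ('i::finite \<Rightarrow> real \<Rightarrow> real) \<Rightarrow> real ^ 'i" where
  "ou \<epsilon> \<omega> = (\<chi> j. - (\<epsilon> $ j) * (LINT s:{..0}|lborel. exp s * \<omega> j s))"


section \<open>The random differential equation and its random dynamical system\<close>

definition rhs ::
  "real ^ 'i ^ 'i \<Rightarrow> real \<Rightarrow> real \<Rightarrow> real \<Rightarrow> (real \<Rightarrow> real) \<Rightarrow> real ^ 'i \<Rightarrow> real ^ 'i \<Rightarrow>
   (real ^ 'i) \<times> (real ^ 'i) \<Rightarrow> (real ^ 'i::finite) \<times> (real ^ 'i)" where
  "rhs A K \<alpha> \<beta> g f z = (\<lambda>(u, v).
     (v + z,
      - (K *\<^sub>R (A *v u)) - \<alpha> *\<^sub>R v + f - \<beta> *\<^sub>R (\<chi> j. g (u $ j)) + (1 - \<alpha>) *\<^sub>R z))"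

definition is_solution ::
  "real ^ 'i ^ 'i \<Rightarrow> real \<Rightarrow> real \<Rightarrow> real \<Rightarrow> (real \<Rightarrow> real) \<Rightarrow> real ^ 'i \<Rightarrow> real ^ 'i \<Rightarrow>
   ('i::finite \<Rightarrow> real \<Rightarrow> real) \<Rightarrow> (real ^ 'i) \<times> (real ^ 'i) \<Rightarrow>
   (real \<Rightarrow> (real ^ 'i) \<times> (real ^ 'i)) \<Rightarrow> bool" where
  "is_solution A K \<alpha> \<beta> g f \<epsilon> \<omega> y0 Y \<longleftrightarrow>
     Y 0 = y0 \<and>
     (\<forall>t\<ge>0. (Y has_vector_derivative rhs A K \<alpha> \<beta> g f (ou \<epsilon> (shift t \<omega>)) (Y t))
               (at t within {0..}))"

text \<open>Only values at \<open>t \<ge> 0\<close> are determined by the equation, so the description operator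
  is applied to the value at time \<open>t\<close> and not to the whole function.\<close>

definition solution ::
  "real ^ 'i ^ 'i \<Rightarrow> real \<Rightarrow> real \<Rightarrow> real \<Rightarrow> (real \<Rightarrow> real) \<Rightarrow> real ^ 'i \<Rightarrow> real ^ 'i \<Rightarrow>
   real \<Rightarrow> ('i::finite \<Rightarrow> real \<Rightarrow> real) \<Rightarrow> (real ^ 'i) \<times> (real ^ 'i) \<Rightarrow>
   (real ^ 'i) \<times> (real ^ 'i)" where
  "solution A K \<alpha> \<beta> g f \<epsilon> t \<omega> y0 =
     (THE y. \<exists>Y. is_solution A K \<alpha> \<beta> g f \<epsilon> \<omega> y0 Y \<and> Y t = y)"

definition rds ::
  "real ^ 'i ^ 'i \<Rightarrow> real \<Rightarrow> real \<Rightarrow> real \<Rightarrow> (real \<Rightarrow> real) \<Rightarrow> real ^ 'i \<Rightarrow> real ^ 'i \<Rightarrow>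
   real \<Rightarrow> ('i::finite \<Rightarrow> real \<Rightarrow> real) \<Rightarrow> (real ^ 'i) \<times> (real ^ 'i) \<Rightarrow>
   (real ^ 'i) \<times> (real ^ 'i)" where
  "rds A K \<alpha> \<beta> g f \<epsilon> t \<omega> = (\<lambda>(u0, u1).
     solution A K \<alpha> \<beta> g f \<epsilon> t \<omega> (u0, u1 - ou \<epsilon> \<omega>) + (0, ou \<epsilon> (shift t \<omega>)))"


section \<open>The splitting of the phase space\<close>

definition eta0 :: "(real ^ 'i) \<times> (real ^ 'i::finite)" where
  "eta0 = (vec 1, 0)"

definition eta_minus :: "real \<Rightarrow> (real ^ 'i) \<times> (real ^ 'i::finite)" where
  "eta_minus \<alpha> = (vec 1, vec (- \<alpha>))"

definition E1 :: "((real ^ 'i) \<times> (real ^ 'i::finite)) set" where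
  "E1 = span {eta0}"

definition E_minus :: "real \<Rightarrow> ((real ^ 'i) \<times> (real ^ 'i::finite)) set" where
  "E_minus \<alpha> = span {eta_minus \<alpha>}"

definition E11 :: "real \<Rightarrow> ((real ^ 'i) \<times> (real ^ 'i::finite)) set" where
  "E11 \<alpha> = {x + y | x y. x \<in> E1 \<and> y \<in> E_minus \<alpha>}"

definition E22 :: "real \<Rightarrow> ((real ^ 'i) \<times> (real ^ 'i::finite)) set" where
  "E22 \<alpha> = orthogonal_comp (E11 \<alpha>)"

definition E2 :: "real \<Rightarrow> ((real ^ 'i) \<times> (real ^ 'i::finite)) set" where
  "E2 \<alpha> = {x + y | x y. x \<in> E_minus \<alpha> \<and> y \<in> E22 \<alpha>}"

definition proj :: "real \<Rightarrow> (real ^ 'i) \<times> (real ^ 'i::finite) \<Rightarrow> (real ^ 'i) \<times> (real ^ 'i)" where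
  "proj \<alpha> x = (THE p. p \<in> E1 \<and> x - p \<in> E2 \<alpha>)"


section \<open>Spectral data\<close>

text \<open>\<open>lam 0 \<le> lam 1 \<le> \<dots>\<close> lists the roots of the characteristic polynomial with multiplicity;
  entries beyond the size of the matrix are irrelevant.\<close>

definition ordered_eigenvalues :: "real ^ 'i ^ 'i::finite \<Rightarrow> (nat \<Rightarrow> real) \<Rightarrow> bool" where
  "ordered_eigenvalues A lam \<longleftrightarrow>
     (\<forall>x. det (mat x - A) = (\<Prod>k<CARD('i). x - lam k)) \<and> mono_on {..<CARD('i)} lam"

end

theory Submission
  imports Defs "HOL-Library.Periodic_Fun" "HOL-Library.Discrete_Functions"
begin

text \<open>
  In the coordinates \<open>(u, w)\<close> with \<open>w = v + z\<close> the system is driven by the increments of the Wiener paths alone,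
  and \<open>proj \<alpha>\<close> maps \<open>(u, w)\<close> to \<open>drift (u, w) *\<^sub>R eta0\<close> with \<open>drift (u, w) = mean u + mean w / \<alpha>\<close>, whose
  time derivative, apart from the noise, is bounded. For the difference of two solutions the quadratic form
  \<open>c\<^sup>2 * drift\<^sup>2 - Q\<close>, with \<open>Q\<close> the energy of the component in \<open>E2\<close>, is a function \<open>V\<close> of time with
  \<open>V' \<ge> - 2 * L_F * V\<close>, because of the spectral gap. Its positivity set is therefore an invariant cone, on which the order of the drifts is
  preserved; comparing one solution with the shifts of another by multiples of the period \<open>\<kappa>\<close>, the displacements
  of any two solutions over any time interval differ by at most \<open>\<kappa> + sqrt Q / c\<close>.

  Cut time into blocks of length \<open>T\<close> and compare on each block with the solution restarted at the origin. The
  restarted displacements depend on the noise increments of a single block each, so they are independent and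
  identically distributed and obey the strong law. The comparison errors are \<open>\<kappa>\<close> plus \<open>sqrt Q\<close> at the
  beginning of each block, and since \<open>Q\<close> is contracted, the average of the latter is controlled by
  the average of the suprema of the noise over blocks, which is \<open>O(sqrt T)\<close> by chaining. Hence
  \<open>drift / t\<close> eventually stays within \<open>O(1 / sqrt T)\<close> of the constant \<open>block_mean T / T\<close>; letting \<open>T\<close> tend to
  infinity yields a limit which depends neither on the noise nor on the initial value.
\<close>

section \<open>Spectral gap of the coupling matrix\<close>

text \<open>Restarting at the origin costs an error whose bound contains at least \<kappa> for every
  block, so no averaging over blocks of a fixed length removes it. It fades only through division by
  the block length; hence the number of blocks goes to infinity first, for fixed \<open>T\<close>,
  and the noise of a block has to grow more slowly than \<open>T\<close>. The restarts also take the
  place of an ergodic theorem, since they leave sums of functionals of disjoint pieces of the path.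
  Wiener measure is given through finite families of increments. Measurability, stationarity and
  lack of correlation of path functionals are therefore proved for interpolations on a grid and
  carried over by dominated convergence, which is why functionals Lipschitz in the supremum norm are
  singled out. Fourth moments of increments are the input that makes the supremum square integrable.
  The spectral hypothesis is a factorisation of the characteristic polynomial. Algebraic simplicity
  of 0 must first become a statement on the kernel before a variational inequality on the complement
  of \<open>vec 1\<close> is available.\<close>

text \<open>Geometric multiplicity two forces a double root: Cramer's rule replaces two columns of
  \<open>mat x - A\<close> by x times a kernel vector, and each such column releases a factor
  x.\<close>

lemma det_char_double_kernel:
  fixes A :: "real ^ 'i ^ 'i::finite"
  assumes A1: "A *v vec 1 = 0" and Au: "A *v u = 0" and u: "u \<noteq> 0" and perp: "u \<bullet> vec 1 = 0"
  shows "\<exists>D c. c \<noteq> 0 \<and> continuous_on UNIV D \<and> (\<forall>x::real. c * det (mat x - A) = x\<^sup>2 * D x)"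
proof -
  fix i0 :: 'i
  \<comment> \<open>Removing the coordinate \<open>i0\<close> from the kernel vector ensures that
    replacing column \<open>i0\<close> does not change the product with \<open>w\<close>.\<close>
  define w where "w = u - (u $ i0) *\<^sub>R vec 1"
  have w0: "w $ i0 = 0" by (simp add: w_def)
  have "w \<noteq> 0"
  proof
    assume "w = 0"
    then have "u = (u $ i0) *\<^sub>R vec 1" by (simp add: w_def)
    then have "u \<bullet> u = (u $ i0) * (u \<bullet> vec 1)" by (metis inner_scaleR_right)
    with perp u show False by simp
  qed
  then obtain i1 where i1: "w $ i1 \<noteq> 0" by (metis vec_eq_iff zero_index)
  with w0 have ne: "i0 \<noteq> i1" by auto
  define M where "M x = (mat x - A :: real^'i^'i)" for x
  have M_mult: "M x *v v = x *\<^sub>R v - A *v v" for x v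
    by (simp add: M_def matrix_vector_mult_diff_rdistrib scaleR_vec_def vec_eq_iff matrix_vector_mult_def mat_def if_distrib[of "\<lambda>z. z * _"] sum_subtractf left_diff_distrib cong: if_cong)
  have Aw: "A *v w = 0"
    using A1 Au by (simp only: w_def matrix_vector_mult_diff_distrib matrix_vector_mult_scaleR) simp
  define D where "D x = det (\<chi> i j. if j = i1 then w $ i else if j = i0 then 1 else M x $ i $ j)" for x
  define M1 where "M1 x = (\<chi> i j. if j = i0 then (M x *v vec 1) $ i else M x $ i $ j)" for x
  have d1: "det (M1 x) = det (M x)" for x
    unfolding M1_def using cramer_lemma[of i0 "M x" "vec 1"] by simp
  have M1w: "M1 x *v w = x *\<^sub>R w" for x
  proof -
    have "M1 x *v w = M x *v w"
      unfolding vec_eq_iff matrix_vector_mult_def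
      by (auto simp: M1_def w0 intro!: sum.cong)
    then show ?thesis using M_mult[of x w] Aw by simp
  qed
  have d2: "det (\<chi> i j. if j = i1 then (M1 x *v w) $ i else M1 x $ i $ j) = w $ i1 * det (M x)" for x
    using cramer_lemma[of i1 "M1 x" w] d1 by simp
  have "w $ i1 * det (M x) = x\<^sup>2 * D x" for x
  proof -
    let ?B = "\<chi> j i. if j = i1 then w $ i else if j = i0 then 1 else M x $ i $ j"
    \<comment> \<open>Columns \<open>i0\<close> and \<open>i1\<close> are now x times constant
      vectors; the transposition is there because the factors are pulled out of rows.\<close>
    have "(\<chi> i j. if j = i1 then (M1 x *v w) $ i else M1 x $ i $ j)
      = transpose (\<chi> j. (if j = i1 \<or> j = i0 then x else 1) *s ?B $ j)"
      unfolding M1w unfolding vec_eq_iff using ne M_mult[of x "vec 1"] A1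
      by (auto simp: transpose_def M1_def)
    then have "w $ i1 * det (M x) = det (\<chi> j. (if j = i1 \<or> j = i0 then x else 1) *s ?B $ j)"
      using d2[of x] by (simp add: det_transpose)
    also have "\<dots> = (\<Prod>j\<in>UNIV. if j = i1 \<or> j = i0 then x else 1) * det (\<chi> j. ?B $ j)"
      by (rule det_rows_mul)
    also have "(\<Prod>j\<in>UNIV. if j = i1 \<or> j = i0 then x else 1) = (\<Prod>j\<in>{i1,i0}. x)"
      by (rule prod.mono_neutral_cong_right) auto
    also have "\<dots> = x\<^sup>2" using ne by (simp add: power2_eq_square)
    also have "det (\<chi> j. ?B $ j) = D x"
    proof -
      have "(\<chi> j. ?B $ j) = transpose (\<chi> i j. if j = i1 then w $ i else if j = i0 then 1 else M x $ i $ j)"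
        by (simp add: transpose_def vec_eq_iff)
      then show ?thesis by (simp only: det_transpose D_def)
    qed
    finally show ?thesis .
  qed
  moreover have "continuous_on UNIV D"
  proof -
    have "continuous_on UNIV (\<lambda>x. (if j = i1 then w $ i else if j = i0 then 1 else M x $ i $ j))" for i j
      by (cases "j = i1"; cases "j = i0"; cases "i = j") (simp_all add: M_def mat_def continuous_on_diff)
    then show ?thesis unfolding D_def det_def by (auto intro!: continuous_intros)
  qed
  ultimately show ?thesis using i1 unfolding M_def by blast
qed

text \<open>After one factor x is divided out, the product over k \<ge> 1 remains. A second kernel
  vector makes it vanish at 0, reached as a limit because \<open>D\<close> is only known to be
  continuous; then some \<open>lam k\<close> with k \<ge> 1 is 0, against the ordering.\<close>

lemma ordered_eigenvalues_kernel:
  fixes A :: "real ^ 'i ^ 'i::finite"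
  assumes ev: "ordered_eigenvalues A lam" and card: "CARD('i) \<ge> 2" and lam: "lam 0 = 0" "0 < lam 1"
    and A1: "A *v vec 1 = 0" and Au: "A *v u = 0" and perp: "u \<bullet> vec 1 = 0"
  shows "u = 0"
proof (rule ccontr)
  assume "u \<noteq> 0"
  from det_char_double_kernel[OF A1 Au this perp] obtain D c where
    D: "c \<noteq> 0" "continuous_on UNIV D" "\<And>x::real. c * det (mat x - A) = x\<^sup>2 * D x" by blast
  define p where "p x = (\<Prod>k\<in>{1..<CARD('i)}. x - lam k)" for x
  have det: "det (mat x - A) = x * p x" for x
  proof -
    have "{..<CARD('i)} = insert 0 {1..<CARD('i)}" using card by auto
    then show ?thesis using ev lam by (simp add: ordered_eigenvalues_def p_def)
  qed
  have eq: "c * p x = x * D x" if "x \<noteq> 0" for x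
    using D(3)[of x] that by (simp add: det power2_eq_square)
  have "((\<lambda>x. c * p x) \<longlongrightarrow> c * p 0) (at 0)" unfolding p_def by (intro tendsto_intros)
  moreover have "((\<lambda>x. x * D x) \<longlongrightarrow> 0 * D 0) (at 0)"
    using D(2) by (intro tendsto_intros) (auto simp: continuous_on_def)
  then have "((\<lambda>x. c * p x) \<longlongrightarrow> 0) (at 0)"
    by (simp add: tendsto_cong[of "\<lambda>x. c * p x" "\<lambda>x. x * D x"] eq eventually_at_filter)
  ultimately have "c * p 0 = 0" by (rule LIM_unique)
  then have "p 0 = 0" using D by simp
  then obtain k where k: "1 \<le> k" "k < CARD('i)" "lam k = 0" by (auto simp: p_def)
  moreover have "lam 1 \<le> lam k"
    using ev k card by (intro mono_onD[of "{..<CARD('i)}" lam]) (auto simp: ordered_eigenvalues_def)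
  ultimately show False using lam by simp
qed

lemma symmetric_matrix_inner:
  fixes A :: "real ^ 'i ^ 'i::finite"
  assumes "transpose A = A"
  shows "(A *v x) \<bullet> y = x \<bullet> (A *v y)"
  by (metis assms dot_lmul_matrix vector_transpose_matrix)

text \<open>Rayleigh quotient: a minimiser on the unit sphere of the hyperplane is an eigenvector,
  so the minimum is some \<open>lam k\<close>, and k = 0 is excluded by the kernel lemma.\<close>

lemma poincare_inequality:
  fixes A :: "real ^ 'i ^ 'i::finite"
  assumes sym: "transpose A = A" and ev: "ordered_eigenvalues A lam" and card: "CARD('i) \<ge> 2"
    and lam: "lam 0 = 0" "0 < lam 1" and A1: "A *v vec 1 = 0"
    and perp: "u \<bullet> vec 1 = 0"
  shows "lam 1 * (u \<bullet> u) \<le> u \<bullet> (A *v u)"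
proof (cases "u = 0")
  case False
  define S where "S = sphere 0 1 \<inter> {v :: real^'i. v \<bullet> vec 1 = 0}"
  have "compact S" unfolding S_def
    by (intro compact_Int_closed compact_sphere) (simp only: closed_hyperplane inner_commute[of _ "vec 1"])
  moreover have uS: "u /\<^sub>R norm u \<in> S" using False perp by (simp add: S_def)
  moreover have "continuous_on S (\<lambda>v. v \<bullet> (A *v v))"
    by (intro continuous_intros linear_continuous_on) (simp add: linear_conv_bounded_linear[symmetric])
  ultimately obtain v where v: "v \<in> S" "\<And>y. y \<in> S \<Longrightarrow> v \<bullet> (A *v v) \<le> y \<bullet> (A *v y)"
    using continuous_attains_inf[of S "\<lambda>v. v \<bullet> (A *v v)"] by blast
  define \<mu> where "\<mu> = v \<bullet> (A *v v)"
  have vv: "v \<bullet> v = 1" "v \<bullet> vec 1 = 0" using v(1) by (auto simp: S_def norm_eq_1)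
  have min: "\<mu> * (y \<bullet> y) \<le> y \<bullet> (A *v y)" if "y \<bullet> vec 1 = 0" for y
  proof (cases "y = 0")
    case False
    have "\<mu> \<le> (y /\<^sub>R norm y) \<bullet> (A *v (y /\<^sub>R norm y))"
      unfolding \<mu>_def by (rule v) (use that False in \<open>simp add: S_def\<close>)
    also have "\<dots> = (y \<bullet> (A *v y)) / (norm y)\<^sup>2"
      by (simp add: matrix_vector_mult_scaleR divide_inverse power2_eq_square)
    finally show ?thesis using False by (simp add: field_simps dot_square_norm)
  qed simp
  \<comment> \<open>The residual is orthogonal to \<open>vec 1\<close> by symmetry, so
    \<open>v + s *\<^sub>R r\<close> is an admissible competitor; the first-order term of this
    variation is 2 s times the square of \<open>r\<close>.\<close>
  define r where "r = A *v v - \<mu> *\<^sub>R v"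
  have r1: "r \<bullet> vec 1 = 0"
    using vv symmetric_matrix_inner[OF sym, of v "vec 1"] A1 by (simp add: r_def inner_diff_left)
  have "r \<bullet> r = 0"
  proof (rule ccontr)
    assume "r \<bullet> r \<noteq> 0"
    then have rr: "r \<bullet> r > 0" using inner_ge_zero[of r] by linarith
    define B where "B = r \<bullet> (A *v r) - \<mu> * (r \<bullet> r)"
    have "2 * s * (r \<bullet> r) + s\<^sup>2 * B \<ge> 0" for s
    proof -
      have sw: "r \<bullet> (A *v v) = v \<bullet> (A *v r)" using symmetric_matrix_inner[OF sym, of v r] by (simp add: inner_commute)
      have rr': "r \<bullet> r = r \<bullet> (A *v v) - \<mu> * (r \<bullet> v)"
        by (subst (2) r_def) (simp add: inner_diff_right)
      have "\<mu> * ((v + s *\<^sub>R r) \<bullet> (v + s *\<^sub>R r)) \<le> (v + s *\<^sub>R r) \<bullet> (A *v (v + s *\<^sub>R r))"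
        by (rule min) (use vv r1 in \<open>simp add: inner_add_left\<close>)
      moreover have "s * (\<mu> * (r \<bullet> v)) = s * (v \<bullet> (A *v r)) - s * (r \<bullet> r)"
      proof -
        have "\<mu> * (r \<bullet> v) = v \<bullet> (A *v r) - r \<bullet> r" using rr' sw by simp
        then show ?thesis by (simp only: right_diff_distrib)
      qed
      ultimately show ?thesis
        unfolding B_def using vv(1) sw
        by (simp add: inner_add_left inner_add_right matrix_vector_right_distrib matrix_vector_mult_scaleR
            inner_commute[of v r] \<mu>_def[symmetric] algebra_simps power2_eq_square)
    qed
    \<comment> \<open>For \<open>s = - (r \<bullet> r) / k\<close> the quadratic in s becomes
      \<open>((r \<bullet> r) / k)\<^sup>2 * (B - 2 * k)\<close>, which is negative once k exceeds B
      / 2.\<close>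
    moreover define k where "k = \<bar>B\<bar> + 1"
    moreover have k: "k > 0" "B < 2 * k" by (auto simp: k_def)
    ultimately have "2 * (- (r \<bullet> r) / k) * (r \<bullet> r) + (- (r \<bullet> r) / k)\<^sup>2 * B \<ge> 0" by blast
    also have "2 * (- (r \<bullet> r) / k) * (r \<bullet> r) + (- (r \<bullet> r) / k)\<^sup>2 * B = ((r \<bullet> r) / k)\<^sup>2 * (B - 2 * k)"
      using k by (simp add: field_simps power2_eq_square)
    finally show False using rr k by (simp add: zero_le_mult_iff)
  qed
  then have eig: "A *v v = \<mu> *\<^sub>R v" by (simp add: r_def)
  have "det (mat \<mu> - A) = 0"
  proof (rule ccontr)
    assume "det (mat \<mu> - A) \<noteq> 0"
    then have "inj ((*v) (mat \<mu> - A))" by (simp add: invertible_det_nz[symmetric] inj_matrix_vector_mult)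
    moreover have "(mat \<mu> - A) *v v = 0"
      using eig by (simp add: scaleR_vec_def vec_eq_iff matrix_vector_mult_def mat_def if_distrib[of "\<lambda>z. z * _"] sum_subtractf left_diff_distrib cong: if_cong)
    then have "(mat \<mu> - A) *v v = (mat \<mu> - A) *v 0" by simp
    ultimately have "v = 0" by (rule injD)
    then show False using vv by simp
  qed
  then obtain k where k: "k < CARD('i)" "\<mu> = lam k" using ev by (auto simp: ordered_eigenvalues_def)
  have "lam 1 \<le> \<mu>"
  proof (cases "k = 0")
    case True
    then have "v = 0" using ordered_eigenvalues_kernel[OF ev card lam A1 _ vv(2)] eig k lam by simp
    then show ?thesis using vv by simp
  next
    case False
    with k card show ?thesis using ev
      by (auto simp: ordered_eigenvalues_def intro!: mono_onD[of "{..<CARD('i)}" lam])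
  qed
  then have "lam 1 * (u \<bullet> u) \<le> \<mu> * (u \<bullet> u)" by (intro mult_right_mono) auto
  also have "\<dots> \<le> u \<bullet> (A *v u)" by (rule min[OF perp])
  finally show ?thesis .
qed simp

section \<open>Ordinary differential equations on the half line\<close>

lemma nonincreasing_halfline:
  fixes h :: "real \<Rightarrow> real"
  assumes "\<And>t. 0 \<le> t \<Longrightarrow> (h has_real_derivative h' t) (at t within {0..})"
    and "\<And>t. 0 \<le> t \<Longrightarrow> t \<le> T \<Longrightarrow> h' t \<le> 0" and "0 \<le> T"
  shows "h T \<le> h 0"
proof (cases "T = 0")
  case False
  have "continuous_on {0..} h"
    using assms(1) by (auto simp: continuous_on_eq_continuous_within intro: DERIV_continuous)
  then have "continuous_on {0..T} h" by (rule continuous_on_subset) auto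
  moreover have "(h has_real_derivative h' t) (at t)" if "0 < t" "t < T" for t
    using assms(1)[of t] that at_within_interior[of t "{0..}"] by (simp add: interior_real_atLeast)
  ultimately show ?thesis
    using DERIV_nonpos_imp_decreasing_open[of 0 T h] assms(2,3) by force
qed simp

lemma exp_weighted_nonincreasing:
  fixes p :: "real \<Rightarrow> real"
  assumes p: "\<And>t. 0 \<le> t \<Longrightarrow> (p has_real_derivative p' t) (at t within {0..})"
    and le: "\<And>t. 0 \<le> t \<Longrightarrow> t \<le> T \<Longrightarrow> p' t \<le> c * p t" and "0 \<le> T"
  shows "p T \<le> exp (c * T) * p 0"
proof -
  have "exp (- c * T) * p T \<le> exp (- c * 0) * p 0"
  proof (rule nonincreasing_halfline[OF _ _ \<open>0 \<le> T\<close>])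
    show "((\<lambda>t. exp (- c * t) * p t) has_real_derivative (exp (- c * t) * (p' t - c * p t))) (at t within {0..})"
      if "0 \<le> t" for t
      by (auto intro!: derivative_eq_intros p that simp: algebra_simps)
    show "exp (- c * t) * (p' t - c * p t) \<le> 0" if "0 \<le> t" "t \<le> T" for t
      using le[OF that] by (simp add: mult_le_0_iff)
  qed
  then show ?thesis by (simp add: exp_minus field_simps)
qed

text \<open>Adding e / c to p removes the inhomogeneity. Both signs of c occur later: positive for
  comparing solutions, negative for dissipation.\<close>

lemma linear_gronwall:
  fixes p :: "real \<Rightarrow> real"
  assumes p: "\<And>t. 0 \<le> t \<Longrightarrow> (p has_real_derivative p' t) (at t within {0..})"
    and le: "\<And>t. 0 \<le> t \<Longrightarrow> t \<le> T \<Longrightarrow> p' t \<le> c * p t + e" and "0 \<le> T" and c: "c \<noteq> 0"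
  shows "p T \<le> exp (c * T) * (p 0 + e / c) - e / c"
proof -
  have "(\<lambda>t. p t + e / c) T \<le> exp (c * T) * (\<lambda>t. p t + e / c) 0"
  proof (rule exp_weighted_nonincreasing[OF _ _ \<open>0 \<le> T\<close>])
    show "((\<lambda>t. p t + e / c) has_real_derivative p' t) (at t within {0..})" if "0 \<le> t" for t
      by (auto intro!: derivative_eq_intros p that)
    show "p' t \<le> c * (p t + e / c)" if "0 \<le> t" "t \<le> T" for t
      using le[OF that] c by (simp add: algebra_simps)
  qed
  then show ?thesis by simp
qed

lemma has_real_derivative_inner_self:
  assumes "(D has_vector_derivative D') (at t within S)"
  shows "((\<lambda>t. D t \<bullet> D t) has_real_derivative 2 * (D t \<bullet> D')) (at t within S)"
proof -
  have "((\<lambda>t. D t \<bullet> D t) has_vector_derivative D t \<bullet> D' + D' \<bullet> D t) (at t within S)"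
    using assms by (rule bounded_bilinear.has_vector_derivative[OF bounded_bilinear_inner])  (rule assms)
  then show ?thesis by (simp add: has_real_derivative_iff_has_vector_derivative inner_commute)
qed

text \<open>The squared norm of the difference is used because it stays differentiable where the
  solutions meet. The rate 2L + 1 comes from 2 d \<eta> \<le> d^2 + \<eta>^2 and is rounded up to 2
  (L + 1) so that the square root can be taken at the end.\<close>

lemma ode_perturbation:
  fixes X Y :: "real \<Rightarrow> 'a::real_inner"
  assumes X: "\<And>t. 0 \<le> t \<Longrightarrow> (X has_vector_derivative X' t) (at t within {0..})"
    and Y: "\<And>t. 0 \<le> t \<Longrightarrow> (Y has_vector_derivative Y' t) (at t within {0..})"
    and le: "\<And>t. 0 \<le> t \<Longrightarrow> t \<le> T \<Longrightarrow> norm (X' t - Y' t) \<le> L * norm (X t - Y t) + \<eta>"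
    and "0 \<le> T" "0 \<le> L" and XY: "X 0 = Y 0"
  shows "norm (X T - Y T) \<le> exp ((L + 1) * T) * \<eta>"
proof -
  have \<eta>: "0 \<le> \<eta>" using le[of 0] XY \<open>0 \<le> T\<close> by (simp add: order_trans[OF norm_ge_zero])
  define D where "D t = X t - Y t" for t
  define p where "p t = D t \<bullet> D t" for t
  define p' where "p' t = 2 * (D t \<bullet> (X' t - Y' t))" for t
  have p: "(p has_real_derivative p' t) (at t within {0..})" if "0 \<le> t" for t
    unfolding p_def p'_def
    by (rule has_real_derivative_inner_self) (auto simp: D_def[abs_def] intro!: derivative_intros X Y that)
  have "p' t \<le> (2 * L + 1) * p t + \<eta>\<^sup>2" if t: "0 \<le> t" "t \<le> T" for t
  proof -
    have "D t \<bullet> (X' t - Y' t) \<le> norm (D t) * norm (X' t - Y' t)" by (rule norm_cauchy_schwarz)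
    also have "\<dots> \<le> norm (D t) * (L * norm (D t) + \<eta>)"
      using le[OF t] by (intro mult_left_mono) (auto simp: D_def)
    finally have "p' t \<le> 2 * (norm (D t) * (L * norm (D t) + \<eta>))" by (simp add: p'_def)
    also have "\<dots> \<le> (2 * L + 1) * (norm (D t))\<^sup>2 + \<eta>\<^sup>2"
      using sum_squares_bound[of "norm (D t)" \<eta>] by (simp add: algebra_simps power2_eq_square)
    finally show ?thesis by (simp add: p_def dot_square_norm)
  qed
  then have "p T \<le> exp ((2*L+1) * T) * (p 0 + \<eta>\<^sup>2 / (2*L+1)) - \<eta>\<^sup>2 / (2*L+1)"
    using \<open>0 \<le> L\<close> by (intro linear_gronwall[OF p]) (auto simp: \<open>0 \<le> T\<close>)
  also have "\<dots> \<le> exp ((2*L+1) * T) * \<eta>\<^sup>2"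
  proof -
    have "\<eta>\<^sup>2 / (2*L+1) \<le> \<eta>\<^sup>2" using \<open>0 \<le> L\<close> by (simp add: divide_le_eq mult_left_mono mult_le_cancel_left1)
    then have "exp ((2*L+1) * T) * (\<eta>\<^sup>2 / (2*L+1)) \<le> exp ((2*L+1) * T) * \<eta>\<^sup>2" by (intro mult_left_mono) auto
    moreover have "\<eta>\<^sup>2 / (2*L+1) \<ge> 0" "p 0 = 0" using \<open>0 \<le> L\<close> XY by (auto simp: p_def D_def)
    ultimately show ?thesis by simp
  qed
  also have "\<dots> \<le> exp (2 * ((L+1) * T)) * \<eta>\<^sup>2" using \<open>0 \<le> T\<close> by (intro mult_right_mono) (auto simp: algebra_simps)
  also have "\<dots> = (exp ((L+1) * T) * \<eta>)\<^sup>2" by (simp add: power_mult_distrib exp_double)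
  finally have "(norm (D T))\<^sup>2 \<le> (exp ((L+1) * T) * \<eta>)\<^sup>2" by (simp add: p_def dot_square_norm)
  then show ?thesis using \<eta> by (auto simp: D_def intro: power2_le_imp_le)
qed

lemma ode_unique:
  fixes X Y :: "real \<Rightarrow> 'a::real_inner"
  assumes "\<And>t. 0 \<le> t \<Longrightarrow> (X has_vector_derivative F t (X t)) (at t within {0..})"
    and "\<And>t. 0 \<le> t \<Longrightarrow> (Y has_vector_derivative F t (Y t)) (at t within {0..})"
    and "\<And>t x y. norm (F t x - F t y) \<le> L * norm (x - y)" and "0 \<le> L"
    and "X 0 = Y 0" and "0 \<le> t"
  shows "X t = Y t"
  using ode_perturbation[of X "\<lambda>t. F t (X t)" Y "\<lambda>t. F t (Y t)" t L 0] assms by auto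

lemma integral_has_vector_derivative_halfline:
  fixes G :: "real \<Rightarrow> 'a::banach"
  assumes "continuous_on UNIV G" and "0 \<le> t"
  shows "((\<lambda>t. integral {0..t} G) has_vector_derivative G t) (at t within {0..})"
proof -
  have "((\<lambda>t. integral {0..t} G) has_vector_derivative G t) (at t within {0..t+1})"
    using assms by (intro integral_has_vector_derivative) (auto intro: continuous_on_subset)
  moreover have "at t within {0..t+1} = at t within {0..}"
    by (rule at_within_nhd[of _ "{..<t+1}"]) auto
  ultimately show ?thesis by simp
qed

lemma continuous_on_integral_max:
  fixes G :: "real \<Rightarrow> 'a::banach"
  assumes "continuous_on UNIV G"
  shows "continuous_on UNIV (\<lambda>t. integral {0..max 0 t} G)"
proof -
  have "continuous_on {0..} (\<lambda>t. integral {0..t} G)"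
    using integral_has_vector_derivative_halfline[OF assms]
    by (auto simp: continuous_on_eq_continuous_within intro: has_vector_derivative_continuous)
  then show ?thesis
    by (rule continuous_on_compose2[where f = "max 0"]) (auto intro!: continuous_intros)
qed

text \<open>The weight \<open>exp (2 * L * t) * R t\<close> makes the Picard operator a contraction on the whole half line
  at once, whatever the growth of \<open>F t 0\<close>.\<close>

theorem ode_global_existence:
  fixes F :: "real \<Rightarrow> 'a::banach \<Rightarrow> 'a"
  assumes lip: "\<And>t x y. norm (F t x - F t y) \<le> L * norm (x - y)" and L: "0 < L"
    and cont: "continuous_on UNIV (\<lambda>(t, x). F t x)"
  obtains X where "X 0 = x0" "\<And>t. 0 \<le> t \<Longrightarrow> (X has_vector_derivative F t (X t)) (at t within {0..})"
proof -
  have contF: "continuous_on UNIV (\<lambda>t. F t (f t))" if "continuous_on UNIV f" for f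
    using continuous_on_compose2[OF cont continuous_on_Pair[OF continuous_on_id that]] by simp
  have cF0: "continuous_on UNIV (\<lambda>t. norm (F t 0))" using contF[of "\<lambda>_. 0"] by (auto intro!: continuous_intros)
  \<comment> \<open>\<open>R\<close> absorbs the initial value and the growth of
    \<open>F s 0\<close>, so that the rescaled solution is bounded. The \<open>max 0\<close> extends
    everything to negative times, since bounded continuous functions are taken on the whole
    line.\<close>
  define R where "R t = 1 + norm x0 + integral {0..max 0 t} (\<lambda>s. norm (F s 0))" for t
  have cR: "continuous_on UNIV R" unfolding R_def
    by (intro continuous_intros continuous_on_integral_max cF0)
  have int: "G integrable_on {a..b}" if "continuous_on UNIV G" for G :: "real \<Rightarrow> 'b::banach" and a b
    using that by (meson continuous_on_subset integrable_continuous_real subset_UNIV)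
  have R1: "R t \<ge> 1" for t unfolding R_def
    using integral_nonneg[OF int[OF cF0], of 0 "max 0 t"] by (simp add: add_nonneg_nonneg)
  have Rmono: "R s \<le> R t" if "0 \<le> s" "s \<le> t" for s t
    unfolding R_def using that by (simp add: integral_subset_le int[OF cF0])
  define w where "w t = exp (2 * L * max 0 t) * R t" for t
  have cw: "continuous_on UNIV w" unfolding w_def by (intro continuous_intros cR)
  have w1: "w t > 0" "R t \<le> w t" for t
    using R1[of t] L by (auto simp: w_def intro!: mult_pos_pos)
  \<comment> \<open>As \<open>R\<close> is monotone, the exponential alone yields 1 / (2 L);
    multiplied by the Lipschitz constant this is the contraction factor 1/2.\<close>
  have wint: "integral {0..t} w \<le> w t / (2 * L)" if "0 \<le> t" for t
  proof -
    have "integral {0..t} w \<le> integral {0..t} (\<lambda>s. exp (2 * L * s) * R t)"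
      using L by (intro integral_le int cw) (auto intro!: continuous_intros mult_left_mono Rmono simp: w_def)
    also have "((\<lambda>s. exp (2 * L * s) * R t) has_integral (exp (2 * L * t) * R t / (2 * L) - exp (2 * L * 0) * R t / (2 * L))) {0..t}"
      using L that by (intro fundamental_theorem_of_calculus)
        (auto intro!: derivative_eq_intros simp flip: has_real_derivative_iff_has_vector_derivative)
    then have "integral {0..t} (\<lambda>s. exp (2 * L * s) * R t) = exp (2 * L * t) * R t / (2 * L) - R t / (2 * L)"
      by (rule trans[OF integral_unique]) simp
    also have "\<dots> \<le> w t / (2 * L)" using that L R1[of t] by (simp add: w_def)
    finally show ?thesis .
  qed
  \<comment> \<open>The Picard operator for the quotient of the solution by the weight
    \<open>w\<close>.\<close>
  define \<Phi> where "\<Phi> z t = (x0 + integral {0..max 0 t} (\<lambda>s. F s (w s *\<^sub>R z s))) /\<^sub>R w t" for z :: "real \<Rightarrow> 'a" and t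
  have c\<Phi>i: "continuous_on UNIV (\<lambda>s. F s (w s *\<^sub>R z s))" if "continuous_on UNIV z" for z
    by (intro contF continuous_intros cw that)
  have diff: "norm (\<Phi> y t - \<Phi> z t) \<le> d / 2"
    if y: "continuous_on UNIV y" and z: "continuous_on UNIV z" and d: "\<And>s. norm (y s - z s) \<le> d" for y z t d
  proof -
    have "norm (integral {0..max 0 t} (\<lambda>s. F s (w s *\<^sub>R y s) - F s (w s *\<^sub>R z s)))
      \<le> integral {0..max 0 t} (\<lambda>s. L * d * w s)"
    proof (rule integral_norm_bound_integral)
      show "norm (F s (w s *\<^sub>R y s) - F s (w s *\<^sub>R z s)) \<le> L * d * w s" for s
      proof -
        have "norm (F s (w s *\<^sub>R y s) - F s (w s *\<^sub>R z s)) \<le> L * norm (w s *\<^sub>R (y s - z s))"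
          using lip[of s "w s *\<^sub>R y s" "w s *\<^sub>R z s"] by (simp add: algebra_simps)
        also have "\<dots> \<le> L * (w s * d)" using w1[of s] L d[of s] by (intro mult_left_mono) auto
        finally show ?thesis by (simp add: mult_ac)
      qed
    qed (auto intro!: int continuous_intros c\<Phi>i y z cw)
    also have "\<dots> = L * d * integral {0..max 0 t} w" by simp
    also have "\<dots> \<le> L * d * (w (max 0 t) / (2 * L))"
      using order_trans[OF norm_ge_zero d[of 0]] L by (intro mult_left_mono wint) auto
    also have "\<dots> = w t * (d / 2)" using L by (simp add: w_def R_def)
    finally have "norm (integral {0..max 0 t} (\<lambda>s. F s (w s *\<^sub>R y s)) - integral {0..max 0 t} (\<lambda>s. F s (w s *\<^sub>R z s))) \<le> w t * (d / 2)"
      by (simp add: integral_diff int c\<Phi>i y z)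
    moreover have "\<Phi> y t - \<Phi> z t = (integral {0..max 0 t} (\<lambda>s. F s (w s *\<^sub>R y s)) - integral {0..max 0 t} (\<lambda>s. F s (w s *\<^sub>R z s))) /\<^sub>R w t"
      by (simp only: \<Phi>_def scaleR_diff_right[symmetric]) simp
    ultimately show ?thesis
      using w1[of t] by (simp add: divide_inverse_commute[symmetric] pos_divide_le_eq mult.commute)
  qed
  have zero: "norm (\<Phi> (\<lambda>_. 0) t) \<le> 1" for t
  proof -
    have "norm (integral {0..max 0 t} (\<lambda>s. F s 0)) \<le> integral {0..max 0 t} (\<lambda>s. norm (F s 0))"
      by (intro integral_norm_bound_integral int cF0 contF) auto
    then have "norm (x0 + integral {0..max 0 t} (\<lambda>s. F s 0)) \<le> R t"
      unfolding R_def by (intro norm_triangle_le) auto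
    then show ?thesis using w1[of t] by (simp add: \<Phi>_def divide_inverse_commute[symmetric] pos_divide_le_eq)
  qed
  have cont\<Phi>: "continuous_on UNIV (\<Phi> z)" if "continuous_on UNIV z" for z
    unfolding \<Phi>_def using w1(1) by (intro continuous_intros continuous_on_integral_max c\<Phi>i that cw) (auto simp: less_le)
  have bc: "\<Phi> (apply_bcontfun z) \<in> bcontfun" for z
  proof (rule bcontfun_normI[OF cont\<Phi>])
    show "norm (\<Phi> (apply_bcontfun z) t) \<le> 1 + norm z / 2" for t
      using diff[of "apply_bcontfun z" "\<lambda>_. 0" "norm z" t] zero[of t] norm_bounded[of z]
        norm_triangle_sub[of "\<Phi> (apply_bcontfun z) t" "\<Phi> (\<lambda>_. 0) t"] by auto
  qed auto
  define \<Psi> where "\<Psi> z = Bcontfun (\<Phi> (apply_bcontfun z))" for z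
  have ap: "apply_bcontfun (\<Psi> z) = \<Phi> (apply_bcontfun z)" for z
    unfolding \<Psi>_def by (rule Bcontfun_inverse[OF bc])
  have "\<exists>!z. \<Psi> z = z"
  proof (rule banach_fix_type[of "1/2"])
    show "\<forall>y z. dist (\<Psi> y) (\<Psi> z) \<le> 1/2 * dist y z"
    proof (intro allI dist_bound)
      fix y z t
      show "dist (apply_bcontfun (\<Psi> y) t) (apply_bcontfun (\<Psi> z) t) \<le> 1/2 * dist y z"
        unfolding ap dist_norm
        using diff[of "apply_bcontfun y" "apply_bcontfun z" "dist y z" t] dist_bounded[of y _ z]
        by (simp add: dist_norm)
    qed
  qed auto
  then obtain z where "\<Psi> z = z" by blast
  then have z: "apply_bcontfun z t = \<Phi> (apply_bcontfun z) t" for t using ap[of z] by simp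
  define X where "X t = x0 + integral {0..t} (\<lambda>s. F s (w s *\<^sub>R apply_bcontfun z s))" for t
  have Xz: "X t = w t *\<^sub>R apply_bcontfun z t" if "0 \<le> t" for t
    unfolding z[of t] using that w1[of t] by (simp add: \<Phi>_def X_def)
  show ?thesis
  proof
    show "X 0 = x0" by (simp add: X_def)
    show "(X has_vector_derivative F t (X t)) (at t within {0..})" if "0 \<le> t" for t
      unfolding Xz[OF that] unfolding X_def
      using integral_has_vector_derivative_halfline[OF c\<Phi>i that, of "apply_bcontfun z"]
      by (auto intro!: derivative_eq_intros)
  qed
qed

section \<open>The invariant cone and the energy estimates\<close>

definition mean :: "real ^ 'i::finite \<Rightarrow> real" where
  "mean u = (u \<bullet> vec 1) / CARD('i)"

definition centred :: "real ^ 'i::finite \<Rightarrow> real ^ 'i" where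
  "centred u = u - mean u *\<^sub>R vec 1"

lemma inner_vec1_self: "(vec 1 :: real ^ 'i::finite) \<bullet> vec 1 = CARD('i)"
  by (simp add: inner_vec_def)

lemma inner_vec1: "u \<bullet> vec 1 = CARD('i) * mean u" for u :: "real ^ 'i::finite"
  by (simp add: mean_def)

lemma mean_linear: "linear mean"
  by (rule linearI) (auto simp: mean_def inner_add_left add_divide_distrib)

lemmas mean_simps = linear_add[OF mean_linear] linear_diff[OF mean_linear] linear_scale[OF mean_linear]
  linear_neg[OF mean_linear] linear_0[OF mean_linear]

lemma mean_vec1: "mean (vec 1) = 1"
  by (simp only: mean_def inner_vec1_self) simp

lemma bounded_linear_mean: "bounded_linear mean"
  using mean_linear by (simp add: linear_conv_bounded_linear)

lemma centred_linear: "linear centred"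
  by (rule linearI) (auto simp: centred_def mean_simps algebra_simps)

lemmas centred_simps = linear_add[OF centred_linear] linear_diff[OF centred_linear] linear_scale[OF centred_linear]
  linear_neg[OF centred_linear] linear_0[OF centred_linear]

lemma inner_centred: "centred u \<bullet> centred v = u \<bullet> v - CARD('i) * mean u * mean v" for u v :: "real ^ 'i::finite"
proof -
  have "centred u \<bullet> centred v = u \<bullet> v - mean v * (u \<bullet> vec 1) - mean u * (v \<bullet> vec 1) + mean u * mean v * (vec 1 \<bullet> (vec 1 :: real^'i))"
    by (simp only: centred_def inner_diff_left inner_diff_right inner_scaleR_left inner_scaleR_right inner_commute[of "vec 1" v]) (simp add: algebra_simps)
  then show ?thesis by (simp only: inner_vec1 inner_vec1_self mean_vec1) (simp add: algebra_simps)
qed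

lemma inner_centred_vec1: "centred u \<bullet> vec 1 = 0" for u :: "real ^ 'i::finite"
  by (simp only: centred_def inner_diff_left inner_scaleR_left inner_vec1_self) (simp add: mean_def)

lemma inner_centred_self: "centred u \<bullet> centred v = centred u \<bullet> v" for u v :: "real ^ 'i::finite"
  using inner_centred_vec1[of u] by (simp add: centred_def[of v] inner_diff_right)

lemma abs_mean_le: "CARD('i) * \<bar>mean u\<bar> \<le> sqrt CARD('i) * norm u" for u :: "real ^ 'i::finite"
proof -
  have "\<bar>u \<bullet> vec 1\<bar> \<le> norm u * norm (vec 1 :: real^'i)" by (rule Cauchy_Schwarz_ineq2)
  also have "norm (vec 1 :: real^'i) = sqrt CARD('i)" by (simp only: norm_eq_sqrt_inner inner_vec1_self)
  finally show ?thesis by (simp only: inner_vec1 abs_mult) (simp add: mult.commute)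
qed

lemma two_abs_inner_le: "2 * s * \<bar>x \<bullet> y\<bar> \<le> s\<^sup>2 * (x \<bullet> x) + y \<bullet> y" for x y :: "'a::real_inner"
proof -
  have "0 \<le> s\<^sup>2 * (x \<bullet> x) + y \<bullet> y + 2 * s * (x \<bullet> y)"
    using inner_ge_zero[of "s *\<^sub>R x + y"] by (simp add: inner_add_left inner_add_right inner_commute[of y x] power2_eq_square algebra_simps)
  moreover have "0 \<le> s\<^sup>2 * (x \<bullet> x) + y \<bullet> y - 2 * s * (x \<bullet> y)"
    using inner_ge_zero[of "s *\<^sub>R x - y"] by (simp add: inner_diff_left inner_diff_right inner_commute[of y x] power2_eq_square algebra_simps)
  ultimately show ?thesis by (simp add: abs_if)
qed

text \<open>The spectrum is represented by \<open>poincare\<close>, with \<open>lam1\<close> the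
  first nonzero eigenvalue, and the derivative bound on \<open>g\<close> by its Lipschitz form
  \<open>lip\<close>.\<close>

locale damped_lattice =
  fixes A :: "real ^ 'i ^ 'i::finite" and lam1 K \<alpha> \<beta> \<delta> c1 c2 \<kappa> a L_F :: real
    and g :: "real \<Rightarrow> real" and f :: "real ^ 'i"
  assumes sym: "transpose A = A" and A1: "A *v vec 1 = 0"
    and poincare: "\<And>u. u \<bullet> vec 1 = 0 \<Longrightarrow> lam1 * (u \<bullet> u) \<le> u \<bullet> (A *v u)"
    and pos: "0 < \<alpha>" "0 < K" "0 < \<delta>" "\<delta> \<le> 1" "0 < lam1" "0 < c2"
    and lip: "\<And>x y. \<bar>g x - g y\<bar> \<le> c2 * \<bar>x - y\<bar>" and bnd: "\<And>x. \<bar>g x\<bar> \<le> c1"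
    and per: "0 < \<kappa>" "\<And>x. g (x + \<kappa>) = g x"
    and a_def: "a = \<alpha> / 2 - \<bar>\<alpha> / 2 - \<delta> * K * lam1 / \<alpha>\<bar>"
    and L_F_def: "L_F = 2 * c2 * \<bar>\<beta>\<bar> / \<alpha>"
    and gap: "a > 4 * L_F"
begin

lemma L_F_nonneg: "0 \<le> L_F" using pos by (simp add: L_F_def)
lemma a_pos: "0 < a" using gap L_F_nonneg by linarith
lemma a_le: "a \<le> \<alpha> / 2" by (simp add: a_def)

lemma inner_A_sym: "(A *v x) \<bullet> y = x \<bullet> (A *v y)"
  by (rule symmetric_matrix_inner[OF sym])

lemma mean_A: "mean (A *v u) = 0"
  using inner_A_sym[of u "vec 1"] A1 by (simp add: mean_def)

lemma A_centred: "A *v centred u = A *v u"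
  using A1 by (simp only: centred_def matrix_vector_mult_diff_distrib matrix_vector_mult_scaleR) simp

definition G :: "real ^ 'i \<Rightarrow> real ^ 'i" where "G u = (\<chi> j. g (u $ j))"

text \<open>\<open>b\<close> is the noise path and the second coordinate is the velocity minus
  \<open>b\<close>. In this form the noise enters without being differentiated, and the equation
  makes sense for every continuous path.\<close>

definition field :: "real ^ 'i \<Rightarrow> (real ^ 'i) \<times> (real ^ 'i) \<Rightarrow> (real ^ 'i) \<times> (real ^ 'i)" where
  "field b y = (snd y + b, - (K *\<^sub>R (A *v fst y)) - \<alpha> *\<^sub>R (snd y + b) + f - \<beta> *\<^sub>R G (fst y))"

text \<open>The coefficient of \<open>eta0\<close> in the splitting into E1 and E2. The weight 1 /
  \<alpha> is also the one for which the damping cancels the velocity in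
  \<open>drift_field\<close>.\<close>

definition drift :: "(real ^ 'i) \<times> (real ^ 'i) \<Rightarrow> real" where
  "drift y = mean (fst y) + mean (snd y) / \<alpha>"

definition wvec :: "(real ^ 'i) \<times> (real ^ 'i) \<Rightarrow> real ^ 'i" where
  "wvec y = centred ((\<alpha>/2) *\<^sub>R fst y + snd y)"

definition gap_shift :: real where "gap_shift = \<delta> * K * lam1"

text \<open>\<open>B\<close> is the polar form of the energy \<open>Q\<close>, which on \<open>E2\<close> is the square of the norm for which the linear part
  of the equation dissipates at rate \<open>a\<close>, and which vanishes on \<open>E1\<close>.\<close>

definition B :: "(real ^ 'i) \<times> (real ^ 'i) \<Rightarrow> (real ^ 'i) \<times> (real ^ 'i) \<Rightarrow> real" where
  "B y z = K * (fst y \<bullet> (A *v fst z)) + (\<alpha>\<^sup>2/4 - gap_shift) * (centred (fst y) \<bullet> centred (fst z)) + wvec y \<bullet> wvec z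
     + CARD('i) * mean (snd y) * mean (snd z) / 2"

definition Q :: "(real ^ 'i) \<times> (real ^ 'i) \<Rightarrow> real" where "Q y = B y y"

lemma drift_linear: "linear drift"
  by (rule linearI) (auto simp: drift_def mean_simps algebra_simps add_divide_distrib)

lemmas drift_simps = linear_add[OF drift_linear] linear_diff[OF drift_linear] linear_neg[OF drift_linear]
  linear_scale[OF drift_linear] linear_0[OF drift_linear]

lemma wvec_linear: "linear wvec"
  by (rule linearI) (auto simp: wvec_def centred_simps algebra_simps)

lemmas wvec_simps = linear_add[OF wvec_linear] linear_diff[OF wvec_linear] linear_neg[OF wvec_linear]
  linear_scale[OF wvec_linear] linear_0[OF wvec_linear]

lemma B_commute: "B y z = B z y"
  using inner_A_sym[of "fst y" "fst z"] by (simp add: B_def inner_commute mult.commute mult.left_commute)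

lemma B_bilinear: "bounded_bilinear B"
  unfolding bilinear_conv_bounded_bilinear[symmetric] bilinear_def
proof safe
  have *: "linear (\<lambda>z. B y z)" for y
    by (rule linearI)
      (simp_all add: B_def centred_simps wvec_simps mean_simps matrix_vector_right_distrib matrix_vector_mult_scaleR inner_add_right field_simps)
  show "linear (\<lambda>z. B y z)" for y by (rule *)
  show "linear (\<lambda>y. B y z)" for z using *[of z] by (simp add: B_commute[of _ z])
qed

text \<open>The weight \<alpha>^2/4 - \<open>gap_shift\<close> in \<open>B\<close> may be negative.
  The Poincare inequality together with \<delta> \<le> 1 lets the coupling term pay for
  \<open>gap_shift\<close>, so that the full \<alpha>^2/4 is left over.\<close>

lemma Q_ge: "\<alpha>\<^sup>2/4 * (centred (fst y) \<bullet> centred (fst y)) + wvec y \<bullet> wvec y + CARD('i) * (mean (snd y))\<^sup>2 / 2 \<le> Q y"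
proof -
  have "lam1 * (centred (fst y) \<bullet> centred (fst y)) \<le> centred (fst y) \<bullet> (A *v centred (fst y))"
    by (rule poincare[OF inner_centred_vec1])
  also have "\<dots> = fst y \<bullet> (A *v fst y)"
    using inner_A_sym[of "centred (fst y)" "fst y"] inner_A_sym[of "fst y" "fst y"] by (simp add: A_centred)
  finally have "K * (lam1 * (centred (fst y) \<bullet> centred (fst y))) \<le> K * (fst y \<bullet> (A *v fst y))" 
    using pos by (intro mult_left_mono) auto
  moreover have "\<delta> * (K * lam1 * (centred (fst y) \<bullet> centred (fst y))) \<le> 1 * (K * lam1 * (centred (fst y) \<bullet> centred (fst y)))"
    using pos by (intro mult_right_mono mult_nonneg_nonneg) auto
  ultimately show ?thesis by (simp add: Q_def B_def gap_shift_def algebra_simps power2_eq_square)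
qed

lemma Q_nonneg: "0 \<le> Q y"
  by (rule order_trans[OF _ Q_ge]) simp

lemma Q_add_le: "Q (y + z) \<le> 2 * Q y + 2 * Q z"
proof -
  interpret B: bounded_bilinear B by (rule B_bilinear)
  show ?thesis using Q_nonneg[of "y - z"]
    by (simp add: Q_def B.add_left B.add_right B.diff_left B.diff_right B_commute[of z y])
qed

lemma Q_minus: "Q (- y) = Q y"
proof -
  interpret B: bounded_bilinear B by (rule B_bilinear)
  show ?thesis by (simp add: Q_def B.minus_left B.minus_right)
qed

lemma Q_snd_le: "Q (0, x) \<le> (norm x)\<^sup>2"
proof -
  have "Q (0, x) = x \<bullet> x - CARD('i) * (mean x)\<^sup>2 / 2"
    by (simp add: Q_def B_def wvec_def centred_simps inner_centred power2_eq_square)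
  also have "\<dots> \<le> (norm x)\<^sup>2" by (simp add: dot_square_norm)
  finally show ?thesis .
qed

text \<open>\<open>vec 1\<close> in the position lies in the kernel of the form, so translations by
  multiples of the period are free of charge for the energy.\<close>

lemma Q_shift: "Q (y + (s *\<^sub>R vec 1, 0)) = Q y"
proof -
  interpret B: bounded_bilinear B by (rule B_bilinear)
  have c: "centred (vec 1 :: real^'i) = 0"
    by (simp only: centred_def mean_vec1) simp
  have "A *v (s *\<^sub>R vec 1) = 0" using A1 by (simp only: matrix_vector_mult_scaleR) simp
  then have *: "B z (s *\<^sub>R vec 1, 0) = 0" for z
    unfolding B_def wvec_def fst_conv snd_conv centred_simps c by (simp add: mean_simps)
  show ?thesis unfolding Q_def B.add_left B.add_right using * B_commute by simp
qed

lemma Q_deriv: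
  assumes "(y has_vector_derivative y') (at t within S)"
  shows "((\<lambda>t. Q (y t)) has_real_derivative 2 * B (y t) y') (at t within S)"
proof -
  have "((\<lambda>t. B (y t) (y t)) has_vector_derivative B (y t) y' + B y' (y t)) (at t within S)"
    by (rule bounded_bilinear.has_vector_derivative[OF B_bilinear assms assms])
  then show ?thesis by (simp add: has_real_derivative_iff_has_vector_derivative Q_def B_commute)
qed

text \<open>The coupling term of position against velocity cancels, by symmetry of \<open>A\<close>,
  against the one produced by \<open>wvec\<close>; the only mixed term left pairs the centred
  position with \<open>wvec\<close>.\<close>

lemma energy_identity:
  "B (u, x) (x, - (K *\<^sub>R (A *v u)) - \<alpha> *\<^sub>R x) = - (\<alpha>/2) * (Q (u, x) - CARD('i) * (mean x)\<^sup>2 / 2)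
     + (\<alpha>\<^sup>2/2 - gap_shift) * (centred u \<bullet> wvec (u, x)) - \<alpha> * CARD('i) * (mean x)\<^sup>2 / 2"
proof -
  have 1: "u \<bullet> (A *v x) = x \<bullet> (A *v u)" "x \<bullet> u = u \<bullet> x" using inner_A_sym[of u x] by (simp_all add: inner_commute)
  show ?thesis
    unfolding Q_def B_def wvec_def inner_centred fst_conv snd_conv
    by (simp add: mean_simps mean_A inner_add_left inner_add_right inner_diff_right 1)
      (simp add: algebra_simps power2_eq_square add_divide_distrib diff_divide_distrib)
qed

text \<open>By a weighted Cauchy-Schwarz inequality the mixed term costs at most |\<alpha>/2 -
  \<delta> K lam1/\<alpha>| times the centred energy, which is exactly what \<open>a\<close> takes
  off the rate \<alpha>/2. The mean velocity decays at rate \<alpha>, which is at least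
  \<open>a\<close>.\<close>

lemma dissipation: "B (u, x) (x, - (K *\<^sub>R (A *v u)) - \<alpha> *\<^sub>R x) \<le> - a * Q (u, x)"
proof -
  define q where "q = Q (u, x) - CARD('i) * (mean x)\<^sup>2 / 2"
  let ?w = "wvec (u, x)"
  have q: "\<alpha>\<^sup>2/4 * (centred u \<bullet> centred u) + ?w \<bullet> ?w \<le> q" using Q_ge[of "(u, x)"] by (simp add: q_def)
  have "\<alpha> * \<bar>centred u \<bullet> ?w\<bar> \<le> \<alpha>\<^sup>2/4 * (centred u \<bullet> centred u) + ?w \<bullet> ?w"
    using two_abs_inner_le[of "\<alpha>/2" "centred u" ?w] by (simp add: power2_eq_square)
  with q have "\<bar>centred u \<bullet> ?w\<bar> \<le> q / \<alpha>" using pos by (simp add: field_simps)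
  then have uw: "\<bar>\<alpha>\<^sup>2/2 - gap_shift\<bar> * \<bar>centred u \<bullet> ?w\<bar> \<le> \<bar>\<alpha>\<^sup>2/2 - gap_shift\<bar> * (q / \<alpha>)"
    by (rule mult_left_mono) simp
  have "(\<alpha>\<^sup>2/2 - gap_shift) * (centred u \<bullet> ?w) \<le> \<bar>\<alpha>\<^sup>2/2 - gap_shift\<bar> * \<bar>centred u \<bullet> ?w\<bar>"
    unfolding abs_mult[symmetric] by (rule abs_ge_self)
  also note uw
  also have "\<bar>\<alpha>\<^sup>2/2 - gap_shift\<bar> * (q / \<alpha>) = \<bar>\<alpha>/2 - gap_shift/\<alpha>\<bar> * q"
  proof -
    have "\<bar>\<alpha>/2 - gap_shift/\<alpha>\<bar> = \<bar>(\<alpha>\<^sup>2/2 - gap_shift) / \<alpha>\<bar>" using pos by (simp add: field_simps power2_eq_square)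
    then show ?thesis using pos by (simp add: abs_divide)
  qed
  finally have "B (u, x) (x, - (K *\<^sub>R (A *v u)) - \<alpha> *\<^sub>R x) \<le> - a * q - \<alpha> * (CARD('i) * (mean x)\<^sup>2 / 2)"
    unfolding energy_identity q_def[symmetric] a_def gap_shift_def by (simp add: algebra_simps)
  also have "\<dots> \<le> - a * q - a * (CARD('i) * (mean x)\<^sup>2 / 2)"
    using a_le pos by (intro diff_left_mono mult_right_mono) auto
  finally show ?thesis by (simp add: q_def algebra_simps)
qed

end

section \<open>Solutions, restarts and the invariant cone\<close>

context damped_lattice begin

definition flow :: "(real \<Rightarrow> real ^ 'i) \<Rightarrow> (real \<Rightarrow> (real ^ 'i) \<times> (real ^ 'i)) \<Rightarrow> bool" where
  "flow b X \<longleftrightarrow> (\<forall>t\<ge>0. (X has_vector_derivative field (b t) (X t)) (at t within {0..}))"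

lemma flowD: "flow b X \<Longrightarrow> 0 \<le> t \<Longrightarrow> (X has_vector_derivative field (b t) (X t)) (at t within {0..})"
  by (simp add: flow_def)

lemma norm_G_diff: "norm (G u - G v) \<le> c2 * norm (u - v)"
proof -
  have "norm (G u - G v) \<le> norm (c2 *\<^sub>R (u - v))"
    using lip pos by (intro norm_le_componentwise_cart) (simp add: G_def abs_mult)
  then show ?thesis using pos by simp
qed

lemma norm_G: "norm (G u) \<le> c1 * CARD('i)"
proof -
  have "norm (G u) \<le> (\<Sum>j\<in>UNIV. \<bar>G u $ j\<bar>)" by (rule norm_le_l1_cart)
  also have "\<dots> \<le> (\<Sum>j\<in>(UNIV::'i set). c1)" by (intro sum_mono) (simp add: G_def bnd)
  finally show ?thesis by (simp add: mult.commute)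
qed

lemma field_lipschitz:
  obtains L where "0 < L" "\<And>b b' y z. norm (field b y - field b' z) \<le> L * norm (y - z) + L * norm (b - b')"
proof -
  obtain NA where NA: "0 < NA" "\<And>x. norm (A *v x) \<le> NA * norm x"
    using bounded_linear.pos_bounded[OF matrix_vector_mul_bounded_linear, of A] by (metis mult.commute)
  define L where "L = 1 + \<alpha> + K * NA + \<bar>\<beta>\<bar> * c2"
  show ?thesis
  proof
    show "0 < L" using pos NA by (auto simp: L_def intro!: add_pos_nonneg)
    fix b b' :: "real ^ 'i" and y z :: "(real ^ 'i) \<times> (real ^ 'i)"
    let ?u = "fst y - fst z" and ?x = "snd y - snd z"
    have eq: "field b y - field b' z = (?x + (b - b'), - (K *\<^sub>R (A *v ?u)) - \<alpha> *\<^sub>R (?x + (b - b')) - \<beta> *\<^sub>R (G (fst y) - G (fst z)))"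
      by (simp add: field_def matrix_vector_mult_diff_distrib algebra_simps)
    have ux: "norm ?u \<le> norm (y - z)" "norm ?x \<le> norm (y - z)"
      using norm_fst_le[of "fst y - fst z" "snd y - snd z"] norm_snd_le[of "snd y - snd z" "fst y - fst z"]
      by (simp_all add: minus_prod_def)
    have xb: "norm (?x + (b - b')) \<le> norm (y - z) + norm (b - b')"
      using ux norm_triangle_ineq[of ?x "b - b'"] by linarith
    have "norm (field b y - field b' z) \<le> norm (?x + (b - b')) + norm (- (K *\<^sub>R (A *v ?u)) - \<alpha> *\<^sub>R (?x + (b - b')) - \<beta> *\<^sub>R (G (fst y) - G (fst z)))"
      unfolding eq by (rule norm_Pair_le)
    also have "norm (- (K *\<^sub>R (A *v ?u)) - \<alpha> *\<^sub>R (?x + (b - b')) - \<beta> *\<^sub>R (G (fst y) - G (fst z)))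
      \<le> norm (- (K *\<^sub>R (A *v ?u))) + norm (\<alpha> *\<^sub>R (?x + (b - b'))) + norm (\<beta> *\<^sub>R (G (fst y) - G (fst z)))"
      by (intro norm_triangle_le_diff add_right_mono norm_triangle_ineq4)
    also have "norm (- (K *\<^sub>R (A *v ?u))) \<le> K * NA * norm (y - z)"
      using NA(2)[of ?u] ux(1) pos NA(1) by (auto simp: mult.assoc intro!: mult_left_mono order_trans[OF NA(2)])
    also have "norm (\<alpha> *\<^sub>R (?x + (b - b'))) \<le> \<alpha> * (norm (y - z) + norm (b - b'))"
      using xb pos by (auto intro!: mult_left_mono)
    also have "norm (\<beta> *\<^sub>R (G (fst y) - G (fst z))) \<le> \<bar>\<beta>\<bar> * c2 * norm (y - z)"
      using norm_G_diff[of "fst y" "fst z"] ux(1) pos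
      by (auto simp: mult.assoc intro!: mult_left_mono order_trans[OF norm_G_diff])
    also note xb
    finally have "norm (field b y - field b' z) \<le> L * norm (y - z) + (1 + \<alpha>) * norm (b - b')"
      by (simp add: L_def algebra_simps)
    also have "(1 + \<alpha>) * norm (b - b') \<le> L * norm (b - b')"
      using pos NA by (intro mult_right_mono) (auto simp: L_def)
    finally show "norm (field b y - field b' z) \<le> L * norm (y - z) + L * norm (b - b')" by simp
  qed
qed

lemma continuous_G: "continuous_on S G"
proof -
  have "c2-lipschitz_on S G" using norm_G_diff pos by (auto intro!: lipschitz_onI simp: dist_norm)
  then show ?thesis by (rule lipschitz_on_continuous_on)
qed

lemma flow_exists:
  assumes "continuous_on UNIV b"
  obtains X where "flow b X" "X 0 = x0"
proof -
  obtain L where L: "0 < L" "\<And>b b' y z. norm (field b y - field b' z) \<le> L * norm (y - z) + L * norm (b - b')"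
    using field_lipschitz by blast
  have "continuous_on UNIV (\<lambda>(t, y). field (b t) y)"
  proof -
    have "continuous_on UNIV (\<lambda>p::real \<times> (real ^ 'i) \<times> (real ^ 'i). b (fst p))"
      by (rule continuous_on_compose2[OF assms]) (auto intro!: continuous_intros)
    moreover have "continuous_on UNIV (\<lambda>p::real \<times> (real ^ 'i) \<times> (real ^ 'i). G (fst (snd p)))"
      by (rule continuous_on_compose2[OF continuous_G[of UNIV]]) (auto intro!: continuous_intros)
    moreover have "continuous_on UNIV (\<lambda>p::real \<times> (real ^ 'i) \<times> (real ^ 'i). A *v (fst (snd p)))"
      by (rule continuous_on_compose2[OF matrix_vector_mult_linear_continuous_on[of UNIV]]) (auto intro!: continuous_intros)
    ultimately show ?thesis
      by (auto simp: field_def split_beta intro!: continuous_intros)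
  qed
  moreover have "norm (field (b t) y - field (b t) z) \<le> L * norm (y - z)" for t y z
    using L(2)[of "b t" y "b t" z] by simp
  ultimately obtain X where "X 0 = x0" "\<And>t. 0 \<le> t \<Longrightarrow> (X has_vector_derivative field (b t) (X t)) (at t within {0..})"
    using ode_global_existence[of "\<lambda>t. field (b t)" L x0] L(1) by blast
  then show ?thesis by (intro that[of X]) (auto simp: flow_def)
qed

lemma flow_unique:
  assumes "flow b X" "flow b Y" "X 0 = Y 0" "0 \<le> t"
  shows "X t = Y t"
proof -
  obtain L where L: "0 < L" "\<And>b b' y z. norm (field b y - field b' z) \<le> L * norm (y - z) + L * norm (b - b')"
    using field_lipschitz by blast
  have "norm (field (b t) y - field (b t) z) \<le> L * norm (y - z)" for t y z
    using L(2)[of "b t" y "b t" z] by simp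
  then show ?thesis
    using ode_unique[of X "\<lambda>t. field (b t)" Y L t] assms L(1) by (simp add: flow_def)
qed

text \<open>\<open>A\<close> has mean-zero range, and the first component cancels against the
  damping in the second, so neither the velocity nor the noise survives.\<close>

lemma drift_field: "drift (field b y) = (mean f - \<beta> * mean (G (fst y))) / \<alpha>"
  using pos by (simp add: drift_def field_def mean_simps mean_A add_divide_distrib diff_divide_distrib distrib_left)

lemma drift_deriv:
  assumes "(y has_vector_derivative y') (at t within S)"
  shows "((\<lambda>t. drift (y t)) has_real_derivative drift y') (at t within S)"
  unfolding has_real_derivative_iff_has_vector_derivative
  using bounded_linear.has_vector_derivative[OF linear_conv_bounded_linear[THEN iffD1, OF drift_linear] assms] .

text \<open>What is left in \<open>drift_field\<close> is bounded because \<open>g\<close> is, hence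
  a constant that is uniform in the noise and in the solution.\<close>

lemma flow_drift_lipschitz:
  obtains C0 where "0 \<le> C0"
    "\<And>b X s t. flow b X \<Longrightarrow> 0 \<le> s \<Longrightarrow> s \<le> t \<Longrightarrow> \<bar>drift (X t) - drift (X s)\<bar> \<le> C0 * (t - s)"
proof -
  define C0 where "C0 = (\<bar>mean f\<bar> + \<bar>\<beta>\<bar> * c1) / \<alpha>"
  have mG: "\<bar>mean (G u)\<bar> \<le> c1" for u
  proof -
    have "\<bar>G u \<bullet> vec 1\<bar> \<le> (\<Sum>j\<in>(UNIV::'i set). c1)"
      unfolding inner_vec_def by (rule order_trans[OF sum_abs sum_mono]) (simp add: G_def bnd)
    then show ?thesis by (simp only: mean_def) (simp add: abs_divide field_simps)
  qed
  have c1: "0 \<le> c1" using bnd[of 0] abs_ge_zero order_trans by blast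
  show ?thesis
  proof
    show "0 \<le> C0" using pos c1 by (simp add: C0_def)
    fix b X and s t :: real assume X: "flow b X" and st: "0 \<le> s" "s \<le> t"
    have "norm (drift (X t) - drift (X s)) \<le> C0 * norm (t - s)"
    proof (rule field_differentiable_bound[of "{s..t}"])
      fix r assume r: "r \<in> {s..t}"
      show "((\<lambda>t. drift (X t)) has_field_derivative drift (field (b r) (X r))) (at r within {s..t})"
        using flowD[OF X, of r] r st by (intro drift_deriv) (auto elim: has_vector_derivative_within_subset)
      have "\<bar>mean f - \<beta> * mean (G (fst (X r)))\<bar> \<le> \<bar>mean f\<bar> + \<bar>\<beta>\<bar> * c1"
        using mG[of "fst (X r)"] by (intro order_trans[OF abs_triangle_ineq4] add_left_mono) (auto simp: abs_mult intro: mult_left_mono)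
      then show "norm (drift (field (b r) (X r))) \<le> C0"
        using pos by (simp add: drift_field C0_def abs_divide divide_right_mono)
    qed (use st in auto)
    then show "\<bar>drift (X t) - drift (X s)\<bar> \<le> C0 * (t - s)" using st by simp
  qed
qed

text \<open>A restart at time c: the driver is again a path starting at 0, and adding
  \<open>b c\<close> to the second coordinate keeps the actual velocity unchanged.\<close>

lemma flow_shift:
  assumes "flow b X" "0 \<le> c"
  shows "flow (\<lambda>t. b (c + t) - b c) (\<lambda>t. X (c + t) + (0, b c))"
  unfolding flow_def
proof safe
  fix t :: real assume t: "0 \<le> t"
  have 1: "((\<lambda>t. c + t) has_vector_derivative 1) (at t within {0..})"
    using has_vector_derivative_add[OF has_vector_derivative_const has_vector_derivative_id] by simp
  have 2: "(X has_vector_derivative field (b (c + t)) (X (c + t))) (at (c + t) within (\<lambda>t. c + t) ` {0..})"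
    using assms(2) t by (intro has_vector_derivative_within_subset[OF flowD[OF assms(1)]]) auto
  have "field (b (c + t) - b c) (X (c + t) + (0, b c)) = field (b (c + t)) (X (c + t))"
    by (simp add: field_def)
  then show "((\<lambda>t. X (c + t) + (0, b c)) has_vector_derivative field (b (c + t) - b c) (X (c + t) + (0, b c))) (at t within {0..})"
    using has_vector_derivative_add[OF vector_diff_chain_within[OF 1 2] has_vector_derivative_const[of "(0, b c)"]]
    by (simp add: o_def)
qed

lemma flow_period:
  assumes "flow b X"
  shows "flow b (\<lambda>t. X t + ((of_int m * \<kappa>) *\<^sub>R vec 1, 0))"
proof -
  interpret g: periodic_fun_simple g \<kappa> by unfold_locales (rule per(2))
  have G: "G (u + (of_int m * \<kappa>) *\<^sub>R vec 1) = G u" for u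
    by (simp add: G_def vec_eq_iff g.plus_of_int)
  have A: "A *v (u + (of_int m * \<kappa>) *\<^sub>R vec 1) = A *v u" for u
    using A1 by (simp only: matrix_vector_right_distrib matrix_vector_mult_scaleR) simp
  have F: "field b (y + ((of_int m * \<kappa>) *\<^sub>R vec 1, 0)) = field b y" for b y
    by (simp only: field_def fst_add snd_add fst_conv snd_conv A G) simp
  show ?thesis
    unfolding flow_def F
  proof safe
    fix t :: real assume "0 \<le> t"
    from has_vector_derivative_add[OF flowD[OF assms this] has_vector_derivative_const]
    show "((\<lambda>t. X t + ((of_int m * \<kappa>) *\<^sub>R vec 1, 0)) has_vector_derivative field (b t) (X t)) (at t within {0..})"
      by (simp only: add_0_right)
  qed
qed

text \<open>This normalisation makes the mean parts of a perturbation h in the derivative of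
  \<open>c\<^sup>2 * (drift y)\<^sup>2 - Q y\<close> combine to a multiple of
  \<open>mean u * mean h\<close>, with no separate contribution of the mean velocity.\<close>

definition c :: real where "c = sqrt (CARD('i) * \<alpha>\<^sup>2 / 2)"

lemma c_pos: "0 < c" and c_sq: "c\<^sup>2 = CARD('i) * \<alpha>\<^sup>2 / 2"
  using pos by (simp_all add: c_def)

text \<open>The indefinite form \<open>c\<^sup>2 * (drift y)\<^sup>2 - Q y\<close> defines the invariant cone around \<open>E1\<close>.\<close>

lemma cone_estimate:
  assumes h: "norm h \<le> c2 * \<bar>\<beta>\<bar> * norm u"
  shows "- 2 * L_F * (c\<^sup>2 * (drift (u, x))\<^sup>2 - Q (u, x)) \<le>
    c\<^sup>2 * (2 * drift (u, x) * drift (x, - (K *\<^sub>R (A *v u)) - \<alpha> *\<^sub>R x + h)) - 2 * B (u, x) (x, - (K *\<^sub>R (A *v u)) - \<alpha> *\<^sub>R x + h)"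
proof -
  interpret B: bounded_bilinear B by (rule B_bilinear)
  define N :: real where "N = CARD('i)"
  have N: "N > 0" by (simp add: N_def)
  let ?w = "wvec (u, x)" and ?z = "(x, - (K *\<^sub>R (A *v u)) - \<alpha> *\<^sub>R x)"
  \<comment> \<open>All contributions of \<open>h\<close> to the derivative collect into twice the
    inner product of \<open>h\<close> with this vector, whose two summands are orthogonal.\<close>
  define y where "y = (\<alpha>/2 * mean u) *\<^sub>R vec 1 - ?w"
  have split: "(x, - (K *\<^sub>R (A *v u)) - \<alpha> *\<^sub>R x + h) = ?z + (0, h)" by simp
  have d: "drift (x, - (K *\<^sub>R (A *v u)) - \<alpha> *\<^sub>R x + h) = mean h / \<alpha>"
    using pos by (simp add: drift_def mean_simps mean_A add_divide_distrib diff_divide_distrib right_diff_distrib)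
  have Bh: "B (u, x) (0, h) = ?w \<bullet> h + N * mean x * mean h / 2"
    using inner_centred_self[of "(\<alpha>/2) *\<^sub>R u + x" h] by (simp add: B_def N_def wvec_def centred_simps)
  have yh: "y \<bullet> h = \<alpha>/2 * N * mean u * mean h - ?w \<bullet> h"
    by (simp only: y_def inner_diff_left inner_scaleR_left inner_commute[of "vec 1" h] inner_vec1 N_def) simp
  have "?w \<bullet> vec 1 = 0" unfolding wvec_def by (rule inner_centred_vec1)
  then have yy: "y \<bullet> y = \<alpha>\<^sup>2/4 * N * (mean u)\<^sup>2 + ?w \<bullet> ?w"
    by (simp only: y_def inner_diff_left inner_diff_right inner_scaleR_left inner_scaleR_right inner_commute[of "vec 1" ?w] inner_vec1_self N_def)
      (simp add: power2_eq_square)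
  have uu: "u \<bullet> u = centred u \<bullet> centred u + N * (mean u)\<^sup>2" by (simp add: inner_centred N_def power2_eq_square)
  have "- (y \<bullet> h) \<le> norm y * norm h" using Cauchy_Schwarz_ineq2[of y h] by simp
  also have "\<dots> \<le> norm y * (c2 * \<bar>\<beta>\<bar> * norm u)" using h by (intro mult_left_mono) auto
  \<comment> \<open>The normalisation of \<open>L_F\<close> leaves \<alpha>/2 next to the norm of u,
    matching the weight \<alpha>^2/4 in \<open>Q_ge\<close>.\<close>
  also have "\<dots> = L_F * (norm y * (\<alpha>/2 * norm u))" using pos by (simp add: L_F_def)
  also have "\<dots> \<le> L_F * ((y \<bullet> y + \<alpha>\<^sup>2/4 * (u \<bullet> u)) / 2)"
    using sum_squares_bound[of "norm y" "\<alpha>/2 * norm u"] L_F_nonneg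
    by (intro mult_left_mono) (auto simp: dot_square_norm power_mult_distrib power_divide)
  also have "\<dots> \<le> L_F * ((\<alpha>\<^sup>2/2 * N * (mean u)\<^sup>2 + (Q (u, x) - N * (mean x)\<^sup>2 / 2)) / 2)"
  proof (intro mult_left_mono L_F_nonneg)
    have "y \<bullet> y + \<alpha>\<^sup>2/4 * (u \<bullet> u) = \<alpha>\<^sup>2/2 * N * (mean u)\<^sup>2 + (\<alpha>\<^sup>2/4 * (centred u \<bullet> centred u) + ?w \<bullet> ?w)"
      by (simp add: yy uu algebra_simps)
    then show "(y \<bullet> y + \<alpha>\<^sup>2/4 * (u \<bullet> u)) / 2 \<le> (\<alpha>\<^sup>2/2 * N * (mean u)\<^sup>2 + (Q (u, x) - N * (mean x)\<^sup>2 / 2)) / 2"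
      using Q_ge[of "(u, x)"] unfolding fst_conv snd_conv N_def by (intro divide_right_mono) (linarith, simp)
  qed
  finally have yh': "- 2 * (y \<bullet> h) \<le> L_F * (\<alpha>\<^sup>2/2 * N * (mean u)\<^sup>2 + (Q (u, x) - N * (mean x)\<^sup>2 / 2))" by simp
  define s where "s = drift (u, x)"
  have mu: "mean u = s - mean x / \<alpha>" by (simp add: s_def drift_def)
  have "\<alpha>\<^sup>2/2 * (mean u)\<^sup>2 \<le> \<alpha>\<^sup>2 * s\<^sup>2 + (mean x)\<^sup>2"
  proof -
    have "\<alpha>\<^sup>2 * (mean u)\<^sup>2 = (\<alpha> * s - mean x)\<^sup>2" using pos by (simp add: mu power_mult_distrib[symmetric] algebra_simps)
    also have "\<dots> \<le> 2 * (\<alpha> * s)\<^sup>2 + 2 * (mean x)\<^sup>2" using zero_le_power2[of "\<alpha> * s + mean x"] by (simp add: power2_eq_square algebra_simps)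
    finally show ?thesis by (simp add: power_mult_distrib)
  qed
  then have "N * (\<alpha>\<^sup>2/2 * (mean u)\<^sup>2) \<le> N * (\<alpha>\<^sup>2 * s\<^sup>2 + (mean x)\<^sup>2)" using N by (intro mult_left_mono) auto
  moreover have "0 \<le> Q (u, x) - N * (mean x)\<^sup>2 / 2"
  proof -
    have "0 \<le> \<alpha>\<^sup>2/4 * (centred u \<bullet> centred u) + ?w \<bullet> ?w" by (intro add_nonneg_nonneg mult_nonneg_nonneg) auto
    then show ?thesis using Q_ge[of "(u, x)"] unfolding fst_conv snd_conv N_def by linarith
  qed
  ultimately have "\<alpha>\<^sup>2/2 * N * (mean u)\<^sup>2 + (Q (u, x) - N * (mean x)\<^sup>2 / 2) \<le> N * \<alpha>\<^sup>2 * s\<^sup>2 + 2 * Q (u, x)"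
    by (simp add: algebra_simps)
  then have "L_F * (\<alpha>\<^sup>2/2 * N * (mean u)\<^sup>2 + (Q (u, x) - N * (mean x)\<^sup>2 / 2)) \<le> L_F * (N * \<alpha>\<^sup>2 * s\<^sup>2 + 2 * Q (u, x))"
    using L_F_nonneg by (rule mult_left_mono)
  with yh' have 1: "- 2 * (y \<bullet> h) \<le> L_F * (N * \<alpha>\<^sup>2 * s\<^sup>2 + 2 * Q (u, x))" by linarith
  \<comment> \<open>Here the spectral gap is spent: of 4 L_F Q, one half pays for the loss caused by
    \<open>h\<close> and the other half is the energy term of the claim.\<close>
  have 2: "4 * L_F * Q (u, x) \<le> 2 * a * Q (u, x)" 
    using gap L_F_nonneg by (intro mult_right_mono Q_nonneg) auto
  have 3: "2 * (B (u, x) ?z) \<le> - 2 * a * Q (u, x)" using dissipation[of u x] by simp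
  have "c\<^sup>2 * (2 * s * (mean h / \<alpha>)) - 2 * B (u, x) (?z + (0, h))
    = N * \<alpha> * s * mean h - 2 * B (u, x) ?z - 2 * (?w \<bullet> h) - N * mean x * mean h"
  proof -
    have "B (u, x) (?z + (0, h)) = B (u, x) ?z + (?w \<bullet> h + N * mean x * mean h / 2)" by (simp only: B.add_right Bh)
    moreover have "c\<^sup>2 * (2 * s * (mean h / \<alpha>)) = N * \<alpha> * s * mean h"
      unfolding c_sq N_def[symmetric] using pos by (simp add: power2_eq_square)
    ultimately show ?thesis by linarith
  qed
  also have "N * \<alpha> * s * mean h - N * mean x * mean h = \<alpha> * N * mean u * mean h"
    using pos by (simp add: mu algebra_simps)
  then have "N * \<alpha> * s * mean h - 2 * B (u, x) ?z - 2 * (?w \<bullet> h) - N * mean x * mean h = 2 * (y \<bullet> h) - 2 * B (u, x) ?z"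
    by (simp add: yh)
  finally have "c\<^sup>2 * (2 * s * (mean h / \<alpha>)) - 2 * B (u, x) (?z + (0, h)) = 2 * (y \<bullet> h) - 2 * B (u, x) ?z" .
  moreover have "- 2 * L_F * (c\<^sup>2 * s\<^sup>2 - Q (u, x)) = - L_F * (N * \<alpha>\<^sup>2 * s\<^sup>2 + 2 * Q (u, x)) + 4 * L_F * Q (u, x)"
    by (simp add: c_sq N_def algebra_simps)
  ultimately show ?thesis unfolding split[symmetric] d s_def[symmetric] using 1 2 3 by linarith
qed

text \<open>As \<open>Q\<close> is nonnegative, V > 0 forbids a zero of the drift of the difference,
  so by the intermediate value theorem its sign cannot change.\<close>

lemma cone_invariant:
  assumes X: "flow b X" and Y: "flow b Y" and t: "0 \<le> t"
    and init: "sqrt (Q (Y 0 - X 0)) < c * drift (Y 0 - X 0)"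
  shows "drift (X t) < drift (Y t)"
proof -
  define D where "D t = Y t - X t" for t
  define D' where "D' t = field (b t) (Y t) - field (b t) (X t)" for t
  have D: "(D has_vector_derivative D' t) (at t within {0..})" if "0 \<le> t" for t
    unfolding D_def[abs_def] D'_def by (intro has_vector_derivative_diff flowD[OF X that] flowD[OF Y that])
  define V where "V t = c\<^sup>2 * (drift (D t))\<^sup>2 - Q (D t)" for t
  define V' where "V' t = c\<^sup>2 * (2 * drift (D t) * drift (D' t)) - 2 * B (D t) (D' t)" for t
  have V: "(V has_real_derivative V' t) (at t within {0..})" if "0 \<le> t" for t
    unfolding V_def[abs_def] V'_def
    by (auto intro!: derivative_eq_intros drift_deriv Q_deriv D that)
  have Vd: "V' t \<ge> - 2 * L_F * V t" for t
  proof -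
    define h where "h = - \<beta> *\<^sub>R (G (fst (Y t)) - G (fst (X t)))"
    have "D' t = (snd (D t), - (K *\<^sub>R (A *v fst (D t))) - \<alpha> *\<^sub>R snd (D t) + h)"
      by (simp add: D'_def D_def field_def h_def matrix_vector_mult_diff_distrib algebra_simps)
    moreover have "norm h \<le> c2 * \<bar>\<beta>\<bar> * norm (fst (D t))"
      using mult_left_mono[OF norm_G_diff[of "fst (Y t)" "fst (X t)"] abs_ge_zero[of \<beta>]] by (simp add: h_def D_def mult_ac)
    ultimately show ?thesis
      using cone_estimate[of h "fst (D t)" "snd (D t)"] by (simp add: V_def V'_def)
  qed
  have Vexp: "- V s \<le> exp (- 2 * L_F * s) * (- V 0)" if "0 \<le> s" for s
  proof (rule exp_weighted_nonincreasing[where p' = "\<lambda>t. - V' t", OF DERIV_minus[OF V] _ that])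
    show "- V' t \<le> - 2 * L_F * - V t" for t using Vd[of t] by simp
  qed
  have d0: "0 < drift (D 0)"
    using order_le_less_trans[OF real_sqrt_ge_zero[OF Q_nonneg] init] c_pos by (simp add: D_def zero_less_mult_iff)
  have "(sqrt (Q (D 0)))\<^sup>2 < (c * drift (D 0))\<^sup>2"
    using init by (intro power_strict_mono) (simp_all add: D_def Q_nonneg)
  then have "Q (D 0) < (c * drift (D 0))\<^sup>2" by (simp add: Q_nonneg)
  then have "V 0 > 0" by (simp add: V_def power_mult_distrib)
  then have Vpos: "V s > 0" if "0 \<le> s" for s
    using Vexp[OF that] by (smt (verit) exp_gt_zero mult_pos_pos mult_minus_right)
  have nz: "drift (D s) \<noteq> 0" if "0 \<le> s" for s
    using Vpos[OF that] Q_nonneg[of "D s"] by (auto simp: V_def)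
  have "continuous_on {0..} (\<lambda>t. drift (D t))"
    by (auto simp: continuous_on_eq_continuous_within intro!: DERIV_continuous drift_deriv D)
  then have "continuous_on {0..t} (\<lambda>t. drift (D t))" by (rule continuous_on_subset) auto
  then have "0 < drift (D t)"
    using IVT2'[of "\<lambda>t. drift (D t)" t 0 0] nz d0 t by force
  then show ?thesis by (simp add: D_def drift_simps)
qed

lemma displacement_comparison:
  assumes X: "flow b X" and Y: "flow b Y" and t: "0 \<le> t"
  shows "\<bar>(drift (X t) - drift (X 0)) - (drift (Y t) - drift (Y 0))\<bar> \<le> sqrt (Q (X 0 - Y 0)) / c + \<kappa>"
proof -
  have one_sided: "(drift (X t) - drift (X 0)) - (drift (Y t) - drift (Y 0)) \<le> sqrt (Q (X 0 - Y 0)) / c + \<kappa>"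
    if X: "flow b X" and Y: "flow b Y" for X Y
  proof -
    \<comment> \<open>A translation of \<open>Y\<close> by exactly \<open>r\<close> would put the
      initial difference on the boundary of the cone. \<open>m\<close> is the least integer with m
      \<kappa> > r, a floor plus one because the cone condition is strict; rounding costs at most
      \<kappa>.\<close>
    define r where "r = sqrt (Q (X 0 - Y 0)) / c + drift (X 0) - drift (Y 0)"
    define m where "m = \<lfloor>r / \<kappa>\<rfloor> + 1"
    have "r / \<kappa> < of_int m" "of_int m \<le> r / \<kappa> + 1" by (auto simp: m_def)
    then have m: "r < of_int m * \<kappa>" "of_int m * \<kappa> \<le> r + \<kappa>"
      using per(1) by (auto simp: field_simps)
    define p where "p = ((of_int m * \<kappa>) *\<^sub>R vec 1 :: real ^ 'i, 0 :: real ^ 'i)"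
    have dp: "drift (y + p) = drift y + of_int m * \<kappa>" for y
      by (simp only: drift_simps) (simp only: drift_def p_def fst_conv snd_conv mean_simps mean_vec1, simp)
    have "Q (Y 0 + p - X 0) = Q (X 0 - Y 0)"
      using Q_shift[of "Y 0 - X 0" "of_int m * \<kappa>"] Q_minus[of "X 0 - Y 0"] by (simp add: p_def algebra_simps del: vec_1)
    moreover have "drift (Y 0 + p - X 0) = drift (Y 0) + of_int m * \<kappa> - drift (X 0)"
      by (simp add: drift_simps(2) dp)
    moreover have "sqrt (Q (X 0 - Y 0)) < c * (drift (Y 0) + of_int m * \<kappa> - drift (X 0))"
      using m(1) c_pos by (simp add: r_def field_simps)
    ultimately have "drift (X t) < drift (Y t + p)"
      using cone_invariant[OF X flow_period[OF Y, of m] t] by (simp add: p_def del: vec_1)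
    then show ?thesis using m(2) by (simp add: dp r_def)
  qed
  have "Q (Y 0 - X 0) = Q (X 0 - Y 0)" using Q_minus[of "X 0 - Y 0"] by simp
  then show ?thesis using one_sided[OF X Y] one_sided[OF Y X] by (simp add: abs_le_iff)
qed

section \<open>Contraction of the energy over a block\<close>

text \<open>\<open>Q\<close> is degenerate, but \<open>B\<close> reads its first argument only
  through the centred position, \<open>wvec\<close> and the mean velocity, and each of these is
  bounded by a multiple of sqrt Q.\<close>

lemma forcing_estimate:
  obtains C1 where "0 \<le> C1"
    "\<And>u x r h. B (u, x) (r, h) \<le> C1 * sqrt (Q (u, x)) * (norm r + norm h)"
proof -
  obtain NA where NA: "0 < NA" "\<And>x. norm (A *v x) \<le> NA * norm x"
    using bounded_linear.pos_bounded[OF matrix_vector_mul_bounded_linear, of A] by (metis mult.commute)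
  define C1 where "C1 = (K * NA + \<bar>\<alpha>\<^sup>2/4 - gap_shift\<bar>) * (2/\<alpha>) + \<alpha>/2 + 2"
  show ?thesis
  proof
    have k: "0 \<le> (K * NA + \<bar>\<alpha>\<^sup>2/4 - gap_shift\<bar>) * (2/\<alpha>)" using pos NA by simp
    then show "0 \<le> C1" using pos unfolding C1_def by linarith
    fix u x r h :: "real ^ 'i"
    let ?w = "wvec (u, x)" and ?q = "sqrt (Q (u, x))" and ?N = "real CARD('i)"
    have q0: "0 \<le> ?q" by (simp add: Q_nonneg)
    have terms: "0 \<le> \<alpha>\<^sup>2/4 * (centred u \<bullet> centred u)" "0 \<le> ?w \<bullet> ?w" "0 \<le> ?N * (mean x)\<^sup>2 / 2" by auto
    note ge = Q_ge[of "(u, x)", unfolded fst_conv snd_conv]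
    have U: "norm (centred u) \<le> (2/\<alpha>) * ?q"
    proof -
      have "(\<alpha>/2 * norm (centred u))\<^sup>2 = \<alpha>\<^sup>2/4 * (centred u \<bullet> centred u)" by (simp add: power_mult_distrib power_divide dot_square_norm)
      also have "\<dots> \<le> Q (u, x)" using terms ge by linarith
      finally have "(\<alpha>/2 * norm (centred u))\<^sup>2 \<le> Q (u, x)" .
      then have "\<alpha>/2 * norm (centred u) \<le> ?q" by (rule real_le_rsqrt)
      then show ?thesis using pos by (simp add: field_simps)
    qed
    have W: "norm ?w \<le> ?q"
    proof (rule real_le_rsqrt)
      show "(norm ?w)\<^sup>2 \<le> Q (u, x)" unfolding dot_square_norm[symmetric] using terms ge by linarith
    qed
    have X: "sqrt ?N * \<bar>mean x\<bar> \<le> 2 * ?q"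
    proof -
      have "(sqrt ?N * \<bar>mean x\<bar>)\<^sup>2 = 2 * (?N * (mean x)\<^sup>2 / 2)" by (simp add: power_mult_distrib)
      also have "\<dots> \<le> 4 * Q (u, x)" using terms ge by linarith
      finally have "sqrt ?N * \<bar>mean x\<bar> \<le> sqrt (4 * Q (u, x))" by (rule real_le_rsqrt)
      then show ?thesis by (simp add: real_sqrt_mult)
    qed
    have 1: "K * (u \<bullet> (A *v r)) \<le> K * ((2/\<alpha>) * ?q * (NA * norm r))"
    proof -
      have "u \<bullet> (A *v r) = centred u \<bullet> (A *v r)"
        using inner_A_sym[of u r] inner_A_sym[of "centred u" r] by (simp add: A_centred)
      also have "\<dots> \<le> norm (centred u) * norm (A *v r)" by (rule norm_cauchy_schwarz)
      also have "\<dots> \<le> (2/\<alpha>) * ?q * (NA * norm r)" using U NA q0 pos by (intro mult_mono) auto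
      finally show ?thesis using pos by (intro mult_left_mono) auto
    qed
    have 2: "(\<alpha>\<^sup>2/4 - gap_shift) * (centred u \<bullet> centred r) \<le> \<bar>\<alpha>\<^sup>2/4 - gap_shift\<bar> * ((2/\<alpha>) * ?q * norm r)"
    proof -
      have "\<bar>centred u \<bullet> r\<bar> \<le> norm (centred u) * norm r" by (rule Cauchy_Schwarz_ineq2)
      also have "\<dots> \<le> (2/\<alpha>) * ?q * norm r" using U by (rule mult_right_mono) simp
      finally have "\<bar>\<alpha>\<^sup>2/4 - gap_shift\<bar> * \<bar>centred u \<bullet> r\<bar> \<le> \<bar>\<alpha>\<^sup>2/4 - gap_shift\<bar> * ((2/\<alpha>) * ?q * norm r)" by (rule mult_left_mono) simp
      then show ?thesis unfolding inner_centred_self abs_mult[symmetric] by (rule order_trans[OF abs_ge_self])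
    qed
    have 3: "?w \<bullet> wvec (r, h) \<le> ?q * (\<alpha>/2 * norm r + norm h)"
    proof -
      have "?w \<bullet> wvec (r, h) = ?w \<bullet> ((\<alpha>/2) *\<^sub>R r + h)"
        by (simp only: wvec_def inner_centred_self fst_conv snd_conv)
      also have "\<dots> \<le> norm ?w * norm ((\<alpha>/2) *\<^sub>R r + h)" by (rule norm_cauchy_schwarz)
      also have "\<dots> \<le> ?q * (\<alpha>/2 * norm r + norm h)"
        using W q0 pos by (intro mult_mono norm_triangle_le) auto
      finally show ?thesis .
    qed
    have 4: "?N * mean x * mean h / 2 \<le> ?q * norm h"
    proof -
      have "?N * mean x * mean h \<le> \<bar>mean x\<bar> * (?N * \<bar>mean h\<bar>)"
        using abs_ge_self[of "mean x * mean h"] by (simp add: abs_mult[symmetric] mult_ac mult_left_mono)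
      also have "\<dots> \<le> \<bar>mean x\<bar> * (sqrt ?N * norm h)" by (intro mult_left_mono abs_mean_le) auto
      also have "\<dots> = sqrt ?N * \<bar>mean x\<bar> * norm h" by simp
      also have "\<dots> \<le> 2 * ?q * norm h" using X by (rule mult_right_mono) simp
      finally show ?thesis by simp
    qed
    have "B (u, x) (r, h) \<le> K * ((2/\<alpha>) * ?q * (NA * norm r)) + \<bar>\<alpha>\<^sup>2/4 - gap_shift\<bar> * ((2/\<alpha>) * ?q * norm r)
        + ?q * (\<alpha>/2 * norm r + norm h) + ?q * norm h"
      using 1 2 3 4 unfolding B_def fst_conv snd_conv by linarith
    also have "\<dots> = ?q * (((K * NA + \<bar>\<alpha>\<^sup>2/4 - gap_shift\<bar>) * (2/\<alpha>) + \<alpha>/2) * norm r + 2 * norm h)"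
      by (simp add: algebra_simps)
    also have "\<dots> \<le> ?q * (C1 * norm r + C1 * norm h)"
      using k pos by (intro mult_left_mono[OF _ q0] add_mono mult_right_mono) (auto simp: C1_def)
    finally show "B (u, x) (r, h) \<le> C1 * ?q * (norm r + norm h)" by (simp add: algebra_simps)
  qed
qed

text \<open>The point \<open>X T + (0, b T)\<close> is the initial value of the next block after the
  restart of \<open>flow_shift\<close>, so the estimate can be iterated.\<close>

lemma block_contraction:
  obtains C T0 where "0 \<le> C" "0 < T0"
    "\<And>b X T M. flow b X \<Longrightarrow> T0 \<le> T \<Longrightarrow> (\<And>t. 0 \<le> t \<Longrightarrow> t \<le> T \<Longrightarrow> norm (b t) \<le> M) \<Longrightarrow>
      sqrt (Q (X T + (0, b T))) \<le> sqrt (Q (X 0)) / 2 + C * (1 + M)"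
proof -
  obtain C1 where C1: "0 \<le> C1" "\<And>u x r h. B (u, x) (r, h) \<le> C1 * sqrt (Q (u, x)) * (norm r + norm h)"
    using forcing_estimate by blast
  define C2 where "C2 = 1 + \<alpha> + norm f + \<bar>\<beta>\<bar> * (c1 * CARD('i))"
  have c1: "0 \<le> c1" using bnd[of 0] abs_ge_zero order_trans by blast
  have C2: "1 \<le> C2" using pos c1 by (simp add: C2_def)
  define C3 where "C3 = C1 * C2"
  have C3: "0 \<le> C3" using C1 C2 by (simp add: C3_def)
  \<comment> \<open>After this time the energy has lost a factor 8; \<open>Q_add_le\<close> gives
    back a factor 2, and the square root of 1/4 is the 1/2 of the claim.\<close>
  define T0 where "T0 = ln 8 / a"
  have T0: "0 < T0" using a_pos by (simp add: T0_def)
  define C where "C = sqrt (2 * (C3\<^sup>2 / a\<^sup>2)) + 2"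
  have C: "0 \<le> C" by (simp add: C_def)
  have main: "sqrt (Q (X T + (0, b T))) \<le> sqrt (Q (X 0)) / 2 + C * (1 + M)"
    if X: "flow b X" and T: "T0 \<le> T" and bM: "\<And>t. 0 \<le> t \<Longrightarrow> t \<le> T \<Longrightarrow> norm (b t) \<le> M" for b X T M
  proof -
    interpret B: bounded_bilinear B by (rule B_bilinear)
    have T': "0 \<le> T" using T T0 by simp
    have M: "0 \<le> M" using bM[of 0] T' norm_ge_zero order_trans by blast
    define p' where "p' t = 2 * B (X t) (field (b t) (X t))" for t
    have p: "((\<lambda>t. Q (X t)) has_real_derivative p' t) (at t within {0..})" if "0 \<le> t" for t
      unfolding p'_def by (intro Q_deriv flowD[OF X that])
    have "p' t \<le> - a * Q (X t) + (C3 * (1 + M))\<^sup>2 / a" if t: "0 \<le> t" "t \<le> T" for t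
    proof -
      obtain u x where ux: "X t = (u, x)" by (cases "X t")
      define r where "r = b t"
      define h where "h = - \<alpha> *\<^sub>R b t + f - \<beta> *\<^sub>R G u"
      define q where "q = sqrt (Q (u, x))"
      have q: "Q (u, x) = q\<^sup>2" "0 \<le> q" by (auto simp: q_def Q_nonneg)
      have bt: "norm (b t) \<le> M" by (rule bM[OF t])
      have "norm h \<le> \<alpha> * norm (b t) + norm f + \<bar>\<beta>\<bar> * norm (G u)"
        unfolding h_def using pos
        by (intro norm_triangle_le_diff add_mono norm_triangle_le order_refl) auto
      also have "\<dots> \<le> \<alpha> * M + norm f + \<bar>\<beta>\<bar> * (c1 * CARD('i))"
        using bt pos norm_G[of u] by (intro add_mono mult_left_mono) auto
      finally have "norm r + norm h \<le> M + \<alpha> * M + norm f + \<bar>\<beta>\<bar> * (c1 * CARD('i))"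
        using bt by (simp add: r_def)
      also have "\<dots> \<le> C2 * (1 + M)" using M pos c1 by (simp add: C2_def algebra_simps add_nonneg_nonneg)
      finally have rh: "norm r + norm h \<le> C2 * (1 + M)" .
      have "field (b t) (X t) = (x, - (K *\<^sub>R (A *v u)) - \<alpha> *\<^sub>R x) + (r, h)"
        by (simp add: field_def ux r_def h_def algebra_simps)
      then have "p' t = 2 * B (u, x) (x, - (K *\<^sub>R (A *v u)) - \<alpha> *\<^sub>R x) + 2 * B (u, x) (r, h)"
        by (simp only: p'_def) (simp only: ux B.add_right distrib_left)
      also have "\<dots> \<le> - 2 * a * q\<^sup>2 + 2 * (C1 * q * (norm r + norm h))"
        using dissipation[of u x] C1(2)[of u x r h] by (simp add: q flip: q_def)
      also have "\<dots> \<le> - 2 * a * q\<^sup>2 + 2 * (C1 * q * (C2 * (1 + M)))"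
        using rh C1(1) q(2) by (intro add_left_mono mult_left_mono) auto
      \<comment> \<open>One of the two copies of \<open>a\<close> in the decay rate is given up to
        absorb the term linear in q.\<close>
      also have "\<dots> \<le> - a * q\<^sup>2 + (C3 * (1 + M))\<^sup>2 / a"
      proof -
        have "2 * (a * q) * (C3 * (1 + M)) \<le> (a * q)\<^sup>2 + (C3 * (1 + M))\<^sup>2" by (rule sum_squares_bound)
        then show ?thesis using a_pos by (simp add: C3_def field_simps power2_eq_square)
      qed
      finally show ?thesis by (simp add: ux q)
    qed
    then have "Q (X T) \<le> exp (- a * T) * (Q (X 0) + (C3 * (1 + M))\<^sup>2 / a / - a) - (C3 * (1 + M))\<^sup>2 / a / - a"
      using a_pos by (intro linear_gronwall[OF p]) (auto simp: T')
    also have "\<dots> \<le> exp (- a * T) * Q (X 0) + (C3 * (1 + M))\<^sup>2 / a\<^sup>2"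
    proof -
      define E where "E = (C3 * (1 + M))\<^sup>2 / a\<^sup>2"
      have "0 \<le> exp (- a * T) * E" by (simp add: E_def)
      moreover have "(C3 * (1 + M))\<^sup>2 / a / - a = - E" by (simp add: E_def power2_eq_square)
      ultimately show ?thesis by (simp add: E_def[symmetric] right_diff_distrib)
    qed
    also have "exp (- a * T) * Q (X 0) \<le> 1/8 * Q (X 0)"
    proof (intro mult_right_mono Q_nonneg)
      have "ln 8 \<le> a * T" using T a_pos by (simp add: T0_def field_simps)
      then have "exp (- a * T) \<le> exp (- ln 8)" by simp
      then show "exp (- a * T) \<le> 1/8" by (simp add: exp_minus)
    qed
    finally have QT: "Q (X T) \<le> 1/8 * Q (X 0) + (C3 * (1 + M))\<^sup>2 / a\<^sup>2" by simp
    have "Q (X T + (0, b T)) \<le> 2 * Q (X T) + 2 * Q (0, b T)" by (rule Q_add_le)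
    also have "\<dots> \<le> 2 * (1/8 * Q (X 0) + (C3 * (1 + M))\<^sup>2 / a\<^sup>2) + 2 * (1 + M)\<^sup>2"
      using QT Q_snd_le[of "b T"] power_mono[OF order_trans[OF bM[OF T' order_refl], of "1 + M"], of 2] by force
    also have "\<dots> = (sqrt (Q (X 0)) / 2)\<^sup>2 + (sqrt (2 * (C3\<^sup>2 / a\<^sup>2)) * (1 + M))\<^sup>2 + (sqrt 2 * (1 + M))\<^sup>2"
      using Q_nonneg[of "X 0"] by (simp add: power_mult_distrib power_divide)
    also have "\<dots> \<le> (sqrt (Q (X 0)) / 2 + sqrt (2 * (C3\<^sup>2 / a\<^sup>2)) * (1 + M) + sqrt 2 * (1 + M))\<^sup>2"
    proof -
      have sq: "x\<^sup>2 + y\<^sup>2 + z\<^sup>2 \<le> (x + y + z)\<^sup>2" if "0 \<le> x" "0 \<le> y" "0 \<le> z" for x y z :: real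
        using mult_nonneg_nonneg[OF that(1,2)] mult_nonneg_nonneg[OF that(1,3)] mult_nonneg_nonneg[OF that(2,3)]
        by (simp add: power2_eq_square algebra_simps)
      show ?thesis using M Q_nonneg[of "X 0"] by (intro sq mult_nonneg_nonneg) auto
    qed
    finally have "sqrt (Q (X T + (0, b T))) \<le> sqrt (Q (X 0)) / 2 + sqrt (2 * (C3\<^sup>2 / a\<^sup>2)) * (1 + M) + sqrt 2 * (1 + M)"
      using M Q_nonneg[of "X 0"] by (intro real_le_lsqrt add_nonneg_nonneg mult_nonneg_nonneg) auto
    moreover have "sqrt 2 * (1 + M) \<le> 2 * (1 + M)" using M by (intro mult_right_mono real_le_lsqrt) auto
    ultimately show ?thesis by (simp add: C_def algebra_simps)
  qed
  show ?thesis by (rule that[OF C T0]) (rule main)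
qed

text \<open>A solution is determined at nonnegative times only, so one is chosen; by
  \<open>displacement_eq\<close> the value at \<open>T \<ge> 0\<close> does not depend on the
  choice.\<close>

definition displacement :: "real \<Rightarrow> (real \<Rightarrow> real ^ 'i) \<Rightarrow> real" where
  "displacement T b = drift ((SOME X. flow b X \<and> X 0 = 0) T)"

lemma displacement_eq:
  assumes "flow b X" "X 0 = 0" "0 \<le> T"
  shows "displacement T b = drift (X T)"
proof -
  define Z where "Z = (SOME X. flow b X \<and> X 0 = 0)"
  have "flow b Z \<and> Z 0 = 0"
    unfolding Z_def by (rule someI[of _ X]) (use assms in auto)
  then have "Z T = X T" using assms by (simp add: flow_unique[of b Z X])
  then show ?thesis by (simp add: displacement_def Z_def)
qed

text \<open>The bound involves the noise on [0, T] alone, which makes the displacement a functional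
  of a single block and opens the way to its measurability.\<close>

lemma displacement_lipschitz:
  assumes T: "0 \<le> T"
  obtains L where "0 \<le> L"
    "\<And>b b' \<eta>. continuous_on UNIV b \<Longrightarrow> continuous_on UNIV b' \<Longrightarrow>
      (\<And>t. 0 \<le> t \<Longrightarrow> t \<le> T \<Longrightarrow> norm (b t - b' t) \<le> \<eta>) \<Longrightarrow> \<bar>displacement T b - displacement T b'\<bar> \<le> L * \<eta>"
proof -
  obtain L where L: "0 < L" "\<And>b b' y z. norm (field b y - field b' z) \<le> L * norm (y - z) + L * norm (b - b')"
    using field_lipschitz by blast
  obtain DL where DL: "0 < DL" "\<And>y. norm (drift y) \<le> norm y * DL"
    using bounded_linear.pos_bounded[OF linear_conv_bounded_linear[THEN iffD1, OF drift_linear]] by blast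
  show ?thesis
  proof
    show "0 \<le> exp ((L + 1) * T) * L * DL" using L DL by simp
    fix b b' :: "real \<Rightarrow> real ^ 'i" and \<eta> :: real
    assume b: "continuous_on UNIV b" and b': "continuous_on UNIV b'"
      and \<eta>: "\<And>t. 0 \<le> t \<Longrightarrow> t \<le> T \<Longrightarrow> norm (b t - b' t) \<le> \<eta>"
    obtain X where X: "flow b X" "X 0 = 0" using flow_exists[OF b] .
    obtain Y where Y: "flow b' Y" "Y 0 = 0" using flow_exists[OF b'] .
    have "norm (X T - Y T) \<le> exp ((L + 1) * T) * (L * \<eta>)"
    proof (rule ode_perturbation[OF flowD[OF X(1)] flowD[OF Y(1)]])
      show "norm (field (b t) (X t) - field (b' t) (Y t)) \<le> L * norm (X t - Y t) + L * \<eta>" if "0 \<le> t" "t \<le> T" for t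
        using L(2)[of "b t" "X t" "b' t" "Y t"] mult_left_mono[OF \<eta>[OF that], of L] L(1) by linarith
    qed (use L X Y T in auto)
    then have "norm (X T - Y T) * DL \<le> exp ((L + 1) * T) * (L * \<eta>) * DL" using DL(1) by (intro mult_right_mono) auto
    then show "\<bar>displacement T b - displacement T b'\<bar> \<le> exp ((L + 1) * T) * L * DL * \<eta>"
      using DL(2)[of "X T - Y T"] displacement_eq[OF X T] displacement_eq[OF Y T] by (simp add: drift_simps mult_ac)
  qed
qed

end

section \<open>A strong law of large numbers\<close>

text \<open>The sum of all \<open>F m\<close> has finite integral, so it is finite almost everywhere
  and its terms tend to 0.\<close>

lemma AE_tendsto_0_if_summable:
  fixes F :: "nat \<Rightarrow> 'a \<Rightarrow> real"
  assumes int: "\<And>m. integrable M (F m)" and nonneg: "\<And>m x. 0 \<le> F m x"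
    and le: "\<And>m. (\<integral>x. F m x \<partial>M) \<le> b m" and sm: "summable b"
  shows "AE x in M. (\<lambda>m. F m x) \<longlonglongrightarrow> 0"
proof -
  have meas[measurable]: "F m \<in> borel_measurable M" for m using int by (rule borel_measurable_integrable)
  have eq: "(\<integral>\<^sup>+x. ennreal (F m x) \<partial>M) = ennreal (\<integral>x. F m x \<partial>M)" for m
    by (rule nn_integral_eq_integral[OF int]) (simp add: nonneg)
  have b: "0 \<le> b m" for m
    using le[of m] Bochner_Integration.integral_nonneg[of M "F m"] nonneg by (meson order_trans)
  have "(\<integral>\<^sup>+x. (\<Sum>m. ennreal (F m x)) \<partial>M) = (\<Sum>m. \<integral>\<^sup>+x. ennreal (F m x) \<partial>M)"
    by (rule nn_integral_suminf) simp
  also have "\<dots> \<le> (\<Sum>m. ennreal (b m))"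
    unfolding eq by (intro suminf_le ennreal_leI le) auto
  also have "\<dots> = ennreal (\<Sum>m. b m)" by (rule suminf_ennreal2[OF b sm])
  finally have "(\<integral>\<^sup>+x. (\<Sum>m. ennreal (F m x)) \<partial>M) \<noteq> \<infinity>" by (auto simp: top_unique)
  then have "AE x in M. (\<Sum>m. ennreal (F m x)) \<noteq> \<infinity>"
    by (intro nn_integral_PInf_AE) auto
  then show ?thesis
  proof eventually_elim
    case (elim x)
    then have "summable (\<lambda>m. F m x)" using nonneg by (intro summable_suminf_not_top) auto
    then show ?case by (rule summable_LIMSEQ_zero)
  qed
qed

lemma filterlim_floor_sqrt: "filterlim floor_sqrt at_top at_top"
  unfolding filterlim_at_top
proof
  fix Z
  show "\<forall>\<^sub>F n in at_top. Z \<le> floor_sqrt n"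
    using eventually_ge_at_top[of "Z\<^sup>2"]
  proof eventually_elim
    case (elim n)
    then show ?case using mono_floor_sqrt'[OF elim] by simp
  qed
qed

text \<open>Every K lies between consecutive squares, whose quotient tends to 1, and monotonicity
  controls \<open>A\<close> in between.\<close>

lemma Cesaro_limit_from_squares:
  fixes A :: "nat \<Rightarrow> real"
  assumes mono: "mono A" and nn: "\<And>k. 0 \<le> A k" and lim: "(\<lambda>m. A (m\<^sup>2) / (real m)\<^sup>2) \<longlonglongrightarrow> \<mu>"
  shows "(\<lambda>K. A K / K) \<longlonglongrightarrow> \<mu>"
proof (rule tendsto_sandwich)
  define r where "r = floor_sqrt"
  have rK: "(r K)\<^sup>2 \<le> K" "K \<le> (Suc (r K))\<^sup>2" for K
    using floor_sqrt_power2_le[of K] Suc_floor_sqrt_power2_gt[of K] by (auto simp: r_def)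
  have rK': "(real (r K))\<^sup>2 \<le> real K" "real K \<le> (real (Suc (r K)))\<^sup>2" for K
    using rK[of K] by (metis of_nat_le_iff of_nat_power)+
  have frac1: "(\<lambda>m. (real m)\<^sup>2 / (real (Suc m))\<^sup>2) \<longlonglongrightarrow> 1"
    using tendsto_power[OF LIMSEQ_n_over_Suc_n, of 2] by (simp add: power_divide)
  have frac2: "(\<lambda>m. (real (Suc m))\<^sup>2 / (real m)\<^sup>2) \<longlonglongrightarrow> 1"
    using tendsto_power[OF LIMSEQ_Suc_n_over_n, of 2] by (simp add: power_divide)
  have "(\<lambda>m. A (m\<^sup>2) / (real m)\<^sup>2 * ((real m)\<^sup>2 / (real (Suc m))\<^sup>2)) \<longlonglongrightarrow> \<mu> * 1"
    by (intro tendsto_mult lim frac1)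
  then show "(\<lambda>K. A ((r K)\<^sup>2) / (real (r K))\<^sup>2 * ((real (r K))\<^sup>2 / (real (Suc (r K)))\<^sup>2)) \<longlonglongrightarrow> \<mu>"
    using filterlim_compose[OF _ filterlim_floor_sqrt, of _ "nhds \<mu>"] by (simp add: r_def)
  have "(\<lambda>m. A ((Suc m)\<^sup>2) / (real (Suc m))\<^sup>2 * ((real (Suc m))\<^sup>2 / (real m)\<^sup>2)) \<longlonglongrightarrow> \<mu> * 1"
    using LIMSEQ_Suc[OF lim] by (intro tendsto_mult frac2)
  then show "(\<lambda>K. A ((Suc (r K))\<^sup>2) / (real (Suc (r K)))\<^sup>2 * ((real (Suc (r K)))\<^sup>2 / (real (r K))\<^sup>2)) \<longlonglongrightarrow> \<mu>"
    using filterlim_compose[OF _ filterlim_floor_sqrt, of _ "nhds \<mu>"] by (simp add: r_def)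
  have rpos: "eventually (\<lambda>K. 0 < r K) sequentially"
    using eventually_gt_at_top[of 0] by eventually_elim (simp add: r_def)
  show "\<forall>\<^sub>F K in sequentially. A ((r K)\<^sup>2) / (real (r K))\<^sup>2 * ((real (r K))\<^sup>2 / (real (Suc (r K)))\<^sup>2) \<le> A K / K"
    using rpos eventually_gt_at_top[of 0]
  proof eventually_elim
    case (elim K)
    have "A ((r K)\<^sup>2) / (real (Suc (r K)))\<^sup>2 \<le> A K / K"
      using elim nn rK[of K] by (intro frac_le monoD[OF mono] rK') auto
    then show ?case using elim by simp
  qed
  show "\<forall>\<^sub>F K in sequentially. A K / K \<le> A ((Suc (r K))\<^sup>2) / (real (Suc (r K)))\<^sup>2 * ((real (Suc (r K)))\<^sup>2 / (real (r K))\<^sup>2)"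
    using rpos eventually_gt_at_top[of 0]
  proof eventually_elim
    case (elim K)
    have "A K / K \<le> A ((Suc (r K))\<^sup>2) / (real (r K))\<^sup>2"
      using elim nn rK[of K] by (intro frac_le monoD[OF mono] rK') auto
    then show ?case by simp
  qed
qed

text \<open>The mean of the first m^2 terms has variance at most C / m^2, which is summable, so
  convergence holds along squares; nonnegativity makes the partial sums monotone and fills the
  gaps.\<close>

theorem (in prob_space) strong_law_uncorrelated:
  fixes X :: "nat \<Rightarrow> 'a \<Rightarrow> real"
  assumes nn: "\<And>k x. x \<in> space M \<Longrightarrow> 0 \<le> X k x" and int[simp]: "\<And>k. integrable M (X k)" and mean: "\<And>k. expectation (X k) = \<mu>"
    and int2[simp]: "\<And>k. integrable M (\<lambda>x. (X k x)\<^sup>2)" and C: "\<And>k. expectation (\<lambda>x. (X k x)\<^sup>2) \<le> C"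
    and intp: "\<And>k l. k < l \<Longrightarrow> integrable M (\<lambda>x. X k x * X l x)"
    and cov: "\<And>k l. k < l \<Longrightarrow> expectation (\<lambda>x. X k x * X l x) = \<mu>\<^sup>2"
  shows "AE x in M. (\<lambda>K. (\<Sum>k<K. X k x) / K) \<longlonglongrightarrow> \<mu>"
proof -
  have intp': "integrable M (\<lambda>x. X k x * X l x)" for k l
    using intp[of k l] intp[of l k] int2[of k] by (cases k l rule: linorder_cases) (auto simp: mult.commute power2_eq_square)
  define Y where "Y k x = X k x - \<mu>" for k x
  have Yp: "integrable M (\<lambda>x. Y k x * Y l x)" for k l
    using intp' by (simp add: Y_def algebra_simps)
  have EY: "expectation (\<lambda>x. Y k x * Y l x) = expectation (\<lambda>x. X k x * X l x) - \<mu>\<^sup>2" for k l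
    using intp' mean by (simp add: Y_def algebra_simps power2_eq_square prob_space)
  have EYkl: "expectation (\<lambda>x. Y k x * Y l x) \<le> (if k = l then C else 0)" for k l
  proof (cases "k = l")
    case True
    have "expectation (\<lambda>x. X l x * X l x) \<le> C" using C[of l] by (simp add: power2_eq_square)
    then have "expectation (\<lambda>x. X l x * X l x) - \<mu>\<^sup>2 \<le> C" using zero_le_power2[of \<mu>] by linarith
    then show ?thesis unfolding EY by (simp add: True)
  next
    case False
    then show ?thesis using cov[of k l] cov[of l k] unfolding EY
      by (cases k l rule: linorder_cases) (auto simp: mult.commute)
  qed
  define S where "S K x = (\<Sum>k<K. Y k x)" for K x
  have S2: "(S K x)\<^sup>2 = (\<Sum>k<K. \<Sum>l<K. Y k x * Y l x)" for K x
    by (simp add: S_def power2_eq_square sum_product)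
  have S2int: "integrable M (\<lambda>x. (S K x)\<^sup>2)" for K unfolding S2 using Yp by simp
  have "expectation (\<lambda>x. (S K x)\<^sup>2) \<le> K * C" for K
  proof -
    have "expectation (\<lambda>x. (S K x)\<^sup>2) = (\<Sum>k<K. \<Sum>l<K. expectation (\<lambda>x. Y k x * Y l x))"
      unfolding S2 using Yp by simp
    also have "\<dots> \<le> (\<Sum>k<K. \<Sum>l<K. if k = l then C else 0)" by (intro sum_mono EYkl)
    also have "\<dots> = K * C" by (simp add: sum.delta)
    finally show ?thesis .
  qed
  note ES2 = this
  have ES: "expectation (\<lambda>x. (S (m\<^sup>2) x)\<^sup>2) / (real m ^ 4) \<le> C * inverse ((real m)\<^sup>2)" for m
  proof -
    have "expectation (\<lambda>x. (S (m\<^sup>2) x)\<^sup>2) / (real m ^ 4) \<le> real (m\<^sup>2) * C / (real m ^ 4)"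
      by (intro divide_right_mono ES2) auto
    also have "\<dots> = C * inverse ((real m)\<^sup>2)"
      by (cases "m = 0") (auto simp: field_simps power2_eq_square eval_nat_numeral)
    finally show ?thesis .
  qed
  have "AE x in M. (\<lambda>m. (S (m\<^sup>2) x / (real m)\<^sup>2)\<^sup>2) \<longlonglongrightarrow> 0"
  proof (rule AE_tendsto_0_if_summable[where b = "\<lambda>m. C * inverse ((real m)\<^sup>2)"])
    show "integrable M (\<lambda>x. (S (m\<^sup>2) x / (real m)\<^sup>2)\<^sup>2)" for m
      using S2int by (simp add: power_divide)
    show "expectation (\<lambda>x. (S (m\<^sup>2) x / (real m)\<^sup>2)\<^sup>2) \<le> C * inverse ((real m)\<^sup>2)" for m
      using ES[of m] by (simp add: power_divide flip: power_mult)
    show "summable (\<lambda>m. C * inverse ((real m)\<^sup>2))"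
      by (intro summable_mult inverse_power_summable) simp
  qed simp
  then show ?thesis
    using AE_space
  proof eventually_elim
    case (elim x)
    have "(\<lambda>m. S (m\<^sup>2) x / (real m)\<^sup>2) \<longlonglongrightarrow> 0"
      using elim(1) tendsto_real_sqrt[of _ 0] by (fastforce simp: tendsto_rabs_zero_iff simp flip: real_sqrt_abs)
    then have "(\<lambda>m. S (m\<^sup>2) x / (real m)\<^sup>2 + \<mu>) \<longlonglongrightarrow> 0 + \<mu>" by (intro tendsto_intros)
    moreover have "eventually (\<lambda>m. S (m\<^sup>2) x / (real m)\<^sup>2 + \<mu> = (\<Sum>k<m\<^sup>2. X k x) / (real m)\<^sup>2) sequentially"
      using eventually_gt_at_top[of 0]
      by eventually_elim (simp add: S_def Y_def sum_subtractf field_simps)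
    ultimately have "(\<lambda>m. (\<Sum>k<m\<^sup>2. X k x) / (real m)\<^sup>2) \<longlonglongrightarrow> \<mu>"
      by (simp add: tendsto_cong)
    then show ?case
      by (intro Cesaro_limit_from_squares[where A = "\<lambda>K. \<Sum>k<K. X k x"]) (auto intro!: monoI sum_mono2 sum_nonneg nn elim)
  qed
qed

section \<open>Functionals of the noise on time blocks\<close>

locale wiener_noise =
  fixes W :: "(real \<Rightarrow> real) measure" and P :: "('i::finite \<Rightarrow> real \<Rightarrow> real) measure"
  assumes W: "two_sided_wiener_measure W" and P_def: "P = Pi\<^sub>M UNIV (\<lambda>_. W)"
begin

sublocale W: prob_space W using W by (simp add: two_sided_wiener_measure_def)
sublocale FP: finite_product_prob_space "\<lambda>_. W" "UNIV :: 'i set" by unfold_locales simp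
sublocale P: prob_space P unfolding P_def by (rule prob_space_PiM) unfold_locales

lemma path_continuous: "\<omega> \<in> space P \<Longrightarrow> continuous_on S (\<omega> j)"
  using W by (auto simp: P_def space_PiM PiE_iff two_sided_wiener_measure_def path_space_def intro: continuous_on_subset)

lemma path_0: "\<omega> \<in> space P \<Longrightarrow> \<omega> j 0 = 0"
  using W by (auto simp: P_def space_PiM PiE_iff two_sided_wiener_measure_def path_space_def)

lemma increment_measurable_W: "s < t \<Longrightarrow> (\<lambda>w. w t - w s) \<in> borel_measurable W"
  using W distributed_measurable[of W lborel "\<lambda>w. w t - w s" "\<lambda>x. ennreal (normal_density 0 (sqrt (t - s)) x)"]
  by (auto simp: two_sided_wiener_measure_def)

lemma component_measurable: "(\<lambda>\<omega>. \<omega> j) \<in> measurable P W"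
  unfolding P_def by (rule measurable_component_singleton) simp

lemma increment_measurable: "s < t \<Longrightarrow> (\<lambda>\<omega>. \<omega> j t - \<omega> j s) \<in> borel_measurable P"
  using measurable_compose[OF component_measurable increment_measurable_W] .

lemma distr_component: "distr P W (\<lambda>\<omega>. \<omega> j) = W"
  unfolding P_def by (rule distr_PiM_component) (auto intro: W.prob_space_axioms)

lemma distr_increment:
  assumes "s < t"
  shows "distr P borel (\<lambda>\<omega>. \<omega> j t - \<omega> j s) = density lborel (\<lambda>x. ennreal (normal_density 0 (sqrt (t - s)) x))"
proof -
  have "distr P borel ((\<lambda>w. w t - w s) \<circ> (\<lambda>\<omega>. \<omega> j)) = distr (distr P W (\<lambda>\<omega>. \<omega> j)) borel (\<lambda>w. w t - w s)"
    by (rule distr_distr[symmetric]) (use increment_measurable_W[OF assms] component_measurable in auto)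
  also have "\<dots> = distr W lborel (\<lambda>w. w t - w s)" unfolding distr_component by (rule distr_cong) auto
  also have "\<dots> = density lborel (\<lambda>x. ennreal (normal_density 0 (sqrt (t - s)) x))"
    using W assms by (auto simp: two_sided_wiener_measure_def distributed_def)
  finally show ?thesis by (simp add: comp_def)
qed

text \<open>The exponent 2 of the length is what chaining lives on: summed over 2^k intervals of
  length T / 2^k it still decays geometrically in k.\<close>

lemma increment_fourth_moment:
  assumes "s < t"
  shows "(\<integral>\<^sup>+\<omega>. ennreal ((\<omega> j t - \<omega> j s) ^ 4) \<partial>P) = ennreal (3 * (t - s)\<^sup>2)"
proof -
  let ?n = "normal_density 0 (sqrt (t - s))"
  have "(\<integral>\<^sup>+\<omega>. ennreal ((\<omega> j t - \<omega> j s) ^ 4) \<partial>P) = (\<integral>\<^sup>+x. ennreal (x ^ 4) \<partial>distr P borel (\<lambda>\<omega>. \<omega> j t - \<omega> j s))"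
    by (subst nn_integral_distr) (auto intro: increment_measurable[OF assms])
  also have "\<dots> = (\<integral>\<^sup>+x. ennreal (?n x * x ^ 4) \<partial>lborel)"
    unfolding distr_increment[OF assms] by (subst nn_integral_density) (auto simp: ennreal_mult)
  also have "\<dots> = ennreal (3 * (t - s)\<^sup>2)"
  proof (rule nn_integral_eq_integrable[THEN iffD2])
    have "has_bochner_integral lborel (\<lambda>x. ?n x * (x - 0) ^ (2 * 2)) (fact (2 * 2) / ((2 / (sqrt (t - s))\<^sup>2) ^ 2 * fact 2))"
      by (rule normal_moment_even) (use assms in simp)
    moreover have "fact (2 * 2) / ((2 / (sqrt (t - s))\<^sup>2) ^ 2 * fact 2) = 3 * (t - s)\<^sup>2"
      using assms by (simp add: fact_numeral power_divide)
    ultimately show "integrable lborel (\<lambda>x. ?n x * x ^ 4) \<and> integral\<^sup>L lborel (\<lambda>x. ?n x * x ^ 4) = 3 * (t - s)\<^sup>2"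
      by (simp add: has_bochner_integral_iff)
  qed auto
  finally show ?thesis .
qed

definition grid_incr :: "real \<Rightarrow> real \<Rightarrow> nat \<times> 'i \<Rightarrow> ('i \<Rightarrow> real \<Rightarrow> real) \<Rightarrow> real" where
  "grid_incr h s = (\<lambda>(i, j) \<omega>. \<omega> j (s + real (Suc i) * h) - \<omega> j (s + real i * h))"

lemma grid_incr_measurable: "0 < h \<Longrightarrow> grid_incr h s p \<in> borel_measurable P"
  unfolding grid_incr_def by (cases p) (auto intro!: increment_measurable)

text \<open>Independence over time cells comes from the Wiener measure and over coordinates from the
  product measure; the joint probability is factored first over j, then over i.\<close>

lemma indep_grid_incr:
  assumes h: "0 < h" and n: "0 < n"
  shows "P.indep_vars (\<lambda>_. borel) (grid_incr h s) ({..<n} \<times> UNIV)"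
proof (subst P.indep_vars_finite[where E = "\<lambda>_. sets borel"])
  let ?z = "\<lambda>i w. w (s + real (Suc i) * h) - w (s + real i * h) :: real"
  have "strict_mono_on {..n} (\<lambda>i. s + real i * h)" using h by (auto intro!: strict_mono_onI)
  then have indW: "W.indep_vars (\<lambda>_. borel) ?z {..<n}"
    using W unfolding two_sided_wiener_measure_def by blast
  have zm: "?z i \<in> borel_measurable W" for i using h by (intro increment_measurable_W) auto
  have spP: "space P = (\<Pi>\<^sub>E j\<in>UNIV. space W)" by (simp add: P_def space_PiM)
  show "\<forall>A\<in>({..<n} \<times> UNIV) \<rightarrow> sets borel. P.prob (\<Inter>p\<in>{..<n} \<times> UNIV. grid_incr h s p -` A p \<inter> space P)
      = (\<Prod>p\<in>{..<n} \<times> UNIV. P.prob (grid_incr h s p -` A p \<inter> space P))"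
  proof safe
    fix A :: "nat \<times> 'i \<Rightarrow> real set" assume A: "A \<in> ({..<n} \<times> UNIV) \<rightarrow> sets borel"
    have Ab: "A (i, j) \<in> sets borel" if "i < n" for i j using A that by auto
    have sing: "P.prob (grid_incr h s (i, j) -` A (i, j) \<inter> space P) = W.prob (?z i -` A (i, j) \<inter> space W)" if "i < n" for i j
    proof -
      have "W.prob (?z i -` A (i, j) \<inter> space W) = measure (distr P W (\<lambda>\<omega>. \<omega> j)) (?z i -` A (i, j) \<inter> space W)"
        by (simp only: distr_component)
      also have "\<dots> = P.prob ((\<lambda>\<omega>. \<omega> j) -` (?z i -` A (i, j) \<inter> space W) \<inter> space P)"
        using measurable_sets[OF zm Ab[OF that]] by (intro measure_distr component_measurable)
      also have "(\<lambda>\<omega>. \<omega> j) -` (?z i -` A (i, j) \<inter> space W) \<inter> space P = grid_incr h s (i, j) -` A (i, j) \<inter> space P"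
        by (auto simp: grid_incr_def spP)
      finally show ?thesis ..
    qed
    have ne: "{..<n} \<noteq> {}" using n by auto
    have "(\<Inter>p\<in>{..<n} \<times> UNIV. grid_incr h s p -` A p \<inter> space P) = (\<Pi>\<^sub>E j\<in>UNIV. \<Inter>i\<in>{..<n}. ?z i -` A (i, j) \<inter> space W)"
      using ne by (auto simp: grid_incr_def spP PiE_iff) 
    also have "P.prob \<dots> = (\<Prod>j\<in>UNIV. W.prob (\<Inter>i\<in>{..<n}. ?z i -` A (i, j) \<inter> space W))"
      unfolding P_def
    proof (rule FP.prob_times)
      show "(\<Inter>i\<in>{..<n}. ?z i -` A (i, j) \<inter> space W) \<in> W.events" for j
        by (intro sets.finite_INT measurable_sets[OF zm Ab]) (use ne in auto)
    qed
    also have "\<dots> = (\<Prod>j\<in>UNIV. \<Prod>i<n. W.prob (?z i -` A (i, j) \<inter> space W))"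
      using ne Ab by (intro prod.cong refl W.indep_varsD_finite[OF indW]) auto
    also have "\<dots> = (\<Prod>j\<in>UNIV. \<Prod>i<n. P.prob (grid_incr h s (i, j) -` A (i, j) \<inter> space P))"
      using sing by (intro prod.cong) auto
    also have "\<dots> = (\<Prod>p\<in>{..<n} \<times> UNIV. P.prob (grid_incr h s p -` A p \<inter> space P))"
      by (subst prod.swap) (simp add: prod.cartesian_product split_beta)
    finally show "P.prob (\<Inter>p\<in>{..<n} \<times> UNIV. grid_incr h s p -` A p \<inter> space P)
      = (\<Prod>p\<in>{..<n} \<times> UNIV. P.prob (grid_incr h s p -` A p \<inter> space P))" .
  qed
qed (use n h in \<open>auto simp: grid_incr_measurable Int_stable_def sets.sigma_sets_eq[of borel, simplified]\<close>)

text \<open>The right-hand side does not contain \<open>s\<close>: this is the stationarity of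
  increments in the form used for comparing blocks.\<close>

lemma distr_grid_incr:
  assumes h: "0 < h" and n: "0 < n"
  shows "distr P (\<Pi>\<^sub>M p\<in>{..<n} \<times> UNIV. borel) (\<lambda>\<omega>. \<lambda>p\<in>{..<n} \<times> UNIV. grid_incr h s p \<omega>)
    = (\<Pi>\<^sub>M p\<in>{..<n} \<times> UNIV. density lborel (\<lambda>x. ennreal (normal_density 0 (sqrt h) x)))"
proof -
  have "distr P (\<Pi>\<^sub>M p\<in>{..<n} \<times> UNIV. borel) (\<lambda>\<omega>. \<lambda>p\<in>{..<n} \<times> UNIV. grid_incr h s p \<omega>)
    = (\<Pi>\<^sub>M p\<in>{..<n} \<times> UNIV. distr P borel (grid_incr h s p))"
    using indep_grid_incr[OF assms] n by (intro P.indep_vars_iff_distr_eq_PiM[THEN iffD1] grid_incr_measurable h) auto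
  moreover have "distr P borel (grid_incr h s p) = density lborel (\<lambda>x. ennreal (normal_density 0 (sqrt h) x))" for p
    using distr_increment[of "s + real (fst p) * h" "s + real (Suc (fst p)) * h" "snd p"] h
    by (simp add: grid_incr_def split_beta algebra_simps)
  ultimately show ?thesis by simp
qed

lemma nn_integral_grid_incr_fourth:
  assumes "0 < h"
  shows "(\<integral>\<^sup>+\<omega>. ennreal ((grid_incr h s p \<omega>) ^ 4) \<partial>P) = ennreal (3 * h\<^sup>2)"
  using increment_fourth_moment[of "s + real (fst p) * h" "s + real (Suc (fst p)) * h" "snd p"] assms
  by (simp add: grid_incr_def split_beta algebra_simps)

end

section \<open>Interpolation on a grid and Lipschitz functionals of the path\<close>

text \<open>The interpolation of the path that starts at \<open>0\<close> and has increment \<open>D i\<close> over \<open>[i * h, (i + 1) * h]\<close>.\<close>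

definition pw_linear :: "real \<Rightarrow> nat \<Rightarrow> (nat \<Rightarrow> 'v::real_normed_vector) \<Rightarrow> real \<Rightarrow> 'v" where
  "pw_linear h m D t = (\<Sum>i<m. max 0 (min 1 (t / h - real i)) *\<^sub>R D i)"

lemma continuous_pw_linear: "continuous_on S (pw_linear h m D)"
  unfolding pw_linear_def divide_inverse by (intro continuous_intros)

lemma norm_pw_linear_diff: "norm (pw_linear h m D t - pw_linear h m D' t) \<le> (\<Sum>i<m. norm (D i - D' i))"
proof -
  have "pw_linear h m D t - pw_linear h m D' t = (\<Sum>i<m. max 0 (min 1 (t / h - real i)) *\<^sub>R (D i - D' i))"
    by (simp add: pw_linear_def sum_subtractf scaleR_diff_right)
  also have "norm \<dots> \<le> (\<Sum>i<m. norm (D i - D' i))"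
    by (intro sum_norm_le) (auto simp: intro!: mult_left_le_one_le)
  finally show ?thesis .
qed

lemma pw_linear_interpolates:
  assumes h: "0 < h" and i: "i < m" and \<theta>: "0 \<le> \<theta>" "\<theta> \<le> 1" and w: "w 0 = 0"
  shows "pw_linear h m (\<lambda>k. w (real (Suc k) * h) - w (real k * h)) ((real i + \<theta>) * h) =
    w (real i * h) + \<theta> *\<^sub>R (w (real (Suc i) * h) - w (real i * h))"
proof -
  let ?D = "\<lambda>k. w (real (Suc k) * h) - w (real k * h)"
  \<comment> \<open>The coefficient of cell k is the fraction of it already traversed: all, a part
    \<theta>, or nothing.\<close>
  have coeff: "max 0 (min 1 (real i + \<theta> - real k)) = (if k < i then 1 else if k = i then \<theta> else 0)" for k
    using \<theta> by (cases k i rule: linorder_cases) (auto simp: max_def min_def)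
  have "pw_linear h m ?D ((real i + \<theta>) * h) = (\<Sum>k<m. (if k < i then ?D k else if k = i then \<theta> *\<^sub>R ?D k else 0))"
    unfolding pw_linear_def using h by (intro sum.cong) (simp_all add: coeff)
  also have "\<dots> = (\<Sum>k<Suc i. (if k < i then ?D k else if k = i then \<theta> *\<^sub>R ?D k else 0))"
    using i by (intro sum.mono_neutral_right) auto
  also have "\<dots> = (\<Sum>k<i. ?D k) + \<theta> *\<^sub>R ?D i" by simp
  also have "(\<Sum>k<i. ?D k) = w (real i * h)"
    using sum_lessThan_telescope[of "\<lambda>k. w (real k * h)" i] w by simp
  finally show ?thesis by simp
qed

lemma partition_point:
  fixes T :: real
  assumes T: "0 < T" and m: "0 < m" and t: "0 \<le> t" "t \<le> T"
  obtains i \<theta> where "i < m" "0 \<le> \<theta>" "\<theta> \<le> 1" "t = (real i + \<theta>) * (T / real m)"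
proof -
  define q where "q = t / (T / real m)"
  have q: "0 \<le> q" "q \<le> real m" "t = q * (T / real m)" using assms by (auto simp: q_def field_simps)
  show ?thesis
  proof (cases "q < real m")
    case True
    have "real (nat \<lfloor>q\<rfloor>) = of_int \<lfloor>q\<rfloor>" using q by simp
    moreover have "nat \<lfloor>q\<rfloor> < m" using True q by linarith
    ultimately show ?thesis using q by (intro that[of "nat \<lfloor>q\<rfloor>" "q - of_int \<lfloor>q\<rfloor>"]) (auto, linarith+)
  next
    case False
    \<comment> \<open>The end point t = T is assigned to the last cell.\<close>
    then show ?thesis using q m by (intro that[of "m - 1" 1]) (auto simp: of_nat_diff)
  qed
qed

text \<open>On each cell the interpolation is a convex combination of two grid values of the
  path.\<close>

lemma norm_pw_linear_le:
  fixes w :: "real \<Rightarrow> 'v::real_normed_vector"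
  assumes T: "0 < T" and m: "0 < m" and t: "0 \<le> t" "t \<le> T" and w: "w 0 = 0"
    and S: "\<And>r. 0 \<le> r \<Longrightarrow> r \<le> T \<Longrightarrow> norm (w r) \<le> S"
  shows "norm (pw_linear (T / m) m (\<lambda>k. w (real (Suc k) * (T / m)) - w (real k * (T / m))) t) \<le> S"
proof -
  define h where "h = T / m"
  have h: "0 < h" "real m * h = T" using T m by (auto simp: h_def)
  obtain i \<theta> where i: "i < m" "0 \<le> \<theta>" "\<theta> \<le> 1" "t = (real i + \<theta>) * h"
    using partition_point[OF T m t] unfolding h_def .
  have le: "real i * h \<le> T" "real (Suc i) * h \<le> T" 
    using i(1) h mult_right_mono[of "real i" "real m" h] mult_right_mono[of "real (Suc i)" "real m" h] by auto
  have "pw_linear h m (\<lambda>k. w (real (Suc k) * h) - w (real k * h)) t = (1 - \<theta>) *\<^sub>R w (real i * h) + \<theta> *\<^sub>R w (real (Suc i) * h)"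
    unfolding i(4) using pw_linear_interpolates[where w = w, OF h(1) i(1-3) w] by (simp add: algebra_simps)
  also have "norm \<dots> \<le> (1 - \<theta>) * norm (w (real i * h)) + \<theta> * norm (w (real (Suc i) * h))"
    by (rule norm_triangle_le) (use i in simp)
  also have "\<dots> \<le> (1 - \<theta>) * S + \<theta> * S"
    using i h le by (intro add_mono mult_left_mono S) auto
  finally show ?thesis by (simp add: h_def algebra_simps)
qed

lemma pw_linear_converges:
  fixes w :: "real \<Rightarrow> 'v::real_normed_vector"
  assumes T: "0 < T" and w: "w 0 = 0" and cont: "continuous_on UNIV w" and e: "0 < e"
  shows "\<forall>\<^sub>F m in sequentially. \<forall>t. 0 \<le> t \<longrightarrow> t \<le> T \<longrightarrow>
    norm (pw_linear (T / m) m (\<lambda>k. w (real (Suc k) * (T / m)) - w (real k * (T / m))) t - w t) \<le> e"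
proof -
  have "uniformly_continuous_on {0..T} w"
    by (intro compact_uniformly_continuous continuous_on_subset[OF cont]) auto
  then obtain d where d: "0 < d" "\<And>x y. x \<in> {0..T} \<Longrightarrow> y \<in> {0..T} \<Longrightarrow> dist y x < d \<Longrightarrow> dist (w y) (w x) < e / 2"
    unfolding uniformly_continuous_on_def using e by (meson half_gt_zero)
  obtain M where M: "T / d < real M" using reals_Archimedean2 by blast
  have main: "norm (pw_linear (T / m) m (\<lambda>k. w (real (Suc k) * (T / m)) - w (real k * (T / m))) t - w t) \<le> e"
    if m: "Suc M \<le> m" and t: "0 \<le> t" "t \<le> T" for m t
  proof -
    define h where "h = T / m"
    have m0: "0 < m" using m by simp
    have h: "0 < h" "real m * h = T" using T m0 by (auto simp: h_def)
    have "T / d < real m" using M m by linarith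
    then have hd: "h < d" using d(1) m0 by (simp add: h_def field_simps)
    obtain i \<theta> where i: "i < m" "0 \<le> \<theta>" "\<theta> \<le> 1" "t = (real i + \<theta>) * h"
      using partition_point[OF T m0 t] unfolding h_def .
    have le: "real i * h \<le> T" "real (Suc i) * h \<le> T" 
      using i(1) h mult_right_mono[of "real i" "real m" h] mult_right_mono[of "real (Suc i)" "real m" h] by auto
    have \<theta>h: "0 \<le> \<theta> * h" "\<theta> * h \<le> h" using i h by auto
    have 1: "norm (w (real i * h) - w t) \<le> e / 2"
      using d(2)[of t "real i * h"] t le h hd i \<theta>h by (auto simp: dist_norm algebra_simps intro: less_imp_le)
    have 2: "norm (w (real (Suc i) * h) - w (real i * h)) \<le> e / 2"
      using d(2)[of "real i * h" "real (Suc i) * h"] le h hd by (auto simp: dist_norm algebra_simps intro: less_imp_le)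
    have "pw_linear h m (\<lambda>k. w (real (Suc k) * h) - w (real k * h)) t - w t = (w (real i * h) - w t) + \<theta> *\<^sub>R (w (real (Suc i) * h) - w (real i * h))"
      using pw_linear_interpolates[where w = w, OF h(1) i(1-3) w] i(4) by simp
    also have "norm \<dots> \<le> norm (w (real i * h) - w t) + \<theta> * norm (w (real (Suc i) * h) - w (real i * h))"
      by (rule norm_triangle_le) (use i in simp)
    also have "\<dots> \<le> e / 2 + 1 * (e / 2)"
      using 1 2 i e by (intro add_mono mult_mono) auto
    finally show ?thesis by (simp add: h_def)
  qed
  show ?thesis using eventually_ge_at_top[of "Suc M"] by eventually_elim (use main in auto)
qed

text \<open>Lipschitz for the supremum over [0, T], phrased with an arbitrary bound \<eta> in place
  of a supremum. The case \<eta> = 0 shows that such a functional does not see a continuous path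
  outside [0, T].\<close>

definition sup_lip :: "real \<Rightarrow> real \<Rightarrow> ((real \<Rightarrow> real ^ 'i::finite) \<Rightarrow> real) \<Rightarrow> bool" where
  "sup_lip T L H \<longleftrightarrow> 0 \<le> L \<and> (\<forall>w w' \<eta>. continuous_on UNIV w \<longrightarrow> continuous_on UNIV w' \<longrightarrow>
     (\<forall>t. 0 \<le> t \<longrightarrow> t \<le> T \<longrightarrow> norm (w t - w' t) \<le> \<eta>) \<longrightarrow> \<bar>H w - H w'\<bar> \<le> L * \<eta>)"

lemma sup_lipD:
  assumes "sup_lip T L H" "continuous_on UNIV w" "continuous_on UNIV w'"
    "\<And>t. 0 \<le> t \<Longrightarrow> t \<le> T \<Longrightarrow> norm (w t - w' t) \<le> \<eta>"
  shows "\<bar>H w - H w'\<bar> \<le> L * \<eta>"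
  using assms unfolding sup_lip_def by blast

definition sup_norm :: "real \<Rightarrow> (real \<Rightarrow> real ^ 'i::finite) \<Rightarrow> real" where
  "sup_norm T w = (SUP t\<in>{0..T}. norm (w t))"

lemma sup_norm_ge:
  fixes T :: real
  assumes "continuous_on UNIV w" "0 \<le> t" "t \<le> T"
  shows "norm (w t) \<le> sup_norm T w"
proof -
  have "compact ((\<lambda>t. norm (w t)) ` {0..T})"
    by (intro compact_continuous_image continuous_intros continuous_on_subset[OF assms(1)]) auto
  then have "bdd_above ((\<lambda>t. norm (w t)) ` {0..T})" by (rule bounded_imp_bdd_above[OF compact_imp_bounded])
  then show ?thesis unfolding sup_norm_def using assms by (intro cSUP_upper) auto
qed

lemma sup_norm_le:
  fixes T :: real
  assumes "0 \<le> T" "\<And>t. 0 \<le> t \<Longrightarrow> t \<le> T \<Longrightarrow> norm (w t) \<le> S"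
  shows "sup_norm T w \<le> S"
  unfolding sup_norm_def using assms by (intro cSUP_least) auto

lemma sup_norm_nonneg: "continuous_on UNIV w \<Longrightarrow> 0 \<le> (T::real) \<Longrightarrow> 0 \<le> sup_norm T w"
  using sup_norm_ge[of w 0 T] norm_ge_zero order_trans by blast

lemma sup_lip_sup_norm:
  fixes T :: real
  assumes "0 \<le> T"
  shows "sup_lip T 1 (sup_norm T)"
proof -
  have "sup_norm T w \<le> sup_norm T w' + \<eta>"
    if "continuous_on UNIV w'" "\<And>t. 0 \<le> t \<Longrightarrow> t \<le> T \<Longrightarrow> norm (w t - w' t) \<le> \<eta>" for w w' :: "real \<Rightarrow> real ^ 'i" and \<eta>
    using assms
  proof (rule sup_norm_le)
    fix t assume t: "0 \<le> t" "t \<le> T"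
    show "norm (w t) \<le> sup_norm T w' + \<eta>"
      using sup_norm_ge[OF that(1) t] that(2)[OF t] norm_triangle_sub[of "w t" "w' t"] by linarith
  qed
  note * = this
  show ?thesis unfolding sup_lip_def
  proof (intro conjI allI impI)
    fix w w' :: "real \<Rightarrow> real ^ 'i" and \<eta>
    assume "continuous_on UNIV w" "continuous_on UNIV w'" and le: "\<forall>t\<ge>0. t \<le> T \<longrightarrow> norm (w t - w' t) \<le> \<eta>"
    then show "\<bar>sup_norm T w - sup_norm T w'\<bar> \<le> 1 * \<eta>"
      using *[of w' w \<eta>] *[of w w' \<eta>] by (simp add: norm_minus_commute abs_le_iff)
  qed simp
qed

text \<open>A functional of the path that is Lipschitz for the supremum norm is a limit of continuous functions
  of finitely many increments.\<close>

lemma sup_lip_pw_linear_measurable: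
  fixes H :: "(real \<Rightarrow> real ^ 'i::finite) \<Rightarrow> real"
  assumes H: "sup_lip T L H"
  shows "(\<lambda>d. H (pw_linear h m (\<lambda>i. \<chi> j. d (i, j)))) \<in> borel_measurable (\<Pi>\<^sub>M p\<in>UNIV. borel)"
proof -
  define \<Gamma> where "\<Gamma> d = H (pw_linear h m (\<lambda>i. \<chi> j. d (i, j)))" for d
  have le: "\<bar>\<Gamma> d - \<Gamma> d'\<bar> \<le> L * (\<Sum>i<m. \<Sum>j\<in>UNIV. \<bar>d (i, j) - d' (i, j)\<bar>)" for d d'
    unfolding \<Gamma>_def
  proof (rule sup_lipD[OF H continuous_pw_linear continuous_pw_linear order_trans[OF norm_pw_linear_diff sum_mono]])
    show "norm ((\<chi> j. d (i, j)) - (\<chi> j. d' (i, j))) \<le> (\<Sum>j\<in>UNIV. \<bar>d (i, j) - d' (i, j)\<bar>)" for i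
      using norm_le_l1_cart[of "(\<chi> j. d (i, j)) - (\<chi> j. d' (i, j))"] by simp
  qed
  have "continuous_on UNIV \<Gamma>"
    unfolding continuous_on_def
  proof
    fix d0 :: "nat \<times> 'i \<Rightarrow> real"
    have "((\<lambda>d. d p) \<longlongrightarrow> d0 p) (at d0)" for p
      using continuous_on_product_coordinates[of p] by (auto simp: continuous_on_def)
    then have "((\<lambda>d. L * (\<Sum>i<m. \<Sum>j\<in>UNIV. \<bar>d (i, j) - d0 (i, j)\<bar>)) \<longlongrightarrow> L * (\<Sum>i<m. \<Sum>j\<in>UNIV. \<bar>d0 (i, j) - d0 (i, j)\<bar>)) (at d0)"
      by (intro tendsto_intros)
    then have g0: "((\<lambda>d. L * (\<Sum>i<m. \<Sum>j\<in>UNIV. \<bar>d (i, j) - d0 (i, j)\<bar>)) \<longlongrightarrow> 0) (at d0)" by simp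
    have "\<forall>\<^sub>F d in at d0. norm (\<Gamma> d - \<Gamma> d0) \<le> L * (\<Sum>i<m. \<Sum>j\<in>UNIV. \<bar>d (i, j) - d0 (i, j)\<bar>)"
      using le[of _ d0] by (intro always_eventually allI) simp
    from Lim_null_comparison[OF this g0] have "((\<lambda>d. \<Gamma> d - \<Gamma> d0) \<longlongrightarrow> 0) (at d0)" .
    then show "(\<Gamma> \<longlongrightarrow> \<Gamma> d0) (at d0)" by (simp add: LIM_zero_iff)
  qed
  then have "\<Gamma> \<in> borel_measurable borel" by (rule borel_measurable_continuous_onI)
  \<comment> \<open>The index set is countable, so the product sigma-algebra is the Borel one of the
    product topology.\<close>
  then show ?thesis
    unfolding \<Gamma>_def[abs_def] using measurable_cong_sets[OF sets_PiM_equal_borel refl] by blast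
qed

text \<open>Reindexing by \<open>r\<close> and padding with 0 carries a finite family of increments
  to the full index set on which the interpolated functional is known to be measurable.\<close>

lemma restrict_measurable_UNIV:
  "(\<lambda>x p. if p \<in> I then x (r p) else 0) \<in> measurable (\<Pi>\<^sub>M p\<in>J. borel) (\<Pi>\<^sub>M p\<in>UNIV. borel :: real measure)"
  if "r ` I \<subseteq> J"
proof (rule measurable_PiM_single')
  show "(\<lambda>x. if p \<in> I then x (r p) else 0) \<in> borel_measurable (\<Pi>\<^sub>M p\<in>J. borel :: real measure)" for p
    using that by (cases "p \<in> I") (auto intro!: measurable_component_singleton)
qed auto

section \<open>Chaining bound for the supremum of a path\<close>

lemma le_power4_div:
  fixes x u :: real
  assumes "0 < u"
  shows "x\<^sup>2 \<le> u + x ^ 4 / u"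
proof -
  have "u * x\<^sup>2 \<le> u\<^sup>2 + (x\<^sup>2)\<^sup>2"
  proof -
    have "2 * (u * x\<^sup>2) \<le> u\<^sup>2 + (x\<^sup>2)\<^sup>2" using sum_squares_bound[of u "x\<^sup>2"] by (simp only: mult.assoc)
    moreover have "0 \<le> u * x\<^sup>2" using assms by simp
    ultimately show ?thesis by linarith
  qed
  then show ?thesis using assms by (simp add: field_simps power2_eq_square eval_nat_numeral)
qed

lemma ennreal_affine: "0 \<le> x \<Longrightarrow> 0 \<le> c \<Longrightarrow> 0 \<le> y \<Longrightarrow> ennreal (x + c * y) = ennreal x + ennreal c * ennreal y"
  by (simp add: ennreal_plus ennreal_mult)

text \<open>A new point of level n + 1 lies one step of that level to the right of a point of level
  n, so each level is paid for at most once.\<close>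

lemma dyadic_chaining:
  fixes w :: "real \<Rightarrow> real"
  assumes incr: "\<And>k i. i < 2 ^ k \<Longrightarrow> \<bar>w (real (Suc i) / 2 ^ k) - w (real i / 2 ^ k)\<bar> \<le> b k"
    and b: "\<And>k. 0 \<le> b k" and i: "i \<le> 2 ^ n"
  shows "\<bar>w (real i / 2 ^ n) - w 0\<bar> \<le> (\<Sum>k\<le>n. b k)"
  using i
proof (induction n arbitrary: i)
  case 0
  then have "i = 0 \<or> i = 1" by auto
  then show ?case using incr[of 0 0] b[of 0] by auto
next
  case (Suc n)
  have half: "real (2 * l) / 2 ^ Suc n = real l / 2 ^ n" for l by simp
  show ?case
  proof (cases "even i")
    case True
    then obtain l where l: "i = 2 * l" by blast
    have "l \<le> 2 ^ n" using Suc.prems l by simp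
    then show ?thesis unfolding l half using Suc.IH[of l] b[of "Suc n"] by simp
  next
    case False
    then obtain l where l: "i = Suc (2 * l)" by (metis oddE Suc_eq_plus1)
    have "\<bar>w (real (2 * l) / 2 ^ Suc n) - w 0\<bar> \<le> (\<Sum>k\<le>n. b k)"
      unfolding half using Suc.IH[of l] Suc.prems l by simp
    moreover have "\<bar>w (real i / 2 ^ Suc n) - w (real (2 * l) / 2 ^ Suc n)\<bar> \<le> b (Suc n)"
      unfolding l using Suc.prems l by (intro incr) simp
    ultimately show ?thesis by simp
  qed
qed

text \<open>The factor 5 bounds the sum of the weights (4/5)^k, and 125/64 is (5/4)^3. For Brownian
  increments the level-k sum of fourth powers has expectation 3 T^2 / 2^k, which turns 125/64 into
  the summable ratio 125/128.\<close>

definition chain_term :: "real \<Rightarrow> (real \<Rightarrow> real) \<Rightarrow> nat \<Rightarrow> real" where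
  "chain_term T w k = 5 * (T * (4/5) ^ k + (125/64) ^ k * (\<Sum>i<2^k. (w (real (Suc i) * (T / 2 ^ k)) - w (real i * (T / 2 ^ k))) ^ 4) / T)"

lemma chain_term_nonneg: "0 < (T::real) \<Longrightarrow> 0 \<le> chain_term T w k"
  by (auto simp: chain_term_def intro!: add_nonneg_nonneg mult_nonneg_nonneg divide_nonneg_pos sum_nonneg)

text \<open>The level-\<open>k\<close> increments are bounded by \<open>b k\<close>, where \<open>(b k)\<^sup>2 / (4/5) ^ k\<close> involves only fourth powers of
  increments; Cauchy--Schwarz with weights \<open>(4/5) ^ k\<close> sums the levels. Any ratio strictly between
  \<open>(1/2) powr (1/3)\<close> and \<open>1\<close> would do.\<close>

lemma chain_bound:
  fixes w :: "real \<Rightarrow> real"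
  assumes T: "0 < T" and i: "i \<le> 2 ^ n"
  shows "(w (real i * (T / 2 ^ n)) - w 0)\<^sup>2 \<le> (\<Sum>k\<le>n. chain_term T w k)"
proof -
  define r :: real where "r = 4/5"
  define S where "S k = (\<Sum>i<2^k. (w (real (Suc i) * (T / 2 ^ k)) - w (real i * (T / 2 ^ k))) ^ 4)" for k :: nat
  \<comment> \<open>With this choice (b k)^2 / r^k equals T r^k + S k / (T r^(3k)), the two parts of
    \<open>chain_term\<close>.\<close>
  define u where "u k = T * (r ^ k)\<^sup>2" for k
  have u: "0 < u k" for k using T by (simp add: u_def r_def)
  have S: "0 \<le> S k" for k unfolding S_def by (intro sum_nonneg) simp
  define b where "b k = sqrt (u k + S k / u k)" for k
  have b2: "(b k)\<^sup>2 = u k + S k / u k" for k using u[of k] S[of k] by (simp add: b_def)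
  have gap_shift: "0 \<le> b k" for k using u[of k] S[of k] by (simp add: b_def)
  have "\<bar>w (real (Suc l) / 2 ^ k * T) - w (real l / 2 ^ k * T)\<bar> \<le> b k" if "l < 2 ^ k" for k l
  proof -
    let ?x = "w (real (Suc l) * (T / 2 ^ k)) - w (real l * (T / 2 ^ k))"
    have "?x ^ 4 \<le> S k" unfolding S_def by (rule member_le_sum) (use that in auto)
    then have "?x\<^sup>2 \<le> u k + S k / u k"
      using le_power4_div[OF u[of k], of ?x] divide_right_mono[of "?x ^ 4" "S k" "u k"] u[of k] by simp
    then have "\<bar>?x\<bar> \<le> b k" unfolding b_def using real_sqrt_le_mono[of "?x\<^sup>2"] by simp
    then show ?thesis by simp
  qed
  from dyadic_chaining[of "\<lambda>x. w (x * T)", OF this gap_shift i]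
  have "\<bar>w (real i * (T / 2 ^ n)) - w 0\<bar> \<le> (\<Sum>k\<le>n. b k)" by simp
  then have "(w (real i * (T / 2 ^ n)) - w 0)\<^sup>2 \<le> (\<Sum>k\<le>n. b k)\<^sup>2"
    using gap_shift by (simp add: abs_le_square_iff[symmetric] sum_nonneg)
  also have "(\<Sum>k\<le>n. b k) = (\<Sum>k\<le>n. sqrt (r ^ k) * (b k / sqrt (r ^ k)))"
    by (intro sum.cong) (auto simp: r_def)
  also have "\<dots>\<^sup>2 \<le> (\<Sum>k\<le>n. (sqrt (r ^ k))\<^sup>2) * (\<Sum>k\<le>n. (b k / sqrt (r ^ k))\<^sup>2)"
    by (rule Cauchy_Schwarz_ineq_sum)
  also have "(\<Sum>k\<le>n. (sqrt (r ^ k))\<^sup>2) = (\<Sum>k\<le>n. r ^ k)" by (simp add: r_def)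
  also have "(\<Sum>k\<le>n. r ^ k) * (\<Sum>k\<le>n. (b k / sqrt (r ^ k))\<^sup>2) \<le> 5 * (\<Sum>k\<le>n. (b k / sqrt (r ^ k))\<^sup>2)"
  proof (rule mult_right_mono)
    have "(\<Sum>k\<le>n. r ^ k) = (1 - r ^ Suc n) / (1 - r)"
      using sum_gp_basic[of r n] by (simp add: r_def field_simps)
    also have "\<dots> \<le> 5" by (simp add: r_def)
    finally show "(\<Sum>k\<le>n. r ^ k) \<le> 5" .
  qed (intro sum_nonneg, simp)
  also have "\<dots> = (\<Sum>k\<le>n. chain_term T w k)"
    unfolding sum_distrib_left
  proof (rule sum.cong)
    fix k
    have "(b k / sqrt (r ^ k))\<^sup>2 = (u k + S k / u k) / r ^ k"
      by (simp add: power_divide b2) (simp add: r_def)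
    also have "\<dots> = T * r ^ k + (1 / r ^ 3) ^ k * S k / T"
    proof -
      define \<rho> where "\<rho> = r ^ k"
      have "0 < \<rho>" by (simp add: \<rho>_def r_def)
      moreover have "(1 / r ^ 3) ^ k = 1 / \<rho> ^ 3"
        by (simp only: \<rho>_def power_one_over power_mult[symmetric]) (simp only: mult.commute)
      ultimately show ?thesis using T by (simp add: u_def \<rho>_def[symmetric] field_simps eval_nat_numeral)
    qed
    finally show "5 * (b k / sqrt (r ^ k))\<^sup>2 = chain_term T w k"
      by (simp add: chain_term_def S_def r_def power_divide)
  qed simp
  finally show ?thesis .
qed

text \<open>Dyadic multiples of T approach t from below, and continuity carries the bound
  over.\<close>

lemma dyadic_approx:
  fixes w :: "real \<Rightarrow> real"
  assumes cont: "continuous_on UNIV w" and T: "0 < T" and t: "0 \<le> t" "t \<le> T"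
    and bd: "\<And>n i. i \<le> 2 ^ n \<Longrightarrow> (w (real i * (T / 2 ^ n)) - w 0)\<^sup>2 \<le> B"
  shows "(w t - w 0)\<^sup>2 \<le> B"
proof -
  define q where "q = t / T"
  have q: "0 \<le> q" "q \<le> 1" "t = q * T" using t T by (auto simp: q_def)
  define s where "s n = real (nat \<lfloor>q * 2 ^ n\<rfloor>)" for n
  have s: "s n \<le> q * 2 ^ n" "q * 2 ^ n - 1 \<le> s n" for n using q by (simp_all add: s_def) 
  have "(\<lambda>n. s n / 2 ^ n) \<longlonglongrightarrow> q"
  proof (rule tendsto_sandwich)
    have "(\<lambda>n. q - (1/2) ^ n) \<longlonglongrightarrow> q - (0::real)" by (intro tendsto_intros LIMSEQ_realpow_zero) auto
    then show "(\<lambda>n. q - (1/2) ^ n) \<longlonglongrightarrow> q" by simp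
    show "\<forall>\<^sub>F n in sequentially. q - (1/2) ^ n \<le> s n / 2 ^ n"
    proof (intro always_eventually allI)
      fix n
      have "q - (1/2) ^ n = (q * 2 ^ n - 1) / 2 ^ n" by (simp add: field_simps power_divide)
      also have "\<dots> \<le> s n / 2 ^ n" using s(2)[of n] by (intro divide_right_mono) auto
      finally show "q - (1/2) ^ n \<le> s n / 2 ^ n" .
    qed
    show "\<forall>\<^sub>F n in sequentially. s n / 2 ^ n \<le> q"
      using s(1) by (intro always_eventually allI) (simp add: field_simps)
  qed simp
  then have "(\<lambda>n. s n / 2 ^ n * T) \<longlonglongrightarrow> t" unfolding q(3) by (intro tendsto_intros)
  then have "(\<lambda>n. w (s n / 2 ^ n * T)) \<longlonglongrightarrow> w t"
    using cont by (intro isCont_tendsto_compose[of t w]) (auto simp: continuous_on_eq_continuous_at)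
  then have "(\<lambda>n. (w (s n / 2 ^ n * T) - w 0)\<^sup>2) \<longlonglongrightarrow> (w t - w 0)\<^sup>2" by (intro tendsto_intros)
  moreover have "(w (s n / 2 ^ n * T) - w 0)\<^sup>2 \<le> B" for n
  proof -
    have "q * 2 ^ n \<le> 1 * 2 ^ n" using q by (intro mult_right_mono) auto
    then have "real (nat \<lfloor>q * 2 ^ n\<rfloor>) \<le> real (2 ^ n)"
      unfolding of_nat_power of_nat_numeral using s(1)[of n, unfolded s_def] by linarith
    then have "nat \<lfloor>q * 2 ^ n\<rfloor> \<le> 2 ^ n" by (simp only: of_nat_le_iff)
    from bd[OF this] show ?thesis by (simp add: s_def)
  qed
  ultimately show ?thesis by (intro LIMSEQ_le_const2) auto
qed

section \<open>Moments of the supremum of the noise over a block\<close>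

context wiener_noise begin

definition incr :: "real \<Rightarrow> ('i \<Rightarrow> real \<Rightarrow> real) \<Rightarrow> real \<Rightarrow> real ^ 'i" where
  "incr s \<omega> t = (\<chi> j. \<omega> j (s + t) - \<omega> j s)"

lemma incr_0: "incr s \<omega> 0 = 0" by (simp add: incr_def vec_eq_iff)

lemma continuous_incr:
  assumes "\<omega> \<in> space P"
  shows "continuous_on S (incr s \<omega>)"
proof -
  have "continuous_on S (\<lambda>t. \<omega> j (s + t))" for j
    by (rule continuous_on_compose2[OF path_continuous[OF assms, of UNIV]]) (auto intro!: continuous_intros)
  then show ?thesis unfolding incr_def by (intro continuous_intros)
qed

text \<open>Extended values are used because the series may diverge for exceptional paths, where a
  real series would have no meaningful value.\<close>

definition chain_dom :: "real \<Rightarrow> real \<Rightarrow> ('i \<Rightarrow> real \<Rightarrow> real) \<Rightarrow> ennreal" where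
  "chain_dom T s \<omega> = (\<Sum>j\<in>UNIV. \<Sum>k. ennreal (chain_term T (\<lambda>t. \<omega> j (s + t)) k))"

lemma chain_term_grid_incr:
  "chain_term T (\<lambda>t. \<omega> j (s + t)) k = 5 * (T * (4/5) ^ k + (125/64) ^ k * (\<Sum>i<2^k. (grid_incr (T / 2 ^ k) s (i, j) \<omega>) ^ 4) / T)"
  by (simp add: chain_term_def grid_incr_def)

lemma nn_integral_chain_term:
  fixes T :: real
  assumes T: "0 < T"
  shows "(\<integral>\<^sup>+\<omega>. ennreal (chain_term T (\<lambda>t. \<omega> j (s + t)) k) \<partial>P) = ennreal (5 * T * (4/5) ^ k + 15 * T * (125/128) ^ k)"
proof -
  have [measurable]: "grid_incr (T / 2 ^ k) s p \<in> borel_measurable P" for p k by (rule grid_incr_measurable) (use T in simp)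
  have "(\<integral>\<^sup>+\<omega>. ennreal (chain_term T (\<lambda>t. \<omega> j (s + t)) k) \<partial>P)
    = (\<integral>\<^sup>+\<omega>. ennreal (5 * T * (4/5) ^ k) + ennreal (5 * (125/64) ^ k / T) * (\<Sum>i<2^k. ennreal ((grid_incr (T / 2 ^ k) s (i, j) \<omega>) ^ 4)) \<partial>P)"
  proof (rule nn_integral_cong)
    fix \<omega>
    have "chain_term T (\<lambda>t. \<omega> j (s + t)) k = 5 * T * (4/5) ^ k + (5 * (125/64) ^ k / T) * (\<Sum>i<2^k. (grid_incr (T / 2 ^ k) s (i, j) \<omega>) ^ 4)"
      by (simp add: chain_term_grid_incr)
    then show "ennreal (chain_term T (\<lambda>t. \<omega> j (s + t)) k)
      = ennreal (5 * T * (4/5) ^ k) + ennreal (5 * (125/64) ^ k / T) * (\<Sum>i<2^k. ennreal ((grid_incr (T / 2 ^ k) s (i, j) \<omega>) ^ 4))"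
      using ennreal_affine[of "5 * T * (4/5) ^ k" "5 * (125/64) ^ k / T" "\<Sum>i<2^k. (grid_incr (T / 2 ^ k) s (i, j) \<omega>) ^ 4"] T
      by (simp add: sum_nonneg sum_ennreal)
  qed
  also have "\<dots> = ennreal (5 * T * (4/5) ^ k) + ennreal (5 * (125/64) ^ k / T) * (\<Sum>i<(2::nat)^k. ennreal (3 * (T / 2 ^ k)\<^sup>2))"
    using T by (simp add: nn_integral_add nn_integral_cmult nn_integral_sum nn_integral_grid_incr_fourth P.emeasure_space_1 del: sum_ennreal)
  also have "\<dots> = ennreal (5 * T * (4/5) ^ k + 5 * (125/64) ^ k / T * (2 ^ k * (3 * (T / 2 ^ k)\<^sup>2)))"
  proof -
    have "(\<Sum>i<(2::nat)^k. ennreal (3 * (T / 2 ^ k)\<^sup>2)) = ennreal (2 ^ k * (3 * (T / 2 ^ k)\<^sup>2))"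
      by (subst sum_ennreal) simp_all
    then show ?thesis using T by (simp only:) (rule ennreal_affine[symmetric], auto)
  qed
  also have "5 * (125/64) ^ k / T * (2 ^ k * (3 * (T / 2 ^ k)\<^sup>2)) = 15 * T * ((125/64) ^ k / 2 ^ k)"
    using T by (simp add: power2_eq_square field_simps)
  also have "(125/64 :: real) ^ k / 2 ^ k = (125/128) ^ k" by (simp add: power_divide[symmetric])
  finally show ?thesis .
qed

lemma nn_integral_chain_dom:
  fixes T :: real
  assumes T: "0 < T"
  shows "chain_dom T s \<in> borel_measurable P" and "(\<integral>\<^sup>+\<omega>. chain_dom T s \<omega> \<partial>P) = ennreal (665 * CARD('i) * T)"
proof -
  have [measurable]: "grid_incr (T / 2 ^ k) s p \<in> borel_measurable P" for p k by (rule grid_incr_measurable) (use T in simp)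
  have m[measurable]: "(\<lambda>\<omega>. ennreal (chain_term T (\<lambda>t. \<omega> j (s + t)) k)) \<in> borel_measurable P" for j k
    unfolding chain_term_grid_incr by measurable
  show "chain_dom T s \<in> borel_measurable P" unfolding chain_dom_def[abs_def] by measurable
  \<comment> \<open>The two geometric series contribute 25 T and 640 T, hence the constant
    665.\<close>
  have sums: "(\<lambda>k. 5 * T * (4/5) ^ k + 15 * T * (125/128) ^ k) sums (5 * T * (1 / (1 - 4/5)) + 15 * T * (1 / (1 - 125/128)))"
    by (intro sums_add sums_mult geometric_sums) auto
  have "(\<integral>\<^sup>+\<omega>. chain_dom T s \<omega> \<partial>P) = (\<Sum>j\<in>(UNIV :: 'i set). \<Sum>k. ennreal (5 * T * (4/5) ^ k + 15 * T * (125/128) ^ k))"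
    unfolding chain_dom_def by (simp add: nn_integral_sum nn_integral_suminf nn_integral_chain_term T)
  also have "(\<Sum>k. ennreal (5 * T * (4/5) ^ k + 15 * T * (125/128) ^ k)) = ennreal (665 * T)"
    using sums T by (subst suminf_ennreal2) (auto simp: sums_iff)
  finally show "(\<integral>\<^sup>+\<omega>. chain_dom T s \<omega> \<partial>P) = ennreal (665 * CARD('i) * T)"
    using T by (simp add: ennreal_of_nat_eq_real_of_nat ennreal_mult[symmetric])
qed

lemma sup_norm_inc_sq_le:
  fixes T :: real
  assumes T: "0 < T" and \<omega>: "\<omega> \<in> space P"
  shows "ennreal ((sup_norm T (incr s \<omega>))\<^sup>2) \<le> chain_dom T s \<omega>"
proof (cases "chain_dom T s \<omega> = \<infinity>")
  case False
  define B where "B j = (\<Sum>k. chain_term T (\<lambda>t. \<omega> j (s + t)) k)" for j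
  have fin: "(\<Sum>k. ennreal (chain_term T (\<lambda>t. \<omega> j (s + t)) k)) \<noteq> \<infinity>" for j
    using False unfolding chain_dom_def by (simp add: ennreal_sum_eq_top)
  have sm: "summable (chain_term T (\<lambda>t. \<omega> j (s + t)))" for j
    using fin[of j] chain_term_nonneg[OF T] by (intro summable_suminf_not_top) auto
  have B: "(\<Sum>k. ennreal (chain_term T (\<lambda>t. \<omega> j (s + t)) k)) = ennreal (B j)" for j
    unfolding B_def by (rule suminf_ennreal2[OF chain_term_nonneg[OF T] sm])
  have B0: "0 \<le> B j" for j unfolding B_def by (intro suminf_nonneg sm chain_term_nonneg T)
  have dominating: "chain_dom T s \<omega> = ennreal (\<Sum>j\<in>UNIV. B j)" unfolding chain_dom_def B by (intro sum_ennreal B0)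
  have "(\<omega> j (s + t) - \<omega> j s)\<^sup>2 \<le> B j" if t: "0 \<le> t" "t \<le> T" for t j
  proof -
    have "continuous_on UNIV (\<lambda>t. \<omega> j (s + t))"
      by (rule continuous_on_compose2[OF path_continuous[OF \<omega>, of UNIV]]) (auto intro!: continuous_intros)
    moreover have "(\<omega> j (s + real i * (T / 2 ^ n)) - \<omega> j (s + 0))\<^sup>2 \<le> B j" if "i \<le> 2 ^ n" for i n
      unfolding B_def
      by (rule order_trans[OF chain_bound[OF T that, of "\<lambda>t. \<omega> j (s + t)"] sum_le_suminf[OF sm]])
        (auto simp: chain_term_nonneg[OF T])
    ultimately show ?thesis using dyadic_approx[of "\<lambda>t. \<omega> j (s + t)" T t "B j"] T t by simp
  qed
  then have "(norm (incr s \<omega> t))\<^sup>2 \<le> (\<Sum>j\<in>UNIV. B j)" if "0 \<le> t" "t \<le> T" for t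
    using that unfolding power2_norm_eq_inner inner_vec_def by (auto simp: incr_def power2_eq_square intro!: sum_mono)
  then have "sup_norm T (incr s \<omega>) \<le> sqrt (\<Sum>j\<in>UNIV. B j)"
    using T by (intro sup_norm_le real_le_rsqrt) auto
  then have "(sup_norm T (incr s \<omega>))\<^sup>2 \<le> (sqrt (\<Sum>j\<in>UNIV. B j))\<^sup>2"
    using sup_norm_nonneg[OF continuous_incr[OF \<omega>], of T s] T by (intro power_mono) auto
  also have "\<dots> = (\<Sum>j\<in>UNIV. B j)" using B0 by (simp add: sum_nonneg)
  finally show ?thesis unfolding dominating by (rule ennreal_leI)
qed simp

end

section \<open>Stationarity and lack of correlation of block functionals\<close>

context wiener_noise begin

text \<open>The functional at the interpolated increment path; \<open>Suc m\<close> cells keep the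
  mesh positive for every m.\<close>

definition grid_fun :: "((real \<Rightarrow> real ^ 'i) \<Rightarrow> real) \<Rightarrow> real \<Rightarrow> real \<Rightarrow> nat \<Rightarrow> ('i \<Rightarrow> real \<Rightarrow> real) \<Rightarrow> real" where
  "grid_fun H T s m \<omega> = H (pw_linear (T / Suc m) (Suc m) (\<lambda>i. \<chi> j. grid_incr (T / Suc m) s (i, j) \<omega>))"

lemma grid_incr_incr: "(\<chi> j. grid_incr h s (i, j) \<omega>) = incr s \<omega> (real (Suc i) * h) - incr s \<omega> (real i * h)"
  by (simp add: grid_incr_def incr_def vec_eq_iff)

context
  fixes T L :: real and H :: "(real \<Rightarrow> real ^ 'i) \<Rightarrow> real"
  assumes T: "0 < T" and H: "sup_lip T L H"
begin

lemma L_nonneg: "0 \<le> L" using H by (simp add: sup_lip_def)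

text \<open>The bound is free of m, so it can dominate the passage to the limit.\<close>

lemma grid_fun_bound:
  assumes "\<omega> \<in> space P"
  shows "\<bar>grid_fun H T s m \<omega>\<bar> \<le> \<bar>H (\<lambda>_. 0)\<bar> + L * sup_norm T (incr s \<omega>)"
proof -
  have "\<bar>grid_fun H T s m \<omega> - H (\<lambda>_. 0)\<bar> \<le> L * sup_norm T (incr s \<omega>)"
    unfolding grid_fun_def grid_incr_incr
  proof (rule sup_lipD[OF H continuous_pw_linear continuous_on_const])
    fix t assume "0 \<le> t" "t \<le> T"
    then show "norm (pw_linear (T / Suc m) (Suc m) (\<lambda>i. incr s \<omega> (real (Suc i) * (T / Suc m)) - incr s \<omega> (real i * (T / Suc m))) t - 0) \<le> sup_norm T (incr s \<omega>)"
      unfolding diff_zero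
      by (intro norm_pw_linear_le[where w = "incr s \<omega>", OF T _ _ _ incr_0] sup_norm_ge continuous_incr assms) auto
  qed
  then show ?thesis by linarith
qed

lemma functional_bound:
  assumes "\<omega> \<in> space P"
  shows "\<bar>H (incr s \<omega>)\<bar> \<le> \<bar>H (\<lambda>_. 0)\<bar> + L * sup_norm T (incr s \<omega>)"
proof -
  have "\<bar>H (incr s \<omega>) - H (\<lambda>_. 0)\<bar> \<le> L * sup_norm T (incr s \<omega>)"
    using sup_norm_ge[OF continuous_incr[OF assms]] by (intro sup_lipD[OF H continuous_incr[OF assms] continuous_on_const]) auto
  then show ?thesis by linarith
qed

lemma grid_fun_tendsto:
  assumes \<omega>: "\<omega> \<in> space P"
  shows "(\<lambda>m. grid_fun H T s m \<omega>) \<longlonglongrightarrow> H (incr s \<omega>)"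
proof (rule LIMSEQ_I)
  fix e :: real assume e: "0 < e"
  \<comment> \<open>L + 1 is used because L may be 0.\<close>
  define d where "d = e / (L + 1) / 2"
  have L1: "0 < L + 1" using L_nonneg by simp
  then have "(L + 1) * (e / (L + 1)) = e" by simp
  then have d0: "0 < d" "(L + 1) * d = e / 2"
    using e L1 by (simp_all only: d_def times_divide_eq_right) simp_all
  then have d: "0 < d" "L * d < e" using e by (auto simp: distrib_right)
  from pw_linear_converges[where w = "incr s \<omega>", OF T incr_0 continuous_incr[OF \<omega>] d(1)]
  obtain N where N: "\<And>m t. N \<le> m \<Longrightarrow> 0 \<le> t \<Longrightarrow> t \<le> T \<Longrightarrow>
    norm (pw_linear (T / m) m (\<lambda>k. incr s \<omega> (real (Suc k) * (T / m)) - incr s \<omega> (real k * (T / m))) t - incr s \<omega> t) \<le> d"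
    unfolding eventually_sequentially by blast
  show "\<exists>N. \<forall>m\<ge>N. norm (grid_fun H T s m \<omega> - H (incr s \<omega>)) < e"
  proof (intro exI allI impI)
    fix m assume "N \<le> m"
    have "\<bar>grid_fun H T s m \<omega> - H (incr s \<omega>)\<bar> \<le> L * d"
      unfolding grid_fun_def grid_incr_incr
      by (rule sup_lipD[OF H continuous_pw_linear continuous_incr[OF \<omega>] N]) (use \<open>N \<le> m\<close> in auto)
    then show "norm (grid_fun H T s m \<omega> - H (incr s \<omega>)) < e" using d by simp
  qed
qed

text \<open>The parameter k is free. With k = 0 it exhibits a function of the increments of one
  block; with s = k T the grid starts at 0 for every k, so that different blocks read disjoint parts
  of one independent family.\<close>

lemma grid_fun_restrict:
  "grid_fun H T s m \<omega> = (\<lambda>x. H (pw_linear (T / Suc m) (Suc m) (\<lambda>i. \<chi> j. (if (i, j) \<in> {..<Suc m} \<times> UNIV then x (k * Suc m + i, j) else 0))))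
     (restrict (\<lambda>p. grid_incr (T / Suc m) (s - real k * T) p \<omega>) ({k * Suc m..<Suc k * Suc m} \<times> UNIV))"
proof -
  have "s - real k * T + real (k * Suc m + i) * (T / Suc m) = s + real i * (T / Suc m)" for i
    by (simp add: field_simps)
  moreover have "s - real k * T + real (Suc (k * Suc m + i)) * (T / Suc m) = s + real (Suc i) * (T / Suc m)" for i
    by (simp add: field_simps)
  ultimately have incr_eq: "grid_incr (T / Suc m) (s - real k * T) (k * Suc m + i, j) \<omega> = grid_incr (T / Suc m) s (i, j) \<omega>" for i j
    unfolding grid_incr_def prod.case by (simp only: add_Suc_right)
  have "(if (i, j) \<in> {..<Suc m} \<times> UNIV then restrict (\<lambda>p. grid_incr (T / Suc m) (s - real k * T) p \<omega>) ({k * Suc m..<Suc k * Suc m} \<times> UNIV) (k * Suc m + i, j) else 0)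
      = (if i < Suc m then grid_incr (T / Suc m) s (i, j) \<omega> else 0)" for i j
    using incr_eq[of i j] by (auto simp del: of_nat_Suc)
  then have "(\<lambda>x. H (pw_linear (T / Suc m) (Suc m) (\<lambda>i. \<chi> j. (if (i, j) \<in> {..<Suc m} \<times> UNIV then x (k * Suc m + i, j) else 0))))
     (restrict (\<lambda>p. grid_incr (T / Suc m) (s - real k * T) p \<omega>) ({k * Suc m..<Suc k * Suc m} \<times> UNIV))
    = H (pw_linear (T / Suc m) (Suc m) (\<lambda>i. \<chi> j. if i < Suc m then grid_incr (T / Suc m) s (i, j) \<omega> else 0))"
    by simp
  also have "pw_linear (T / Suc m) (Suc m) (\<lambda>i. \<chi> j. if i < Suc m then grid_incr (T / Suc m) s (i, j) \<omega> else 0)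
    = pw_linear (T / Suc m) (Suc m) (\<lambda>i. \<chi> j. grid_incr (T / Suc m) s (i, j) \<omega>)"
    unfolding pw_linear_def by (intro ext sum.cong) auto
  finally show ?thesis by (simp add: grid_fun_def)
qed

lemma grid_fun_factor_measurable:
  "(\<lambda>x. H (pw_linear (T / Suc m) (Suc m) (\<lambda>i. \<chi> j. (if (i, j) \<in> {..<Suc m} \<times> UNIV then x (k * Suc m + i, j) else 0))))
    \<in> borel_measurable (\<Pi>\<^sub>M p\<in>{k * Suc m..<Suc k * Suc m} \<times> UNIV. borel)"
proof -
  have "(\<lambda>x p. if p \<in> {..<Suc m} \<times> UNIV then x ((\<lambda>(i, j). (k * Suc m + i, j)) p) else 0)
    \<in> measurable (\<Pi>\<^sub>M p\<in>{k * Suc m..<Suc k * Suc m} \<times> (UNIV :: 'i set). borel :: real measure) (\<Pi>\<^sub>M p\<in>UNIV. borel)"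
    by (rule restrict_measurable_UNIV) auto
  from measurable_compose[OF this sup_lip_pw_linear_measurable[OF H, of "T / Suc m" "Suc m"]]
  show ?thesis by (simp only: prod.case)
qed

lemma grid_fun_measurable: "grid_fun H T s m \<in> borel_measurable P"
proof -
  have "(\<lambda>\<omega>. restrict (\<lambda>p. grid_incr (T / Suc m) (s - real 0 * T) p \<omega>) ({0 * Suc m..<Suc 0 * Suc m} \<times> UNIV))
    \<in> measurable P (\<Pi>\<^sub>M p\<in>{0 * Suc m..<Suc 0 * Suc m} \<times> UNIV. borel)"
    by (intro measurable_restrict grid_incr_measurable) (use T in simp)
  from measurable_compose[OF this grid_fun_factor_measurable[of m 0]] show ?thesis
    unfolding grid_fun_restrict[of s m _ 0] by simp
qed

lemma functional_measurable: "(\<lambda>\<omega>. H (incr s \<omega>)) \<in> borel_measurable P"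
  by (rule borel_measurable_LIMSEQ_real[OF grid_fun_tendsto grid_fun_measurable])

text \<open>Both sides integrate the same function against the joint law of the increments, which
  does not depend on s.\<close>

lemma expectation_grid_fun: "P.expectation (grid_fun H T s m) = P.expectation (grid_fun H T 0 m)"
proof -
  let ?I = "{0 * Suc m..<Suc 0 * Suc m} \<times> (UNIV :: 'i set)"
  let ?R = "\<lambda>s \<omega>. restrict (\<lambda>p. grid_incr (T / Suc m) (s - real 0 * T) p \<omega>) ?I"
  let ?F = "\<lambda>x. H (pw_linear (T / Suc m) (Suc m) (\<lambda>i. \<chi> j. (if (i, j) \<in> {..<Suc m} \<times> UNIV then x (0 * Suc m + i, j) else 0)))"
  have h: "0 < T / Suc m" using T by simp
  have "P.expectation (grid_fun H T s m) = integral\<^sup>L (distr P (\<Pi>\<^sub>M p\<in>?I. borel) (?R s)) ?F" for s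
  proof (subst integral_distr)
    show "?R s \<in> measurable P (\<Pi>\<^sub>M p\<in>?I. borel)" by (intro measurable_restrict grid_incr_measurable h)
    show "?F \<in> borel_measurable (\<Pi>\<^sub>M p\<in>?I. borel)" by (rule grid_fun_factor_measurable)
    show "P.expectation (grid_fun H T s m) = P.expectation (\<lambda>\<omega>. ?F (?R s \<omega>))"
      by (rule Bochner_Integration.integral_cong[OF refl]) (rule grid_fun_restrict)
  qed
  moreover have "distr P (\<Pi>\<^sub>M p\<in>?I. borel) (?R s) = distr P (\<Pi>\<^sub>M p\<in>?I. borel) (?R 0)"
    using distr_grid_incr[OF h, of "Suc m" s] distr_grid_incr[OF h, of "Suc m" 0] by (simp add: atLeast0LessThan)
  ultimately show ?thesis by simp
qed

end

lemma sup_norm_inc_measurable: "0 < (T :: real) \<Longrightarrow> (\<lambda>\<omega>. sup_norm T (incr s \<omega>)) \<in> borel_measurable P"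
  using functional_measurable[OF _ sup_lip_sup_norm] by simp

lemma sup_norm_inc_sq:
  fixes T :: real
  assumes T: "0 < T"
  shows "integrable P (\<lambda>\<omega>. (sup_norm T (incr s \<omega>))\<^sup>2)" "P.expectation (\<lambda>\<omega>. (sup_norm T (incr s \<omega>))\<^sup>2) \<le> 665 * CARD('i) * T"
proof -
  note [measurable] = sup_norm_inc_measurable[OF T]
  have le: "(\<integral>\<^sup>+\<omega>. ennreal ((sup_norm T (incr s \<omega>))\<^sup>2) \<partial>P) \<le> ennreal (665 * CARD('i) * T)"
    unfolding nn_integral_chain_dom(2)[OF T, of s, symmetric]
    by (intro nn_integral_mono sup_norm_inc_sq_le T)
  show int: "integrable P (\<lambda>\<omega>. (sup_norm T (incr s \<omega>))\<^sup>2)"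
    using le by (intro integrableI_nonneg) (auto simp: top_unique less_top[symmetric])
  show "P.expectation (\<lambda>\<omega>. (sup_norm T (incr s \<omega>))\<^sup>2) \<le> 665 * CARD('i) * T"
    using le T by (subst (asm) nn_integral_eq_integral[OF int]) auto
qed

lemma sup_norm_inc_integrable:
  fixes T :: real
  assumes T: "0 < T"
  shows "integrable P (\<lambda>\<omega>. sup_norm T (incr s \<omega>))"
proof (rule Bochner_Integration.integrable_bound)
  show "integrable P (\<lambda>\<omega>. 1 + (sup_norm T (incr s \<omega>))\<^sup>2)" using sup_norm_inc_sq(1)[OF T] by simp
  show "AE \<omega> in P. norm (sup_norm T (incr s \<omega>)) \<le> norm (1 + (sup_norm T (incr s \<omega>))\<^sup>2)"
  proof (intro AE_I2)
    fix \<omega> have "2 * \<bar>sup_norm T (incr s \<omega>)\<bar> * 1 \<le> \<bar>sup_norm T (incr s \<omega>)\<bar>\<^sup>2 + 1\<^sup>2" by (rule sum_squares_bound)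
    then show "norm (sup_norm T (incr s \<omega>)) \<le> norm (1 + (sup_norm T (incr s \<omega>))\<^sup>2)" by simp
  qed
qed (rule sup_norm_inc_measurable[OF T])

text \<open>The second moment is of order T, and x \<le> sqrt T + x^2 / sqrt T balances both terms
  at order sqrt T.\<close>

lemma expectation_sup_norm_incr:
  fixes T :: real
  assumes T: "0 < T"
  shows "P.expectation (\<lambda>\<omega>. sup_norm T (incr s \<omega>)) \<le> (1 + 665 * CARD('i)) * sqrt T"
proof -
  have "P.expectation (\<lambda>\<omega>. sup_norm T (incr s \<omega>)) \<le> P.expectation (\<lambda>\<omega>. sqrt T + (sup_norm T (incr s \<omega>))\<^sup>2 / sqrt T)"
  proof (intro integral_mono sup_norm_inc_integrable T)
    show "integrable P (\<lambda>\<omega>. sqrt T + (sup_norm T (incr s \<omega>))\<^sup>2 / sqrt T)" using sup_norm_inc_sq(1)[OF T] by simp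
    fix \<omega>
    have "2 * (sqrt T * sup_norm T (incr s \<omega>)) \<le> (sqrt T)\<^sup>2 + (sup_norm T (incr s \<omega>))\<^sup>2"
      using sum_squares_bound[of "sqrt T" "sup_norm T (incr s \<omega>)"] by simp
    then have "sqrt T * sup_norm T (incr s \<omega>) \<le> (sqrt T)\<^sup>2 + (sup_norm T (incr s \<omega>))\<^sup>2"
      using zero_le_power2[of "sup_norm T (incr s \<omega>)"] zero_le_power2[of "sqrt T"] by linarith
    then show "sup_norm T (incr s \<omega>) \<le> sqrt T + (sup_norm T (incr s \<omega>))\<^sup>2 / sqrt T"
      using T by (simp add: field_simps)
  qed
  also have "\<dots> = sqrt T + P.expectation (\<lambda>\<omega>. (sup_norm T (incr s \<omega>))\<^sup>2) / sqrt T"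
    using sup_norm_inc_sq(1)[OF T, of s] by (simp add: P.prob_space)
  also have "\<dots> \<le> sqrt T + 665 * CARD('i) * T / sqrt T"
    using sup_norm_inc_sq(2)[OF T] T by (intro add_left_mono divide_right_mono) auto
  also have "\<dots> = (1 + 665 * CARD('i)) * sqrt T"
    using T real_sqrt_mult_self[of T] by (simp add: field_simps)
  finally show ?thesis .
qed

context
  fixes T L :: real and H :: "(real \<Rightarrow> real ^ 'i) \<Rightarrow> real"
  assumes T: "0 < T" and H: "sup_lip T L H"
begin

abbreviation dominating :: "real \<Rightarrow> ('i \<Rightarrow> real \<Rightarrow> real) \<Rightarrow> real" where
  "dominating s \<omega> \<equiv> \<bar>H (\<lambda>_. 0)\<bar> + L * sup_norm T (incr s \<omega>)"

lemma dominating_integrable: "integrable P (dominating s)" "integrable P (\<lambda>\<omega>. (dominating s \<omega>)\<^sup>2)"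
proof -
  note i = sup_norm_inc_integrable[OF T, of s] sup_norm_inc_sq(1)[OF T, of s]
  show "integrable P (dominating s)" using i by simp
  have "(\<lambda>\<omega>. (dominating s \<omega>)\<^sup>2) = (\<lambda>\<omega>. \<bar>H (\<lambda>_. 0)\<bar>\<^sup>2 + L\<^sup>2 * (sup_norm T (incr s \<omega>))\<^sup>2 + (2 * \<bar>H (\<lambda>_. 0)\<bar> * L) * sup_norm T (incr s \<omega>))"
    by (simp add: power2_sum power_mult_distrib mult.assoc)
  then show "integrable P (\<lambda>\<omega>. (dominating s \<omega>)\<^sup>2)" using i by simp
qed

lemma integrable_dominated:
  fixes D :: "_ \<Rightarrow> real"
  assumes "integrable P D" "X \<in> borel_measurable P" "\<And>\<omega>. \<omega> \<in> space P \<Longrightarrow> \<bar>X \<omega>\<bar> \<le> D \<omega>"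
  shows "integrable P X"
proof (rule Bochner_Integration.integrable_bound[OF assms(1,2)], rule AE_I2)
  fix \<omega> assume "\<omega> \<in> space P"
  from assms(3)[OF this] show "norm (X \<omega>) \<le> norm (D \<omega>)" by simp
qed

lemma functional_integrable:
  "integrable P (\<lambda>\<omega>. H (incr s \<omega>))" "integrable P (\<lambda>\<omega>. (H (incr s \<omega>))\<^sup>2)"
proof -
  note [measurable] = functional_measurable[OF T H]
  show "integrable P (\<lambda>\<omega>. H (incr s \<omega>))"
    by (rule integrable_dominated[OF dominating_integrable(1) _ functional_bound[OF T H]]) measurable
  show "integrable P (\<lambda>\<omega>. (H (incr s \<omega>))\<^sup>2)"
  proof (rule integrable_dominated[OF dominating_integrable(2)[of s]])
    fix \<omega> assume "\<omega> \<in> space P"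
    from power_mono[OF functional_bound[OF T H this, of s], of 2]
    show "\<bar>(H (incr s \<omega>))\<^sup>2\<bar> \<le> (dominating s \<omega>)\<^sup>2" by simp
  qed measurable
qed

lemma grid_fun_integrable: "integrable P (grid_fun H T s m)"
  by (rule integrable_dominated[OF dominating_integrable(1) grid_fun_measurable[OF T H] grid_fun_bound[OF T H]])

text \<open>Stationarity holds on every grid and passes to the limit by dominated
  convergence.\<close>

lemma expectation_functional: "P.expectation (\<lambda>\<omega>. H (incr s \<omega>)) = P.expectation (\<lambda>\<omega>. H (incr 0 \<omega>))"
proof -
  have "(\<lambda>m. P.expectation (grid_fun H T s m)) \<longlonglongrightarrow> P.expectation (\<lambda>\<omega>. H (incr s \<omega>))" for s
  proof (rule integral_dominated_convergence[where w = "dominating s"])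
    show "AE \<omega> in P. (\<lambda>m. grid_fun H T s m \<omega>) \<longlonglongrightarrow> H (incr s \<omega>)" by (intro AE_I2 grid_fun_tendsto[OF T H])
    show "AE \<omega> in P. norm (grid_fun H T s m \<omega>) \<le> dominating s \<omega>" for m using grid_fun_bound[OF T H] by (intro AE_I2) simp
  qed (use functional_measurable[OF T H] grid_fun_measurable[OF T H] dominating_integrable(1) in auto)
  note lim = this
  have eq: "(\<lambda>m. P.expectation (grid_fun H T s m)) = (\<lambda>m. P.expectation (grid_fun H T 0 m))"
    by (rule ext) (rule expectation_grid_fun[OF T H])
  from LIMSEQ_unique[OF lim[of s, unfolded eq] lim[of 0]] show ?thesis .
qed

text \<open>On a grid the two blocks depend on disjoint sets of independent increments, so the
  expectation factors; dominated convergence keeps this. Products of two blocks are all that the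
  strong law asks for.\<close>

lemma expectation_functional_prod:
  assumes "k < l"
  shows "integrable P (\<lambda>\<omega>. H (incr (real k * T) \<omega>) * H (incr (real l * T) \<omega>))"
    and "P.expectation (\<lambda>\<omega>. H (incr (real k * T) \<omega>) * H (incr (real l * T) \<omega>)) = (P.expectation (\<lambda>\<omega>. H (incr 0 \<omega>)))\<^sup>2"
proof -
  note [measurable] = functional_measurable[OF T H] grid_fun_measurable[OF T H]
  let ?s = "\<lambda>k. real k * T" 
  define D where "D \<omega> = (dominating (?s k) \<omega>)\<^sup>2 + (dominating (?s l) \<omega>)\<^sup>2" for \<omega>
  have D: "integrable P D" unfolding D_def by (rule Bochner_Integration.integrable_add[OF dominating_integrable(2) dominating_integrable(2)])
  have prod_le: "\<bar>x * y\<bar> \<le> a\<^sup>2 + b\<^sup>2" if "\<bar>x\<bar> \<le> a" "\<bar>y\<bar> \<le> b" for x y a b :: real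
  proof -
    have "\<bar>x * y\<bar> \<le> a * b" using that by (simp add: abs_mult mult_mono')
    also have "\<dots> \<le> a\<^sup>2 + b\<^sup>2" using sum_squares_bound[of a b] that mult_nonneg_nonneg[of a b] by linarith
    finally show ?thesis .
  qed
  show "integrable P (\<lambda>\<omega>. H (incr (?s k) \<omega>) * H (incr (?s l) \<omega>))"
  proof (rule Bochner_Integration.integrable_bound[OF D])
    show "AE \<omega> in P. norm (H (incr (?s k) \<omega>) * H (incr (?s l) \<omega>)) \<le> norm (D \<omega>)"
      using prod_le[OF functional_bound[OF T H] functional_bound[OF T H]]
      by (intro AE_I2) (simp add: D_def)
  qed measurable
  have lim: "(\<lambda>m. P.expectation (\<lambda>\<omega>. grid_fun H T (?s k) m \<omega> * grid_fun H T (?s l) m \<omega>)) \<longlonglongrightarrow> P.expectation (\<lambda>\<omega>. H (incr (?s k) \<omega>) * H (incr (?s l) \<omega>))"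
  proof (rule integral_dominated_convergence[where w = D])
    show "AE \<omega> in P. (\<lambda>m. grid_fun H T (?s k) m \<omega> * grid_fun H T (?s l) m \<omega>) \<longlonglongrightarrow> H (incr (?s k) \<omega>) * H (incr (?s l) \<omega>)"
      by (intro AE_I2 tendsto_mult grid_fun_tendsto[OF T H])
    show "AE \<omega> in P. norm (grid_fun H T (?s k) m \<omega> * grid_fun H T (?s l) m \<omega>) \<le> D \<omega>" for m
      using prod_le[OF grid_fun_bound[OF T H] grid_fun_bound[OF T H]] by (intro AE_I2) (simp add: D_def)
  qed (use D in measurable)
  have "P.expectation (\<lambda>\<omega>. grid_fun H T (?s k) m \<omega> * grid_fun H T (?s l) m \<omega>) = P.expectation (grid_fun H T 0 m) * P.expectation (grid_fun H T 0 m)" for m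
  proof -
    let ?h = "T / Suc m"
    let ?K = "\<lambda>k. {k * Suc m..<Suc k * Suc m} \<times> (UNIV :: 'i set)"
    let ?F = "\<lambda>k x. H (pw_linear ?h (Suc m) (\<lambda>i. \<chi> j. (if (i, j) \<in> {..<Suc m} \<times> UNIV then x (k * Suc m + i, j) else 0)))"
    have h: "0 < ?h" using T by simp
    have fac: "grid_fun H T (?s k') m \<omega> = ?F k' (restrict (\<lambda>p. grid_incr ?h 0 p \<omega>) (?K k'))" for k' \<omega>
      using grid_fun_restrict[OF T H, of "?s k'" m \<omega> k'] by (simp only: diff_self)
    have "P.indep_vars (\<lambda>_. borel) (grid_incr ?h 0) ({..<Suc l * Suc m} \<times> UNIV)"
      by (rule indep_grid_incr[OF h]) simp
    then have "P.indep_vars (\<lambda>k. \<Pi>\<^sub>M p\<in>?K k. borel) (\<lambda>k \<omega>. restrict (\<lambda>p. grid_incr ?h 0 p \<omega>) (?K k)) {k, l}"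
    proof (rule P.indep_vars_restrict)
      have le: "Suc k * Suc m \<le> l * Suc m" using assms by (intro mult_right_mono) auto
      show "disjoint_family_on ?K {k, l}"
        unfolding disjoint_family_on_def using le by auto
      show "?K k' \<subseteq> {..<Suc l * Suc m} \<times> UNIV" if "k' \<in> {k, l}" for k'
        using that le by auto
    qed
    from P.indep_vars_compose2[OF this grid_fun_factor_measurable[OF T H]]
    have "P.indep_vars (\<lambda>_. borel) (\<lambda>k \<omega>. grid_fun H T (?s k) m \<omega>) {k, l}"
      by (simp only: fac)
    from P.indep_vars_lebesgue_integral[OF _ this]
    show ?thesis using assms grid_fun_integrable expectation_grid_fun[OF T H, of "?s k" m] expectation_grid_fun[OF T H, of "?s l" m] by simp
  qed
  moreover have "(\<lambda>m. P.expectation (grid_fun H T 0 m)) \<longlonglongrightarrow> P.expectation (\<lambda>\<omega>. H (incr 0 \<omega>))"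
  proof (rule integral_dominated_convergence[where w = "dominating 0"])
    show "AE \<omega> in P. (\<lambda>m. grid_fun H T 0 m \<omega>) \<longlonglongrightarrow> H (incr 0 \<omega>)" by (intro AE_I2 grid_fun_tendsto[OF T H])
    show "AE \<omega> in P. norm (grid_fun H T 0 m \<omega>) \<le> dominating 0 \<omega>" for m using grid_fun_bound[OF T H] by (intro AE_I2) simp
  qed (use dominating_integrable(1) in auto)
  ultimately have "(\<lambda>m. P.expectation (\<lambda>\<omega>. grid_fun H T (?s k) m \<omega> * grid_fun H T (?s l) m \<omega>)) \<longlonglongrightarrow> (P.expectation (\<lambda>\<omega>. H (incr 0 \<omega>)))\<^sup>2"
    by (simp add: power2_eq_square tendsto_mult)
  from LIMSEQ_unique[OF lim this]
  show "P.expectation (\<lambda>\<omega>. H (incr (?s k) \<omega>) * H (incr (?s l) \<omega>)) = (P.expectation (\<lambda>\<omega>. H (incr 0 \<omega>)))\<^sup>2" .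
qed

text \<open>Functionals of variable sign are made nonnegative before use, by adding a constant or
  the supremum norm.\<close>

theorem strong_law_blocks:
  assumes nn: "\<And>w. continuous_on UNIV w \<Longrightarrow> 0 \<le> H w"
  shows "AE \<omega> in P. (\<lambda>K. (\<Sum>k<K. H (incr (real k * T) \<omega>)) / K) \<longlonglongrightarrow> P.expectation (\<lambda>\<omega>. H (incr 0 \<omega>))"
proof (rule P.strong_law_uncorrelated[where C = "2 * \<bar>H (\<lambda>_. 0)\<bar>\<^sup>2 + 2 * L\<^sup>2 * (665 * CARD('i) * T)"])
  fix k
  let ?s = "real k * T"
  note bnd = functional_bound[OF T H, of _ ?s]
  have "P.expectation (\<lambda>\<omega>. (H (incr ?s \<omega>))\<^sup>2) \<le> P.expectation (\<lambda>\<omega>. 2 * \<bar>H (\<lambda>_. 0)\<bar>\<^sup>2 + 2 * L\<^sup>2 * (sup_norm T (incr ?s \<omega>))\<^sup>2)"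
  proof (rule integral_mono[OF functional_integrable(2)])
    show "integrable P (\<lambda>\<omega>. 2 * \<bar>H (\<lambda>_. 0)\<bar>\<^sup>2 + 2 * L\<^sup>2 * (sup_norm T (incr ?s \<omega>))\<^sup>2)"
      by (rule Bochner_Integration.integrable_add[OF P.integrable_const integrable_mult_right]) (rule sup_norm_inc_sq(1)[OF T])
    fix \<omega> assume "\<omega> \<in> space P"
    from power_mono[OF bnd[OF this], of 2]
    have "(H (incr ?s \<omega>))\<^sup>2 \<le> (\<bar>H (\<lambda>_. 0)\<bar> + L * sup_norm T (incr ?s \<omega>))\<^sup>2" by simp
    also have "\<dots> \<le> 2 * \<bar>H (\<lambda>_. 0)\<bar>\<^sup>2 + 2 * (L * sup_norm T (incr ?s \<omega>))\<^sup>2"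
      using zero_le_power2[of "\<bar>H (\<lambda>_. 0)\<bar> - L * sup_norm T (incr ?s \<omega>)"] unfolding power2_sum power2_diff by linarith
    finally show "(H (incr ?s \<omega>))\<^sup>2 \<le> 2 * \<bar>H (\<lambda>_. 0)\<bar>\<^sup>2 + 2 * L\<^sup>2 * (sup_norm T (incr ?s \<omega>))\<^sup>2"
      by (simp add: power_mult_distrib)
  qed
  also have "\<dots> = 2 * \<bar>H (\<lambda>_. 0)\<bar>\<^sup>2 + 2 * L\<^sup>2 * P.expectation (\<lambda>\<omega>. (sup_norm T (incr ?s \<omega>))\<^sup>2)"
    using sup_norm_inc_sq(1)[OF T, of ?s] by (simp add: P.prob_space)
  also have "\<dots> \<le> 2 * \<bar>H (\<lambda>_. 0)\<bar>\<^sup>2 + 2 * L\<^sup>2 * (665 * CARD('i) * T)"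
    using sup_norm_inc_sq(2)[OF T, of ?s] by (intro add_left_mono mult_left_mono) auto
  finally show "P.expectation (\<lambda>\<omega>. (H (incr ?s \<omega>))\<^sup>2) \<le> 2 * \<bar>H (\<lambda>_. 0)\<bar>\<^sup>2 + 2 * L\<^sup>2 * (665 * CARD('i) * T)" .
qed (use nn continuous_incr functional_integrable expectation_functional expectation_functional_prod in auto)

end

end

text \<open>The term is the difference of two consecutive partial sums, which have the same limit
  after division by K.\<close>

lemma tendsto_increment_div:
  fixes s :: "nat \<Rightarrow> real"
  assumes "(\<lambda>K. (\<Sum>k<K. s k) / K) \<longlonglongrightarrow> \<mu>"
  shows "(\<lambda>K. s K / K) \<longlonglongrightarrow> 0"
proof -
  let ?a = "\<lambda>K. (\<Sum>k<K. s k) / real K"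
  have "(\<lambda>K. (real (Suc K) / real K) * ?a (Suc K) - ?a K) \<longlonglongrightarrow> 1 * \<mu> - \<mu>"
    by (intro tendsto_intros LIMSEQ_Suc_n_over_n LIMSEQ_Suc assms)
  moreover have "\<forall>\<^sub>F K in sequentially. (real (Suc K) / real K) * ?a (Suc K) - ?a K = s K / K"
    using eventually_gt_at_top[of 0] by eventually_elim (simp add: field_simps del: of_nat_Suc)
  ultimately show ?thesis by (simp add: tendsto_cong del: of_nat_Suc sum.lessThan_Suc)
qed

section \<open>Growth of the paths at both ends of the time axis\<close>

context wiener_noise begin

lemma expectation_increment:
  assumes "s < t"
  shows "P.expectation (\<lambda>\<omega>. \<omega> j t - \<omega> j s) = 0"
proof -
  have "P.expectation (\<lambda>\<omega>. \<omega> j t - \<omega> j s) = integral\<^sup>L (distr P borel (\<lambda>\<omega>. \<omega> j t - \<omega> j s)) (\<lambda>x. x)"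
    by (subst integral_distr) (auto intro: increment_measurable[OF assms])
  also have "\<dots> = (\<integral>x. normal_density 0 (sqrt (t - s)) x * (x - 0) ^ (2 * 0 + 1) \<partial>lborel)"
    unfolding distr_increment[OF assms] by (subst integral_density) auto
  also have "\<dots> = 0" using assms by (intro has_bochner_integral_integral_eq normal_moment_odd) auto
  finally show ?thesis .
qed

lemma AE_unit_blocks:
  "AE \<omega> in P. (\<lambda>K. (\<Sum>k<K. sup_norm 1 (incr (real k) \<omega>)) / K) \<longlonglongrightarrow> P.expectation (\<lambda>\<omega>. sup_norm 1 (incr 0 \<omega>))"
  using strong_law_blocks[OF zero_less_one sup_lip_sup_norm[OF zero_le_one] sup_norm_nonneg[OF _ zero_le_one]] by simp

lemma AE_integer_times: "AE \<omega> in P. (\<lambda>K. \<omega> j (real K) / K) \<longlonglongrightarrow> 0"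
proof -
  \<comment> \<open>Adding \<open>sup_norm\<close> makes the increment nonnegative; its own strong
    law, \<open>AE_unit_blocks\<close>, is subtracted afterwards.\<close>
  define H where "H w = w 1 $ j + sup_norm 1 w" for w :: "real \<Rightarrow> real ^ 'i"
  have lip: "sup_lip 1 2 H"
    unfolding sup_lip_def
  proof (intro conjI allI impI)
    fix w w' :: "real \<Rightarrow> real ^ 'i" and \<eta> :: real
    assume c: "continuous_on UNIV w" "continuous_on UNIV w'" and le: "\<forall>t\<ge>0. t \<le> 1 \<longrightarrow> norm (w t - w' t) \<le> \<eta>"
    have "\<bar>(w 1 - w' 1) $ j\<bar> \<le> norm (w 1 - w' 1)" by (rule component_le_norm_cart)
    then have "\<bar>w 1 $ j - w' 1 $ j\<bar> \<le> \<eta>" using le[rule_format, of 1] by simp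
    moreover have "\<bar>sup_norm 1 w - sup_norm 1 w'\<bar> \<le> 1 * \<eta>"
      using le by (intro sup_lipD[OF sup_lip_sup_norm c]) auto
    ultimately show "\<bar>H w - H w'\<bar> \<le> 2 * \<eta>" by (simp add: H_def)
  qed simp
  have nn: "0 \<le> H w" if "continuous_on UNIV w" for w
    using component_le_norm_cart[of "w 1" j] sup_norm_ge[OF that, of 1 1] by (simp add: H_def)
  have "P.expectation (\<lambda>\<omega>. incr 0 \<omega> 1 $ j) = 0"
    using expectation_increment[of 0 1 j] by (simp add: incr_def)
  moreover have "integrable P (\<lambda>\<omega>. incr 0 \<omega> 1 $ j)"
  proof -
    have "integrable P (\<lambda>\<omega>. H (incr 0 \<omega>) - sup_norm 1 (incr 0 \<omega>))"
      by (intro Bochner_Integration.integrable_diff functional_integrable[OF zero_less_one lip] sup_norm_inc_integrable zero_less_one)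
    then show ?thesis by (simp add: H_def)
  qed
  ultimately have "P.expectation (\<lambda>\<omega>. H (incr 0 \<omega>)) = P.expectation (\<lambda>\<omega>. sup_norm 1 (incr 0 \<omega>))"
    using sup_norm_inc_integrable[OF zero_less_one, of 0] by (simp add: H_def)
  with strong_law_blocks[OF zero_less_one lip nn]
  have "AE \<omega> in P. (\<lambda>K. (\<Sum>k<K. H (incr (real k) \<omega>)) / K) \<longlonglongrightarrow> P.expectation (\<lambda>\<omega>. sup_norm 1 (incr 0 \<omega>))" by simp
  then show ?thesis using AE_unit_blocks AE_space
  proof eventually_elim
    case (elim \<omega>)
    from tendsto_diff[OF elim(1,2)]
    have "(\<lambda>K. (\<Sum>k<K. incr (real k) \<omega> 1 $ j) / K) \<longlonglongrightarrow> 0"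
      by (simp add: H_def sum.distrib diff_divide_distrib[symmetric])
    moreover have "(\<Sum>k<K. incr (real k) \<omega> 1 $ j) = \<omega> j (real K)" for K
      using sum_lessThan_telescope[of "\<lambda>k. \<omega> j (real k)" K] path_0[OF elim(3)] by (simp add: incr_def add.commute)
    ultimately show ?case by simp
  qed
qed

text \<open>Between integers the path moves by at most the supremum over the unit block, which is
  o(K) because the averages of these suprema converge.\<close>

theorem AE_sublinear: "AE \<omega> in P. \<forall>j. ((\<lambda>t. \<omega> j t / t) \<longlongrightarrow> 0) at_top"
proof -
  have "AE \<omega> in P. ((\<lambda>t. \<omega> j t / t) \<longlongrightarrow> 0) at_top" for j
    using AE_unit_blocks AE_integer_times[of j] AE_space
  proof eventually_elim
    case (elim \<omega>)
    let ?M = "\<lambda>K. sup_norm 1 (incr (real K) \<omega>)"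
    have "(\<lambda>K. \<bar>\<omega> j (real K) / K\<bar> + ?M K / K) \<longlonglongrightarrow> 0"
      using tendsto_add[OF tendsto_rabs[OF elim(2)] tendsto_increment_div[OF elim(1)]] by simp
    moreover have "filterlim (\<lambda>t::real. nat \<lfloor>t\<rfloor>) sequentially at_top"
      by (intro filterlim_compose[OF filterlim_nat_sequentially filterlim_floor_sequentially])
    ultimately have "((\<lambda>t::real. \<bar>\<omega> j (real (nat \<lfloor>t\<rfloor>)) / (nat \<lfloor>t\<rfloor>)\<bar> + ?M (nat \<lfloor>t\<rfloor>) / (nat \<lfloor>t\<rfloor>)) \<longlongrightarrow> 0) at_top"
      by (rule filterlim_compose)
    moreover have "\<forall>\<^sub>F t in at_top. norm (\<omega> j t / t) \<le> \<bar>\<omega> j (real (nat \<lfloor>t\<rfloor>)) / (nat \<lfloor>t\<rfloor>)\<bar> + ?M (nat \<lfloor>t\<rfloor>) / (nat \<lfloor>t\<rfloor>)"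
      using eventually_ge_at_top[of "1::real"]
    proof eventually_elim
      case (elim t)
      define K where "K = nat \<lfloor>t\<rfloor>"
      have K: "1 \<le> real K" "real K \<le> t" "t \<le> real K + 1" using elim by (auto simp: K_def)
      have "\<bar>incr (real K) \<omega> (t - real K) $ j\<bar> \<le> norm (incr (real K) \<omega> (t - real K))" by (rule component_le_norm_cart)
      also have "\<dots> \<le> ?M K" using K by (intro sup_norm_ge continuous_incr \<open>\<omega> \<in> space P\<close>) auto
      finally have "\<bar>\<omega> j t\<bar> \<le> \<bar>\<omega> j (real K)\<bar> + ?M K" by (simp add: incr_def)
      then have "\<bar>\<omega> j t\<bar> / t \<le> (\<bar>\<omega> j (real K)\<bar> + ?M K) / real K"
        using K by (intro frac_le) auto
      then show ?case using K elim by (simp add: K_def[symmetric] add_divide_distrib abs_divide)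
    qed
    ultimately show ?case by (rule Lim_null_comparison[rotated])
  qed
  then show ?thesis by (subst AE_all_countable) auto
qed

text \<open>A crude polynomial bound is enough against the exponential weight in \<open>ou\<close>.
  Second moments give suprema of order k on the k-th backward block, and telescoping makes this
  quadratic.\<close>

lemma AE_backward_growth: "AE \<omega> in P. \<exists>C. \<forall>j. \<forall>t\<ge>0. \<bar>\<omega> j (- t)\<bar> \<le> C * (1 + t)\<^sup>2"
proof -
  let ?M = "\<lambda>k \<omega>. sup_norm 1 (incr (- real (Suc k)) \<omega>)"
  have "AE \<omega> in P. (\<lambda>k. (?M k \<omega>)\<^sup>2 / (real (Suc k))\<^sup>2) \<longlonglongrightarrow> 0"
  proof (rule AE_tendsto_0_if_summable[where b = "\<lambda>k. (665 * real CARD('i)) * inverse ((real (Suc k))\<^sup>2)"])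
    show "integrable P (\<lambda>\<omega>. (?M k \<omega>)\<^sup>2 / (real (Suc k))\<^sup>2)" for k
      using sup_norm_inc_sq(1)[OF zero_less_one] by (intro integrable_divide_zero) auto
    show "P.expectation (\<lambda>\<omega>. (?M k \<omega>)\<^sup>2 / (real (Suc k))\<^sup>2) \<le> (665 * real CARD('i)) * inverse ((real (Suc k))\<^sup>2)" for k
    proof -
      have "P.expectation (\<lambda>\<omega>. (?M k \<omega>)\<^sup>2 / (real (Suc k))\<^sup>2) = P.expectation (\<lambda>\<omega>. (?M k \<omega>)\<^sup>2) / (real (Suc k))\<^sup>2"
        by (rule integral_divide_zero)
      also have "\<dots> \<le> (665 * real CARD('i)) / (real (Suc k))\<^sup>2"
        using sup_norm_inc_sq(2)[OF zero_less_one, of "- real (Suc k)"] by (intro divide_right_mono) (simp_all del: of_nat_Suc)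
      finally show ?thesis by (simp add: divide_inverse)
    qed
    have "summable (\<lambda>k. inverse ((real (Suc k))\<^sup>2))"
      using inverse_power_summable[of 2, where ?'a = real] by (subst summable_Suc_iff) simp
    then show "summable (\<lambda>k. (665 * real CARD('i)) * inverse ((real (Suc k))\<^sup>2))" by (rule summable_mult)
  qed simp
  then show ?thesis using AE_space
  proof eventually_elim
    case (elim \<omega>)
    have "Bseq (\<lambda>k. (?M k \<omega>)\<^sup>2 / (real (Suc k))\<^sup>2)" using elim(1) by (intro convergent_imp_Bseq convergentI)
    then obtain B where B: "0 < B" "\<And>k. norm ((?M k \<omega>)\<^sup>2 / (real (Suc k))\<^sup>2) \<le> B" by (auto simp: Bseq_def)
    define C where "C = sqrt B"
    have C: "0 \<le> C" using B by (simp add: C_def)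
    have M: "?M k \<omega> \<le> C * real (Suc k)" for k
    proof -
      have "(?M k \<omega> / real (Suc k))\<^sup>2 \<le> B" using B(2)[of k] by (simp add: power_divide)
      then have "?M k \<omega> / real (Suc k) \<le> C" unfolding C_def by (rule real_le_rsqrt)
      then show ?thesis by (simp add: divide_le_eq del: of_nat_Suc)
    qed
    \<comment> \<open>The block with number k reaches from -(k + 1) to -k.\<close>
    have step: "\<bar>\<omega> j (- real (Suc k) + r) - \<omega> j (- real (Suc k))\<bar> \<le> C * real (Suc k)" if "0 \<le> r" "r \<le> 1" for j k r
    proof -
      have "\<bar>incr (- real (Suc k)) \<omega> r $ j\<bar> \<le> norm (incr (- real (Suc k)) \<omega> r)" by (rule component_le_norm_cart)
      also have "\<dots> \<le> ?M k \<omega>" by (intro sup_norm_ge continuous_incr elim that)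
      finally show ?thesis using M[of k] by (simp add: incr_def)
    qed
    have int: "\<bar>\<omega> j (- real k)\<bar> \<le> C * (real k)\<^sup>2" for j k
    proof (induction k)
      case (Suc k)
      have "\<bar>\<omega> j (- real (Suc k))\<bar> \<le> C * (real k)\<^sup>2 + C * real (Suc k)"
        using step[of 1 j k] Suc by simp
      also have "\<dots> \<le> C * (real (Suc k))\<^sup>2"
        unfolding distrib_left[symmetric] using C by (intro mult_left_mono) (simp_all add: power2_eq_square algebra_simps)
      finally show ?case .
    qed (use path_0[OF elim(2)] in simp)
    show ?case
    proof (intro exI[of _ "2 * C"] allI impI)
      fix j and t :: real assume t: "0 \<le> t"
      define k where "k = nat \<lfloor>t\<rfloor>"
      have "real k = of_int \<lfloor>t\<rfloor>" using t by (simp add: k_def)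
      then have k: "real k \<le> t" "t \<le> real (Suc k)" unfolding of_nat_Suc by linarith+
      have "\<bar>\<omega> j (- t)\<bar> \<le> C * (real (Suc k))\<^sup>2 + C * real (Suc k)"
        using step[of "real (Suc k) - t" j k] int[of j "Suc k"] k by simp
      also have "\<dots> \<le> C * (real (Suc k))\<^sup>2 + C * (real (Suc k))\<^sup>2"
        using C by (intro add_left_mono mult_left_mono) (auto simp: power2_eq_square)
      also have "\<dots> = 2 * C * (real (Suc k))\<^sup>2" by simp
      also have "\<dots> \<le> 2 * C * (1 + t)\<^sup>2" using C k by (intro mult_left_mono power_mono) auto
      finally show "\<bar>\<omega> j (- t)\<bar> \<le> 2 * C * (1 + t)\<^sup>2" .
    qed
  qed
qed

end

section \<open>The stationary Ornstein--Uhlenbeck process\<close>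

lemma exp_integral_left_half_line:
  fixes u :: real
  assumes u: "0 < u"
  shows "set_integrable lborel {..0} (\<lambda>s. exp (u * s))"
    and "(LINT s:{..0}|lborel. exp (u * s)) = 1 / u"
proof -
  define F where "F x = indicator {0<..} x *\<^sub>R exp (- (x * u))" for x :: real
  have F: "integrable lborel F" "integral\<^sup>L lborel F = 1 / u"
    using integrable_I0i_exp_mscale[OF u] LBINT_I0i_exp_mscale[OF u]
    by (simp_all add: F_def[abs_def] set_integrable_def interval_lebesgue_integral_0_infty set_lebesgue_integral_def)
  have ae: "AE s in lborel. F (0 + - 1 * s) = indicator {..0} s *\<^sub>R exp (u * s)"
    using AE_lborel_singleton[of 0]
    by eventually_elim (auto simp: F_def mult.commute split: split_indicator)
  have meas: "(\<lambda>s. F (0 + - 1 * s)) \<in> borel_measurable lborel" unfolding F_def by measurable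
  show "set_integrable lborel {..0} (\<lambda>s. exp (u * s))"
    unfolding set_integrable_def
    using lborel_integrable_real_affine[OF F(1), of "-1" 0]
    by (rule integrable_cong_AE_imp) (use ae in auto)
  have "(LINT s:{..0}|lborel. exp (u * s)) = integral\<^sup>L lborel (\<lambda>s. F (0 + - 1 * s))"
    unfolding set_lebesgue_integral_def by (rule integral_cong_AE[symmetric]) (use ae meas in auto)
  then show "(LINT s:{..0}|lborel. exp (u * s)) = 1 / u"
    using lborel_integral_real_affine[of "-1" F 0] F(2) by simp
qed

lemma set_integrable_exp_times_growth:
  fixes w :: "real \<Rightarrow> real"
  assumes cont: "continuous_on UNIV w" and growth: "\<And>t. 0 \<le> t \<Longrightarrow> \<bar>w (- t)\<bar> \<le> C * (1 + t)\<^sup>2"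
  shows "set_integrable lborel {..0} (\<lambda>r. exp r * w r)"
proof (rule set_integrable_bound)
  have C: "0 \<le> C" using growth[of 0] by simp
  show "set_integrable lborel {..0} (\<lambda>r. (16 * C) * exp ((1/2) * r))"
    by (rule set_integrable_mult_right) (use exp_integral_left_half_line(1)[of "1/2"] in simp)
  have [measurable]: "w \<in> borel_measurable borel" by (rule borel_measurable_continuous_onI[OF cont])
  show "set_borel_measurable lborel {..0} (\<lambda>r. exp r * w r)" unfolding set_borel_measurable_def by measurable
  show "AE r in lborel. r \<in> {..0} \<longrightarrow> norm (exp r * w r) \<le> norm ((16 * C) * exp ((1/2) * r))"
  proof (intro AE_I2 impI)
    fix r :: real assume r: "r \<in> {..0}"
    \<comment> \<open>Half of the exponential weight is used against the quadratic growth; the other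
      half remains integrable.\<close>
    have "1 - r \<le> 4 * exp (- r / 4)" using exp_ge_add_one_self[of "- r / 4"] by simp
    then have "(1 - r)\<^sup>2 \<le> (4 * exp (- r / 4))\<^sup>2" using r by (intro power_mono) auto
    also have "\<dots> = 16 * exp (- r / 2)" by (simp add: power_mult_distrib exp_double[symmetric])
    finally have "C * (1 - r)\<^sup>2 \<le> C * (16 * exp (- r / 2))" using C by (rule mult_left_mono)
    then have "exp r * \<bar>w r\<bar> \<le> exp r * (C * (16 * exp (- r / 2)))"
      using growth[of "- r"] r by (intro mult_left_mono) auto
    also have "\<dots> = (16 * C) * exp ((1/2) * r)" by (simp add: exp_add[symmetric])
    finally show "norm (exp r * w r) \<le> norm ((16 * C) * exp ((1/2) * r))" using C by (simp add: abs_mult)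
  qed
qed

text \<open>The substitution r = s + t moves the time from the shifted path to the upper limit of an
  integral, where it can be differentiated.\<close>

lemma ou_integral:
  fixes w :: "real \<Rightarrow> real"
  assumes cont: "continuous_on UNIV w" and growth: "\<And>t. 0 \<le> t \<Longrightarrow> \<bar>w (- t)\<bar> \<le> C * (1 + t)\<^sup>2" and t: "0 \<le> t"
  shows "(LINT s:{..0}|lborel. exp s * (w (s + t) - w t)) =
    exp (- t) * ((LINT r:{..0}|lborel. exp r * w r) + integral {0..t} (\<lambda>r. exp r * w r)) - w t"
proof -
  let ?f = "\<lambda>r. exp r * w r"
  have int0: "set_integrable lborel {..0} ?f" by (rule set_integrable_exp_times_growth[OF cont growth])
  have int1: "set_integrable lborel {0..t} ?f"
    by (intro borel_integrable_atLeastAtMost' continuous_intros continuous_on_subset[OF cont]) auto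
  have un: "{..0} \<union> {0..t} = {..t}" using t by auto
  have intt: "set_integrable lborel {..t} ?f"
    using set_integrable_Un[OF int0 int1] by (simp add: un)
  have "(LINT r:{..0} \<union> {0..t}|lborel. ?f r) = (LINT r:{..0}|lborel. ?f r) + (LINT r:{0..t}|lborel. ?f r)"
    by (rule set_integral_Un_AE[OF _ _ _ int0 int1]) (use AE_lborel_singleton[of 0] in auto)
  then have It: "(LINT r:{..t}|lborel. ?f r) = (LINT r:{..0}|lborel. ?f r) + integral {0..t} ?f"
    by (simp add: un set_borel_integral_eq_integral(2)[OF int1])
  have ind: "indicator {..t} (t + 1 * s) = (indicator {..0} s :: real)" for s by (simp add: indicator_def)
  have pt: "exp (- t) * (x *\<^sub>R ?f (t + 1 * s)) = x *\<^sub>R (exp s * w (s + t))" for x s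
  proof -
    have "exp (- t) * (x *\<^sub>R ?f (t + 1 * s)) = x * ((exp (- t) * exp (t + 1 * s)) * w (t + 1 * s))"
      by (simp add: mult_ac)
    also have "exp (- t) * exp (t + 1 * s) = exp s" by (simp add: exp_add[symmetric])
    finally show ?thesis by (simp add: add.commute)
  qed
  have trans_int: "integrable lborel (\<lambda>s. indicator {..0} s *\<^sub>R (exp s * w (s + t)))"
  proof -
    have "integrable lborel (\<lambda>s. exp (- t) * (indicator {..t} (t + 1 * s) *\<^sub>R ?f (t + 1 * s)))"
      using lborel_integrable_real_affine[OF intt[unfolded set_integrable_def], of 1 t] by (intro integrable_mult_right) simp
    then show ?thesis unfolding pt ind .
  qed
  have trans: "(LINT s:{..0}|lborel. exp s * w (s + t)) = exp (- t) * (LINT r:{..t}|lborel. ?f r)"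
  proof -
    have "exp (- t) * (LINT r:{..t}|lborel. ?f r) = exp (- t) * (\<integral>s. indicator {..t} (t + 1 * s) *\<^sub>R ?f (t + 1 * s) \<partial>lborel)"
      unfolding set_lebesgue_integral_def
      using lborel_integral_real_affine[of 1 "\<lambda>r. indicator {..t} r *\<^sub>R ?f r" t] by simp
    also have "\<dots> = (\<integral>s. exp (- t) * (indicator {..t} (t + 1 * s) *\<^sub>R ?f (t + 1 * s)) \<partial>lborel)" by simp
    also have "\<dots> = (LINT s:{..0}|lborel. exp s * w (s + t))"
      unfolding pt ind set_lebesgue_integral_def ..
    finally show ?thesis ..
  qed
  have e: "set_integrable lborel {..0} (\<lambda>s::real. exp s)" "(LINT s:{..0}|lborel. exp s) = (1::real)"
    using exp_integral_left_half_line[of 1] by simp_all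
  have "(LINT s:{..0}|lborel. exp s * (w (s + t) - w t)) = (LINT s:{..0}|lborel. exp s * w (s + t) - w t * exp s)"
    by (simp add: algebra_simps)
  also have "\<dots> = (LINT s:{..0}|lborel. exp s * w (s + t)) - (LINT s:{..0}|lborel. w t * exp s)"
    using trans_int e(1) by (intro set_integral_diff set_integrable_mult_right) (simp_all add: set_integrable_def)
  also have "\<dots> = exp (- t) * ((LINT r:{..0}|lborel. ?f r) + integral {0..t} ?f) - w t"
    by (simp add: trans It e(2))
  finally show ?thesis .
qed

lemma has_vector_derivative_componentwise:
  fixes f :: "real \<Rightarrow> real ^ 'i::finite"
  assumes "\<And>j. ((\<lambda>t. f t $ j) has_vector_derivative f' $ j) (at t within S)"
  shows "(f has_vector_derivative f') (at t within S)"
  using assms unfolding has_vector_derivative_def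
  by (subst has_derivative_componentwise_within) (auto simp: Basis_vec_def inner_axis)

text \<open>The equation dz + z dt = dW in integrated form: neither the path nor z need be
  differentiable, but their difference is.\<close>

lemma ou_deriv:
  fixes \<omega> :: "'i::finite \<Rightarrow> real \<Rightarrow> real" and \<epsilon> :: "real ^ 'i"
  assumes cont: "\<And>j. continuous_on UNIV (\<omega> j)" and growth: "\<And>j t. 0 \<le> t \<Longrightarrow> \<bar>\<omega> j (- t)\<bar> \<le> C * (1 + t)\<^sup>2"
    and t: "0 \<le> t"
  shows "((\<lambda>t. ou \<epsilon> (shift t \<omega>) - (\<chi> j. \<epsilon> $ j * \<omega> j t)) has_vector_derivative - ou \<epsilon> (shift t \<omega>)) (at t within {0..})"
proof -
  define J where "J j t = (LINT r:{..0}|lborel. exp r * \<omega> j r) + integral {0..t} (\<lambda>r. exp r * \<omega> j r)" for j t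
  have ou: "ou \<epsilon> (shift t \<omega>) $ j = \<epsilon> $ j * (\<omega> j t - exp (- t) * J j t)" if "0 \<le> t" for j t
  proof -
    have "ou \<epsilon> (shift t \<omega>) $ j = - (\<epsilon> $ j) * (LINT s:{..0}|lborel. exp s * (\<omega> j (s + t) - \<omega> j t))"
      by (simp add: ou_def shift_def)
    also have "(LINT s:{..0}|lborel. exp s * (\<omega> j (s + t) - \<omega> j t)) = exp (- t) * J j t - \<omega> j t"
      unfolding J_def by (rule ou_integral[OF cont growth that])
    finally show ?thesis by (simp add: algebra_simps)
  qed
  have J: "(J j has_vector_derivative exp t * \<omega> j t) (at t within {0..})" for j
  proof -
    have c: "continuous_on UNIV (\<lambda>r. exp r * \<omega> j r)" by (intro continuous_intros cont)
    show ?thesis unfolding J_def[abs_def]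
      using has_vector_derivative_add[OF has_vector_derivative_const integral_has_vector_derivative_halfline[OF c t]] by simp
  qed
  define Z where "Z t = (\<chi> j. - (\<epsilon> $ j) * (exp (- t) * J j t))" for t
  have eq: "ou \<epsilon> (shift t \<omega>) - (\<chi> j. \<epsilon> $ j * \<omega> j t) = Z t" if "0 \<le> t" for t
    using ou[OF that] by (simp add: vec_eq_iff Z_def algebra_simps)
  have "((\<lambda>t. Z t $ j) has_vector_derivative (- ou \<epsilon> (shift t \<omega>)) $ j) (at t within {0..})" for j
  proof -
    have "((\<lambda>t. - (\<epsilon> $ j) * (exp (- t) * J j t)) has_real_derivative - (\<epsilon> $ j) * (exp (- t) * (exp t * \<omega> j t) + (- exp (- t)) * J j t)) (at t within {0..})"
      by (rule derivative_eq_intros refl J[unfolded has_real_derivative_iff_has_vector_derivative[symmetric]] | simp)+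
    moreover have "- (\<epsilon> $ j) * (exp (- t) * (exp t * \<omega> j t) + (- exp (- t)) * J j t) = (- ou \<epsilon> (shift t \<omega>)) $ j"
      using ou[OF t, of j] by (simp add: exp_minus algebra_simps)
    ultimately show ?thesis by (simp add: Z_def has_real_derivative_iff_has_vector_derivative)
  qed
  then have "(Z has_vector_derivative - ou \<epsilon> (shift t \<omega>)) (at t within {0..})"
    by (rule has_vector_derivative_componentwise)
  then show ?thesis
    by (rule has_vector_derivative_transform[rotated 2]) (use t eq in auto)
qed

section \<open>The rotation number\<close>

text \<open>Summing the halving recursion bounds the sum of the q k by the initial value and twice
  the inputs. The 1 in the conclusion is slack for the limits.\<close>

lemma block_average:
  fixes S D q M :: "nat \<Rightarrow> real"
  assumes step: "\<And>k. \<bar>S (Suc k) - S k - D k\<bar> \<le> c' * q k + \<kappa>"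
    and q: "\<And>k. q (Suc k) \<le> q k / 2 + C * (1 + E * M k)" "\<And>k. 0 \<le> q k" and c': "0 \<le> c'"
    and D: "(\<lambda>K. (\<Sum>k<K. D k) / K) \<longlonglongrightarrow> d" and M: "(\<lambda>K. (\<Sum>k<K. M k) / K) \<longlonglongrightarrow> m"
  shows "\<forall>\<^sub>F K in sequentially. \<bar>S K - d * K\<bar> \<le> (\<kappa> + 2 * c' * C * (1 + E * m) + 1) * K"
proof -
  have sumq: "(\<Sum>k<K. q k) + 2 * q K \<le> 2 * q 0 + 2 * C * (\<Sum>k<K. 1 + E * M k)" for K
  proof (induction K)
    case (Suc K)
    then show ?case using q(1)[of K] by (simp add: distrib_left)
  qed simp
  have S: "\<bar>S K - S 0 - (\<Sum>k<K. D k)\<bar> \<le> c' * (\<Sum>k<K. q k) + \<kappa> * K" for K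
  proof (induction K)
    case (Suc K)
    then show ?case using step[of K] by (simp add: algebra_simps)
  qed simp
  define R where "R K = (\<bar>S 0\<bar> + 2 * c' * q 0) / real K + 2 * c' * C * (1 + E * ((\<Sum>k<K. M k) / K)) + \<kappa> + \<bar>(\<Sum>k<K. D k) / K - d\<bar>" for K
  have "R \<longlonglongrightarrow> 0 + 2 * c' * C * (1 + E * m) + \<kappa> + \<bar>d - d\<bar>"
    unfolding R_def by (intro tendsto_intros D M lim_const_over_n)
  then have "\<forall>\<^sub>F K in sequentially. R K < \<kappa> + 2 * c' * C * (1 + E * m) + 1"
    by (rule order_tendstoD) simp
  then show ?thesis using eventually_gt_at_top[of 0]
  proof eventually_elim
    case (elim K)
    have K: "0 < real K" using elim by simp
    have "c' * (\<Sum>k<K. q k) \<le> c' * (2 * q 0 + 2 * C * (\<Sum>k<K. 1 + E * M k))"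
      using sumq[of K] q(2)[of K] c' by (intro mult_left_mono) auto
    also have "(\<Sum>k<K. 1 + E * M k) = K + E * (\<Sum>k<K. M k)" by (simp add: sum.distrib sum_distrib_left)
    finally have "\<bar>S K - d * K\<bar> \<le> \<bar>S 0\<bar> + c' * (2 * q 0 + 2 * C * (K + E * (\<Sum>k<K. M k))) + \<kappa> * K + \<bar>(\<Sum>k<K. D k) - d * K\<bar>"
      using S[of K] by linarith
    also have "\<dots> = R K * K"
    proof -
      define mM dD where "mM = (\<Sum>k<K. M k) / K" and "dD = (\<Sum>k<K. D k) / K"
      have sums: "(\<Sum>k<K. M k) = mM * K" "(\<Sum>k<K. D k) = dD * K" using K by (simp_all add: mM_def dD_def)
      have abs: "\<bar>dD * K - d * K\<bar> = \<bar>dD - d\<bar> * K" using K by (simp add: abs_mult flip: left_diff_distrib)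
      have "(\<bar>S 0\<bar> + 2 * c' * q 0) / real K * K = \<bar>S 0\<bar> + 2 * c' * q 0" using K by simp
      then show ?thesis
        unfolding R_def mM_def[symmetric] dD_def[symmetric] sums abs by (simp only: distrib_right) (simp add: algebra_simps)
    qed
    also have "\<dots> \<le> (\<kappa> + 2 * c' * C * (1 + E * m) + 1) * K" using elim by (intro mult_right_mono) auto
    finally show ?case .
  qed
qed

text \<open>An incomplete block costs at most \<open>C0 * T + \<bar>d\<bar>\<close>, the second part
  by rounding t / T; for large t this is below t / T, which accounts for the additional 1.\<close>

lemma continuous_time_average:
  fixes y :: "real \<Rightarrow> real" and d B C0 T :: real
  assumes T: "0 < T" and lip: "\<And>s t. 0 \<le> s \<Longrightarrow> s \<le> t \<Longrightarrow> \<bar>y t - y s\<bar> \<le> C0 * (t - s)" and C0: "0 \<le> C0"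
    and blocks: "\<forall>\<^sub>F K in sequentially. \<bar>y (real K * T) - d * K\<bar> \<le> B * K" and B: "0 \<le> B"
  shows "\<forall>\<^sub>F t in at_top. \<bar>y t / t - d / T\<bar> \<le> (B + 1) / T"
proof -
  have "filterlim (\<lambda>t. t * (1 / T)) at_top at_top"
    using T by (intro filterlim_tendsto_pos_mult_at_top[OF tendsto_const _ filterlim_ident, of "1/T", simplified mult.commute]) auto
  then have fl: "filterlim (\<lambda>t. nat \<lfloor>t / T\<rfloor>) sequentially at_top"
    using filterlim_compose[OF filterlim_compose[OF filterlim_nat_sequentially filterlim_floor_sequentially]] by simp
  from eventually_compose_filterlim[OF blocks fl] eventually_ge_at_top[of "(C0 * T + \<bar>d\<bar>) * T"] eventually_gt_at_top[of 0]
  show ?thesis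
  proof eventually_elim
    case (elim t)
    define K where "K = nat \<lfloor>t / T\<rfloor>"
    have t: "0 < t" using elim by simp
    have "0 \<le> t / T" using t T by simp
    then have "real K = of_int \<lfloor>t / T\<rfloor>" by (simp add: K_def)
    then have "real K \<le> t / T" "t / T \<le> real K + 1" by linarith+
    then have K: "real K * T \<le> t" "t \<le> real K * T + T" using T by (auto simp: field_simps)
    have "\<bar>y t - y (real K * T)\<bar> \<le> C0 * (t - real K * T)" using T K by (intro lip) auto
    also have "\<dots> \<le> C0 * T" using C0 K by (intro mult_left_mono) auto
    finally have 1: "\<bar>y t - y (real K * T)\<bar> \<le> C0 * T" .
    have 2: "\<bar>y (real K * T) - d * K\<bar> \<le> B * K" using elim(1) by (simp add: K_def)
    have KT: "real K \<le> t / T" "\<bar>real K - t / T\<bar> \<le> 1" using K T by (auto simp: field_simps abs_le_iff)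
    have "\<bar>d * K - d * (t / T)\<bar> = \<bar>d\<bar> * \<bar>real K - t / T\<bar>" by (simp only: abs_mult[symmetric] right_diff_distrib)
    also have "\<dots> \<le> \<bar>d\<bar> * 1" using KT by (intro mult_left_mono) auto
    finally have 3: "\<bar>d * K - d * (t / T)\<bar> \<le> \<bar>d\<bar>" by simp
    have 4: "B * K \<le> B * (t / T)" using KT B by (intro mult_left_mono) auto
    have 5: "C0 * T + \<bar>d\<bar> \<le> t / T" using elim(2) T by (simp add: field_simps)
    have "\<bar>y t - d * (t / T)\<bar> \<le> (B + 1) * (t / T)"
      unfolding distrib_right mult_1_left using 1 2 3 4 5 by linarith
    moreover have "\<bar>y t - d * (t / T)\<bar> = \<bar>y t / t - d / T\<bar> * t"
    proof -
      have "y t - d * (t / T) = (y t / t - d / T) * t" using t by (simp add: left_diff_distrib)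
      then show ?thesis using t by (simp add: abs_mult)
    qed
    ultimately have "\<bar>y t / t - d / T\<bar> * t \<le> (B + 1) / T * t" by simp
    then show ?case using t by (rule mult_right_le_imp_le)
  qed
qed

text \<open>A single y lies eventually close to both r n and r m, so r is Cauchy. As r is the same
  for all y, so is the limit.\<close>

lemma common_limit:
  fixes r e :: "nat \<Rightarrow> real"
  assumes e: "e \<longlonglongrightarrow> 0" and ne: "Y \<noteq> {}"
    and Y: "\<And>y n. y \<in> Y \<Longrightarrow> n0 \<le> n \<Longrightarrow> \<forall>\<^sub>F t::real in at_top. \<bar>y t - r n\<bar> \<le> e n"
  obtains \<rho> where "\<And>y. y \<in> Y \<Longrightarrow> (y \<longlongrightarrow> \<rho>) at_top"
proof -
  obtain y0 where y0: "y0 \<in> Y" using ne by blast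
  have rr: "\<bar>r n - r m\<bar> \<le> e n + e m" if "n0 \<le> n" "n0 \<le> m" for n m
  proof -
    have "\<forall>\<^sub>F t::real in at_top. \<bar>r n - r m\<bar> \<le> e n + e m"
      using Y[OF y0 that(1)] Y[OF y0 that(2)] by eventually_elim linarith
    then show ?thesis by simp
  qed
  have "Cauchy r"
  proof (rule metric_CauchyI)
    fix \<epsilon> :: real assume "0 < \<epsilon>"
    then have "\<forall>\<^sub>F n in sequentially. e n < \<epsilon> / 2" by (intro order_tendstoD[OF e]) simp
    then obtain N where N: "\<And>n. N \<le> n \<Longrightarrow> e n < \<epsilon> / 2" by (auto simp: eventually_sequentially)
    show "\<exists>M. \<forall>m\<ge>M. \<forall>n\<ge>M. dist (r m) (r n) < \<epsilon>"
    proof (intro exI[of _ "max N n0"] allI impI)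
      fix m n assume "max N n0 \<le> m" "max N n0 \<le> n"
      then show "dist (r m) (r n) < \<epsilon>"
        using rr[of m n] N[of m] N[of n] by (simp add: dist_real_def)
    qed
  qed
  then obtain \<rho> where \<rho>: "r \<longlonglongrightarrow> \<rho>" using Cauchy_convergent_iff convergent_def by blast
  have "(y \<longlongrightarrow> \<rho>) at_top" if y: "y \<in> Y" for y
  proof (rule tendstoI)
    fix \<epsilon> :: real assume \<epsilon>: "0 < \<epsilon>"
    have "\<forall>\<^sub>F n in sequentially. e n < \<epsilon> / 2 \<and> dist (r n) \<rho> < \<epsilon> / 2 \<and> n0 \<le> n"
      using \<epsilon> by (intro eventually_conj order_tendstoD[OF e] tendstoD[OF \<rho>] eventually_ge_at_top) auto
    then obtain n where n: "e n < \<epsilon> / 2" "dist (r n) \<rho> < \<epsilon> / 2" "n0 \<le> n" by (auto simp: eventually_sequentially)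
    show "\<forall>\<^sub>F t in at_top. dist (y t) \<rho> < \<epsilon>"
      using Y[OF y n(3)] by eventually_elim (use n[unfolded dist_real_def] in \<open>unfold dist_real_def, linarith\<close>)
  qed
  then show ?thesis by (rule that)
qed

locale stochastic_lattice = damped_lattice A lam1 K \<alpha> \<beta> \<delta> c1 c2 \<kappa> a L_F g f + wiener_noise W P
  for A :: "real ^ 'i ^ 'i::finite" and lam1 K \<alpha> \<beta> \<delta> c1 c2 \<kappa> a L_F g f and W
    and P :: "('i \<Rightarrow> real \<Rightarrow> real) measure" +
  fixes \<epsilon> :: "real ^ 'i"
begin

definition scaled :: "(real \<Rightarrow> real ^ 'i) \<Rightarrow> real \<Rightarrow> real ^ 'i" where
  "scaled w t = (\<chi> j. \<epsilon> $ j * w t $ j)"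

definition noise :: "('i \<Rightarrow> real \<Rightarrow> real) \<Rightarrow> real \<Rightarrow> real ^ 'i" where
  "noise \<omega> t = (\<chi> j. \<epsilon> $ j * \<omega> j t)"

lemma norm_scale: "norm (\<chi> j. \<epsilon> $ j * v $ j) \<le> norm \<epsilon> * norm v"
proof -
  have "norm (\<chi> j. \<epsilon> $ j * v $ j) \<le> norm (norm \<epsilon> *\<^sub>R v)"
    by (intro norm_le_componentwise_cart) (auto simp: abs_mult intro!: mult_right_mono component_le_norm_cart)
  then show ?thesis by simp
qed

lemma norm_scaled: "norm (scaled w t) \<le> norm \<epsilon> * norm (w t)"
  unfolding scaled_def by (rule norm_scale)

lemma norm_scaled_diff: "norm (scaled w t - scaled w' t) \<le> norm \<epsilon> * norm (w t - w' t)"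
proof -
  have "scaled w t - scaled w' t = (\<chi> j. \<epsilon> $ j * (w t - w' t) $ j)"
    by (simp add: scaled_def vec_eq_iff right_diff_distrib)
  then show ?thesis by (simp only: norm_scale)
qed

lemma continuous_scaled: "continuous_on UNIV w \<Longrightarrow> continuous_on UNIV (scaled w)"
  unfolding scaled_def by (intro continuous_intros)

lemma continuous_noise: "\<omega> \<in> space P \<Longrightarrow> continuous_on UNIV (noise \<omega>)"
  unfolding noise_def by (intro continuous_intros path_continuous)

lemma scaled_inc: "scaled (incr s \<omega>) = (\<lambda>t. noise \<omega> (s + t) - noise \<omega> s)"
  by (simp add: scaled_def incr_def noise_def fun_eq_iff vec_eq_iff right_diff_distrib)

lemma rhs_field: "rhs A K \<alpha> \<beta> g f z y = field z y + (0, z)"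
  by (simp add: rhs_def field_def G_def split_beta algebra_simps)

text \<open>Adding the noise minus z to the second coordinate turns the reduced velocity into v, and
  \<open>ou_deriv\<close> supplies the derivative. Since \<open>solution\<close> is a definite
  description, every competing solution has to be shown equal at time t.\<close>

lemma rds_eq_flow:
  assumes \<omega>: "\<omega> \<in> space P" and growth: "\<And>j t. 0 \<le> t \<Longrightarrow> \<bar>\<omega> j (- t)\<bar> \<le> C * (1 + t)\<^sup>2"
    and X: "flow (noise \<omega>) X" and X0: "X 0 = \<phi>0" and t: "0 \<le> t"
  shows "rds A K \<alpha> \<beta> g f \<epsilon> t \<omega> \<phi>0 = X t + (0, noise \<omega> t)"
proof -
  let ?z = "\<lambda>t. ou \<epsilon> (shift t \<omega>)"
  define Y where "Y t = X t + (0, noise \<omega> t - ?z t)" for t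
  have shift0: "shift 0 \<omega> = \<omega>" using path_0[OF \<omega>] by (simp add: shift_def)
  have noise0: "noise \<omega> 0 = 0" using path_0[OF \<omega>] by (simp add: noise_def vec_eq_iff)
  have "(Y has_vector_derivative rhs A K \<alpha> \<beta> g f (?z s) (Y s)) (at s within {0..})" if s: "0 \<le> s" for s
  proof -
    have "((\<lambda>t. ?z t - noise \<omega> t) has_vector_derivative - ?z s) (at s within {0..})"
      unfolding noise_def by (rule ou_deriv[OF path_continuous[OF \<omega>] growth s])
    from has_vector_derivative_minus[OF this]
    have "((\<lambda>t. noise \<omega> t - ?z t) has_vector_derivative ?z s) (at s within {0..})" by simp
    from has_vector_derivative_add[OF flowD[OF X s] has_vector_derivative_Pair[OF has_vector_derivative_const this]]
    have "(Y has_vector_derivative field (noise \<omega> s) (X s) + (0, ?z s)) (at s within {0..})"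
      by (simp add: Y_def[abs_def])
    moreover have "field (noise \<omega> s) (X s) = field (?z s) (Y s)" by (simp add: field_def Y_def)
    ultimately show ?thesis by (simp add: rhs_field)
  qed
  moreover have "Y 0 = (fst \<phi>0, snd \<phi>0 - ou \<epsilon> \<omega>)"
    by (simp add: Y_def X0 shift0 noise0 prod_eq_iff)
  ultimately have Y: "is_solution A K \<alpha> \<beta> g f \<epsilon> \<omega> (fst \<phi>0, snd \<phi>0 - ou \<epsilon> \<omega>) Y"
    by (simp add: is_solution_def)
  obtain L where L: "0 < L" "\<And>b b' y z. norm (field b y - field b' z) \<le> L * norm (y - z) + L * norm (b - b')"
    using field_lipschitz by blast
  have lipr: "norm (rhs A K \<alpha> \<beta> g f z y - rhs A K \<alpha> \<beta> g f z y') \<le> L * norm (y - y')" for z y y'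
    using L(2)[of z y z y'] by (simp add: rhs_field)
  have unique: "Y' t = Y t" if "is_solution A K \<alpha> \<beta> g f \<epsilon> \<omega> (fst \<phi>0, snd \<phi>0 - ou \<epsilon> \<omega>) Y'" for Y'
  proof (rule ode_unique[of Y' "\<lambda>t. rhs A K \<alpha> \<beta> g f (?z t)" Y L t])
    show "norm (rhs A K \<alpha> \<beta> g f (?z s) x - rhs A K \<alpha> \<beta> g f (?z s) y) \<le> L * norm (x - y)" for s x y by (rule lipr)
    show "Y' 0 = Y 0" using that Y by (simp only: is_solution_def)
  qed (use that Y L(1) t in \<open>simp_all only: is_solution_def\<close>)
  have "solution A K \<alpha> \<beta> g f \<epsilon> t \<omega> (fst \<phi>0, snd \<phi>0 - ou \<epsilon> \<omega>) = Y t"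
    unfolding solution_def
  proof (rule the_equality)
    show "\<exists>Y'. is_solution A K \<alpha> \<beta> g f \<epsilon> \<omega> (fst \<phi>0, snd \<phi>0 - ou \<epsilon> \<omega>) Y' \<and> Y' t = Y t" using Y by blast
  qed (use unique in blast)
  then show ?thesis by (simp add: rds_def split_beta Y_def)
qed

text \<open>E22 consists of the pairs with both means 0, so \<open>drift\<close> vanishes on E2 and
  equals 1 at \<open>eta0\<close>.\<close>

lemma proj_eq_drift: "proj \<alpha> y = drift y *\<^sub>R eta0"
  for y :: "(real ^ 'i) \<times> (real ^ 'i)"
proof -
  have em: "eta_minus \<alpha> = (vec 1 :: real ^ 'i, - \<alpha> *\<^sub>R vec 1)" by (simp add: eta_minus_def vec_eq_iff)
  have d0: "drift (eta0 :: (real ^ 'i) \<times> (real ^ 'i)) = 1"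
    by (simp only: eta0_def drift_def fst_conv snd_conv mean_simps mean_vec1; simp)
  have dm: "drift (eta_minus \<alpha> :: (real ^ 'i) \<times> (real ^ 'i)) = 0"
    using pos by (simp only: em drift_def fst_conv snd_conv mean_simps mean_vec1; simp)
  have E1: "E1 = range (\<lambda>s. s *\<^sub>R (eta0 :: (real ^ 'i) \<times> (real ^ 'i)))" by (simp add: E1_def span_singleton)
  have Em: "E_minus \<alpha> = range (\<lambda>s. s *\<^sub>R (eta_minus \<alpha> :: (real ^ 'i) \<times> (real ^ 'i)))" by (simp add: E_minus_def span_singleton)
  have inner0: "eta0 \<bullet> x = CARD('i) * mean (fst x)" for x :: "(real ^ 'i) \<times> (real ^ 'i)"
    by (simp only: eta0_def inner_prod_def fst_conv snd_conv inner_commute[of "vec 1"] inner_vec1 inner_zero_left; simp)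
  have innerm: "eta_minus \<alpha> \<bullet> x = CARD('i) * (mean (fst x) - \<alpha> * mean (snd x))" for x :: "(real ^ 'i) \<times> (real ^ 'i)"
    by (simp only: em inner_prod_def fst_conv snd_conv inner_scaleR_left inner_commute[of "vec 1"] inner_vec1) (simp add: algebra_simps)
  have E22: "x \<in> E22 \<alpha> \<longleftrightarrow> mean (fst x) = 0 \<and> mean (snd x) = 0" for x :: "(real ^ 'i) \<times> (real ^ 'i)"
  proof
    assume "x \<in> E22 \<alpha>"
    then have o: "orthogonal z x" if "z \<in> E11 \<alpha>" for z using that by (auto simp: E22_def orthogonal_comp_def)
    have mem: "(s *\<^sub>R eta0 + r *\<^sub>R eta_minus \<alpha> :: (real ^ 'i) \<times> (real ^ 'i)) \<in> E11 \<alpha>" for s r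
      unfolding E11_def E1 Em by blast
    have "eta0 \<bullet> x = 0" "eta_minus \<alpha> \<bullet> x = 0"
      using o[OF mem[of 1 0]] o[OF mem[of 0 1]] by (simp_all add: orthogonal_def)
    then show "mean (fst x) = 0 \<and> mean (snd x) = 0" using pos by (simp add: inner0 innerm)
  next
    assume "mean (fst x) = 0 \<and> mean (snd x) = 0"
    then have "eta0 \<bullet> x = 0" "eta_minus \<alpha> \<bullet> x = 0" by (simp_all add: inner0 innerm)
    then have "(s *\<^sub>R eta0 + r *\<^sub>R eta_minus \<alpha>) \<bullet> x = 0" for s r by (simp add: inner_add_left)
    then show "x \<in> E22 \<alpha>"
      unfolding E22_def orthogonal_comp_def E11_def E1 Em orthogonal_def by blast
  qed
  have dE2: "drift x = 0" if x: "x \<in> E2 \<alpha>" for x :: "(real ^ 'i) \<times> (real ^ 'i)"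
  proof -
    obtain s z where sz: "x = s *\<^sub>R eta_minus \<alpha> + z" "z \<in> E22 \<alpha>" using x unfolding E2_def Em by blast
    then have "drift z = 0" using E22[of z] by (simp add: drift_def)
    then show ?thesis by (simp add: sz drift_simps dm)
  qed
  show ?thesis
    unfolding proj_def
  proof (rule the_equality, intro conjI)
    show "drift y *\<^sub>R (eta0 :: (real ^ 'i) \<times> (real ^ 'i)) \<in> E1" unfolding E1 by (rule rangeI)
    \<comment> \<open>The coefficient of \<open>eta_minus\<close>, read off from the second
      component, where \<open>eta0\<close> has no part.\<close>
    define p where "p = - mean (snd y) / \<alpha>"
    define x where "x = y - drift y *\<^sub>R eta0 - p *\<^sub>R eta_minus \<alpha>"
    have "mean (fst x) = mean (fst y) - drift y - p"
      by (simp only: x_def em eta0_def fst_diff fst_scaleR fst_conv mean_simps mean_vec1; simp)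
    moreover have "mean (snd x) = mean (snd y) + p * \<alpha>"
      by (simp only: x_def em eta0_def snd_diff snd_scaleR snd_conv mean_simps mean_vec1; simp)
    ultimately have "x \<in> E22 \<alpha>" using pos by (simp add: E22 p_def drift_def)
    moreover have "y - drift y *\<^sub>R eta0 = p *\<^sub>R eta_minus \<alpha> + x" by (simp add: x_def)
    ultimately show "y - drift y *\<^sub>R eta0 \<in> E2 \<alpha>" unfolding E2_def Em by blast
  next
    fix q assume q: "q \<in> E1 \<and> y - q \<in> E2 \<alpha>"
    then obtain s where "q = s *\<^sub>R eta0" unfolding E1 by blast
    moreover have "drift (y - q) = 0" using q dE2 by blast
    ultimately show "q = drift y *\<^sub>R eta0" by (simp add: drift_simps d0)
  qed
qed

definition "block_mean T = P.expectation (\<lambda>\<omega>. displacement T (scaled (incr 0 \<omega>)))"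

text \<open>The bound supplies the constant \<open>C0 * T\<close> that makes displacements
  nonnegative for the strong law.\<close>

lemma displacement_bounded:
  obtains C0 where "0 \<le> C0" "\<And>T b. 0 \<le> T \<Longrightarrow> continuous_on UNIV b \<Longrightarrow> \<bar>displacement T b\<bar> \<le> C0 * T"
proof -
  obtain C0 where C0: "0 \<le> C0"
    "\<And>b X s t. flow b X \<Longrightarrow> 0 \<le> s \<Longrightarrow> s \<le> t \<Longrightarrow> \<bar>drift (X t) - drift (X s)\<bar> \<le> C0 * (t - s)"
    using flow_drift_lipschitz by blast
  have "\<bar>displacement T b\<bar> \<le> C0 * T" if T: "0 \<le> T" and b: "continuous_on UNIV b" for T b
  proof -
    obtain X where X: "flow b X" "X 0 = 0" using flow_exists[OF b] .
    show ?thesis using C0(2)[OF X(1) order_refl T] displacement_eq[OF X T] X(2) by (simp add: drift_simps)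
  qed
  then show ?thesis using that C0(1) by blast
qed

lemma AE_block_averages:
  assumes T: "0 < T"
  shows "AE \<omega> in P. (\<lambda>K. (\<Sum>k<K. displacement T (scaled (incr (real k * T) \<omega>))) / K) \<longlonglongrightarrow> block_mean T"
proof -
  obtain C0 where C0: "0 \<le> C0" "\<And>T b. 0 \<le> T \<Longrightarrow> continuous_on UNIV b \<Longrightarrow> \<bar>displacement T b\<bar> \<le> C0 * T"
    using displacement_bounded by blast
  obtain L where L: "0 \<le> L" "\<And>b b' \<eta>. continuous_on UNIV b \<Longrightarrow> continuous_on UNIV b' \<Longrightarrow>
      (\<And>t. 0 \<le> t \<Longrightarrow> t \<le> T \<Longrightarrow> norm (b t - b' t) \<le> \<eta>) \<Longrightarrow> \<bar>displacement T b - displacement T b'\<bar> \<le> L * \<eta>"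
    using displacement_lipschitz[of T] T by (metis less_imp_le)
  define H where "H w = displacement T (scaled w) + C0 * T" for w
  have H: "sup_lip T (L * norm \<epsilon>) H"
    unfolding sup_lip_def
  proof (intro conjI allI impI)
    show "0 \<le> L * norm \<epsilon>" using L by simp
    fix w w' :: "real \<Rightarrow> real ^ 'i" and \<eta> :: real
    assume c: "continuous_on UNIV w" "continuous_on UNIV w'" and le: "\<forall>t\<ge>0. t \<le> T \<longrightarrow> norm (w t - w' t) \<le> \<eta>"
    have "\<bar>displacement T (scaled w) - displacement T (scaled w')\<bar> \<le> L * (norm \<epsilon> * \<eta>)"
    proof (rule L(2)[OF continuous_scaled[OF c(1)] continuous_scaled[OF c(2)]])
      fix t assume "0 \<le> t" "t \<le> T"
      then have "norm \<epsilon> * norm (w t - w' t) \<le> norm \<epsilon> * \<eta>" using le by (intro mult_left_mono) auto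
      then show "norm (scaled w t - scaled w' t) \<le> norm \<epsilon> * \<eta>" using norm_scaled_diff[of w t w'] by linarith
    qed
    then show "\<bar>H w - H w'\<bar> \<le> L * norm \<epsilon> * \<eta>" by (simp add: H_def)
  qed
  have nn: "0 \<le> H w" if "continuous_on UNIV w" for w
    using C0(2)[OF less_imp_le[OF T] continuous_scaled[OF that]] by (simp add: H_def)
  have "integrable P (\<lambda>\<omega>. H (incr 0 \<omega>) - C0 * T)"
    using functional_integrable(1)[OF T H, of 0] by simp
  then have "integrable P (\<lambda>\<omega>. displacement T (scaled (incr 0 \<omega>)))" by (simp add: H_def)
  then have EH: "P.expectation (\<lambda>\<omega>. H (incr 0 \<omega>)) = block_mean T + C0 * T"
    by (simp add: H_def block_mean_def P.prob_space)
  have "AE \<omega> in P. (\<lambda>K. (\<Sum>k<K. H (incr (real k * T) \<omega>)) / K) \<longlonglongrightarrow> P.expectation (\<lambda>\<omega>. H (incr 0 \<omega>))"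
    by (rule strong_law_blocks[OF T H]) (rule nn)
  then show ?thesis
  proof eventually_elim
    case (elim \<omega>)
    have "(\<lambda>K. (\<Sum>k<K. H (incr (real k * T) \<omega>)) / K - C0 * T) \<longlonglongrightarrow> block_mean T + C0 * T - C0 * T"
      using elim unfolding EH by (intro tendsto_intros)
    moreover have "\<forall>\<^sub>F K in sequentially. (\<Sum>k<K. H (incr (real k * T) \<omega>)) / K - C0 * T = (\<Sum>k<K. displacement T (scaled (incr (real k * T) \<omega>))) / K"
      using eventually_gt_at_top[of 0] by eventually_elim (simp add: H_def sum.distrib field_simps)
    ultimately show ?case by (simp add: tendsto_cong)
  qed
qed

text \<open>The solution is quantified inside the almost-sure statement, so the exceptional set is
  common to all initial values.\<close>

lemma rotation_estimate:
  obtains e n0 where "e \<longlonglongrightarrow> 0"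
    "\<And>n. n0 \<le> n \<Longrightarrow> AE \<omega> in P. \<forall>X. flow (noise \<omega>) X \<longrightarrow>
      (\<forall>\<^sub>F t in at_top. \<bar>drift (X t) / t - block_mean (real n) / n\<bar> \<le> e n)"
proof -
  obtain C0 where C0: "0 \<le> C0"
    "\<And>b X s t. flow b X \<Longrightarrow> 0 \<le> s \<Longrightarrow> s \<le> t \<Longrightarrow> \<bar>drift (X t) - drift (X s)\<bar> \<le> C0 * (t - s)"
    using flow_drift_lipschitz by blast
  obtain C T0 where C: "0 \<le> C" "0 < T0"
    "\<And>b X T M. flow b X \<Longrightarrow> T0 \<le> T \<Longrightarrow> (\<And>t. 0 \<le> t \<Longrightarrow> t \<le> T \<Longrightarrow> norm (b t) \<le> M) \<Longrightarrow>
      sqrt (Q (X T + (0, b T))) \<le> sqrt (Q (X 0)) / 2 + C * (1 + M)"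
    using block_contraction by blast
  define E where "E = norm \<epsilon>"
  define m where "m T = P.expectation (\<lambda>\<omega>. sup_norm T (incr 0 \<omega>))" for T
  define Bd where "Bd T = \<kappa> + 2 * (1 / c) * C * (1 + E * m T) + 1" for T
  define C5 where "C5 = 1 + 665 * real CARD('i)"
  \<comment> \<open>The summand 2 collects the slack of \<open>block_average\<close> and of
    \<open>continuous_time_average\<close>; \<open>C5\<close> bounds the mean supremum over a block
    of length n by a multiple of sqrt n.\<close>
  define e where "e n = (\<kappa> + 2 * (1 / c) * C * (1 + E * (C5 * sqrt (real n))) + 2) / real n" for n
  have m0: "0 \<le> m T" if "0 < T" for T
    unfolding m_def using that by (intro integral_nonneg_AE AE_I2 sup_norm_nonneg continuous_incr) auto
  have Bd0: "0 \<le> Bd T" if "0 < T" for T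
    unfolding Bd_def using m0[OF that] C(1) c_pos per(1) by (intro add_nonneg_nonneg mult_nonneg_nonneg) (auto simp: E_def)
  have main: "AE \<omega> in P. \<forall>X. flow (noise \<omega>) X \<longrightarrow> (\<forall>\<^sub>F t in at_top. \<bar>drift (X t) / t - block_mean T / T\<bar> \<le> (Bd T + 1) / T)"
    if T0: "T0 \<le> T" for T
  proof -
    have T: "0 < T" using C(2) T0 by simp
    have "AE \<omega> in P. (\<lambda>K. (\<Sum>k<K. sup_norm T (incr (real k * T) \<omega>)) / K) \<longlonglongrightarrow> m T"
      unfolding m_def
      by (rule strong_law_blocks[OF T sup_lip_sup_norm[OF less_imp_le[OF T]]]) (rule sup_norm_nonneg[OF _ less_imp_le[OF T]])
    with AE_block_averages[OF T] AE_space[of P] show ?thesis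
    proof eventually_elim
      case (elim \<omega>)
      show ?case
      proof (intro allI impI)
        fix X assume X: "flow (noise \<omega>) X"
        define q where "q k = sqrt (Q (X (real k * T) + (0, noise \<omega> (real k * T))))" for k
        define M where "M k = sup_norm T (incr (real k * T) \<omega>)" for k
        have blk: "flow (scaled (incr (real k * T) \<omega>)) (\<lambda>t. X (real k * T + t) + (0, noise \<omega> (real k * T)))" for k
          unfolding scaled_inc using T by (intro flow_shift[OF X]) auto
        have Suc_eq: "real k * T + T = real (Suc k) * T" for k by (simp add: algebra_simps)
        have "\<forall>\<^sub>F K in sequentially. \<bar>drift (X (real K * T)) - block_mean T * K\<bar> \<le> (\<kappa> + 2 * (1 / c) * C * (1 + E * m T) + 1) * K"
        proof (rule block_average[where q = q and D = "\<lambda>k. displacement T (scaled (incr (real k * T) \<omega>))" and M = M])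
          fix k
          obtain Z where Z: "flow (scaled (incr (real k * T) \<omega>)) Z" "Z 0 = 0"
            using flow_exists[OF continuous_scaled[OF continuous_incr[OF elim(2)]]] .
          show "\<bar>drift (X (real (Suc k) * T)) - drift (X (real k * T)) - displacement T (scaled (incr (real k * T) \<omega>))\<bar> \<le> 1 / c * q k + \<kappa>"
            using displacement_comparison[OF blk[of k] Z(1) less_imp_le[OF T]] displacement_eq[OF Z less_imp_le[OF T]] Z(2)
            by (simp add: q_def Suc_eq drift_simps del: of_nat_Suc)
          have "sqrt (Q (X (real k * T + T) + (0, noise \<omega> (real k * T)) + (0, scaled (incr (real k * T) \<omega>) T)))
            \<le> sqrt (Q (X (real k * T + 0) + (0, noise \<omega> (real k * T)))) / 2 + C * (1 + E * M k)"
          proof (rule C(3)[OF blk T0])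
            fix t assume t: "0 \<le> t" "t \<le> T"
            have "norm (scaled (incr (real k * T) \<omega>) t) \<le> E * norm (incr (real k * T) \<omega> t)" unfolding E_def by (rule norm_scaled)
            also have "\<dots> \<le> E * M k"
              unfolding M_def by (intro mult_left_mono sup_norm_ge continuous_incr elim(2) t) (simp add: E_def)
            finally show "norm (scaled (incr (real k * T) \<omega>) t) \<le> E * M k" .
          qed
          then show "q (Suc k) \<le> q k / 2 + C * (1 + E * M k)"
            by (simp add: q_def scaled_inc Suc_eq add.assoc del: of_nat_Suc)
          show "0 \<le> q k" by (simp add: q_def Q_nonneg)
        next
          show "0 \<le> 1 / c" using c_pos by simp
          show "(\<lambda>K. (\<Sum>k<K. displacement T (scaled (incr (real k * T) \<omega>))) / K) \<longlonglongrightarrow> block_mean T" by (rule elim(1))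
          show "(\<lambda>K. (\<Sum>k<K. M k) / K) \<longlonglongrightarrow> m T" unfolding M_def by (rule elim(3))
        qed
        then show "\<forall>\<^sub>F t in at_top. \<bar>drift (X t) / t - block_mean T / T\<bar> \<le> (Bd T + 1) / T"
          using Bd0[OF T] unfolding Bd_def[symmetric]
          by (intro continuous_time_average[OF T C0(2)[OF X] C0(1)])
      qed
    qed
  qed
  have "e \<longlonglongrightarrow> 0"
  proof -
    have "(\<lambda>n. (\<kappa> + 2 * (1 / c) * C + 2) / real n + 2 * (1 / c) * C * E * C5 * inverse (sqrt (real n))) \<longlonglongrightarrow> 0 + 2 * (1 / c) * C * E * C5 * 0"
      by (intro tendsto_intros lim_const_over_n tendsto_inverse_0_at_top filterlim_compose[OF sqrt_at_top filterlim_real_sequentially])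
    moreover have "(\<lambda>n. (\<kappa> + 2 * (1 / c) * C + 2) / real n + 2 * (1 / c) * C * E * C5 * inverse (sqrt (real n))) = e"
    proof
      fix n
      have "sqrt (real n) / real n = inverse (sqrt (real n))" by (rule sqrt_divide_self_eq) simp
      then have "k * inverse (sqrt (real n)) = k * sqrt (real n) / real n" for k
        by (metis times_divide_eq_right)
      then show "(\<kappa> + 2 * (1 / c) * C + 2) / real n + 2 * (1 / c) * C * E * C5 * inverse (sqrt (real n)) = e n"
        by (simp only:) (simp add: e_def add_divide_distrib algebra_simps)
    qed
    ultimately show ?thesis by simp
  qed
  moreover have "AE \<omega> in P. \<forall>X. flow (noise \<omega>) X \<longrightarrow> (\<forall>\<^sub>F t in at_top. \<bar>drift (X t) / t - block_mean (real n) / n\<bar> \<le> e n)"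
    if n: "nat \<lceil>T0\<rceil> \<le> n" for n
  proof -
    have nT: "T0 \<le> real n" using n by linarith
    then have n0: "0 < real n" using C(2) by linarith
    have "m (real n) \<le> C5 * sqrt (real n)" unfolding m_def C5_def using expectation_sup_norm_incr[OF n0] by simp
    then have "2 * (1 / c) * C * (1 + E * m (real n)) \<le> 2 * (1 / c) * C * (1 + E * (C5 * sqrt (real n)))"
      using C(1) c_pos by (intro mult_left_mono add_left_mono) (auto simp: E_def)
    then have "(Bd (real n) + 1) / real n \<le> e n"
      unfolding e_def Bd_def using n0 by (intro divide_right_mono) auto
    then show ?thesis using main[OF nT] by (auto elim!: eventually_mono intro: order_trans)
  qed
  ultimately show ?thesis by (rule that)
qed

theorem rotation_number_exists:
  "\<exists>\<rho>. AE \<omega> in P. \<forall>\<phi>0. ((\<lambda>t. proj \<alpha> (rds A K \<alpha> \<beta> g f \<epsilon> t \<omega> \<phi>0) /\<^sub>R t) \<longlongrightarrow> \<rho> *\<^sub>R eta0) at_top"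
proof -
  obtain e n0 where e: "e \<longlonglongrightarrow> 0" and AE_n: "\<And>n. n0 \<le> n \<Longrightarrow> AE \<omega> in P. \<forall>X. flow (noise \<omega>) X \<longrightarrow>
      (\<forall>\<^sub>F t in at_top. \<bar>drift (X t) / t - block_mean (real n) / n\<bar> \<le> e n)"
    using rotation_estimate by blast
  \<comment> \<open>Integer block lengths keep the number of exceptional sets countable.\<close>
  define good where "good \<omega> \<longleftrightarrow> (\<forall>n\<ge>n0. \<forall>X. flow (noise \<omega>) X \<longrightarrow>
      (\<forall>\<^sub>F t in at_top. \<bar>drift (X t) / t - block_mean (real n) / n\<bar> \<le> e n))" for \<omega>
  have good: "AE \<omega> in P. good \<omega>"
    unfolding good_def using AE_n by (subst AE_all_countable) (auto simp: AE_conj_iff)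
  \<comment> \<open>Solutions for all good noises and all initial values are put into one set, so
    that one \<rho> serves for all of them.\<close>
  define Y where "Y = {\<lambda>t. drift (X t) / t | X. \<exists>\<omega>\<in>space P. good \<omega> \<and> flow (noise \<omega>) X}"
  have "Y \<noteq> {}"
  proof -
    have "\<exists>\<omega>\<in>space P. good \<omega>"
    proof (rule ccontr)
      assume "\<not> (\<exists>\<omega>\<in>space P. good \<omega>)"
      with AE_space[of P] good have "AE \<omega> in P. False" by (auto elim: eventually_elim2)
      then show False by simp
    qed
    then obtain \<omega> where \<omega>: "\<omega> \<in> space P" "good \<omega>" by blast
    obtain X where "flow (noise \<omega>) X" using flow_exists[OF continuous_noise[OF \<omega>(1)]] .
    then show ?thesis using \<omega> by (auto simp: Y_def)
  qed
  moreover have "\<forall>\<^sub>F t in at_top. \<bar>y t - block_mean (real n) / n\<bar> \<le> e n" if "y \<in> Y" "n0 \<le> n" for y n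
    using that by (auto simp: Y_def good_def)
  ultimately obtain \<rho> where \<rho>: "\<And>y. y \<in> Y \<Longrightarrow> (y \<longlongrightarrow> \<rho>) at_top"
    using common_limit[OF e, of Y n0 "\<lambda>n. block_mean (real n) / n"] by blast
  have "AE \<omega> in P. \<forall>\<phi>0. ((\<lambda>t. proj \<alpha> (rds A K \<alpha> \<beta> g f \<epsilon> t \<omega> \<phi>0) /\<^sub>R t) \<longlongrightarrow> \<rho> *\<^sub>R eta0) at_top"
    using good AE_sublinear AE_backward_growth AE_space
  proof eventually_elim
    case (elim \<omega>)
    obtain C where C: "\<And>j t. 0 \<le> t \<Longrightarrow> \<bar>\<omega> j (- t)\<bar> \<le> C * (1 + t)\<^sup>2" using elim(3) by blast
    show ?case
    proof
      fix \<phi>0 :: "(real ^ 'i) \<times> (real ^ 'i)"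
      obtain X where X: "flow (noise \<omega>) X" "X 0 = \<phi>0" using flow_exists[OF continuous_noise[OF elim(4)]] .
      have lim1: "((\<lambda>t. drift (X t) / t) \<longlongrightarrow> \<rho>) at_top" using elim X by (intro \<rho>) (auto simp: Y_def)
      have "((\<lambda>t. (\<chi> j. \<epsilon> $ j * (\<omega> j t / t))) \<longlongrightarrow> (\<chi> j. \<epsilon> $ j * 0)) at_top"
        using elim(2) by (intro tendsto_intros) auto
      then have "((\<lambda>t. mean (\<chi> j. \<epsilon> $ j * (\<omega> j t / t)) / \<alpha>) \<longlongrightarrow> mean (\<chi> j. \<epsilon> $ j * 0) / \<alpha>) at_top"
        using tendsto_divide[OF bounded_linear.tendsto[OF bounded_linear_mean] tendsto_const, of _ _ at_top \<alpha>] pos by auto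
      moreover have "mean (\<chi> j. \<epsilon> $ j * (0::real)) = 0" by (simp add: mean_def inner_vec_def)
      ultimately have lim2: "((\<lambda>t. mean (\<chi> j. \<epsilon> $ j * (\<omega> j t / t)) / \<alpha>) \<longlongrightarrow> 0) at_top" by simp
      have "((\<lambda>t. (drift (X t) / t + mean (\<chi> j. \<epsilon> $ j * (\<omega> j t / t)) / \<alpha>) *\<^sub>R eta0) \<longlongrightarrow> (\<rho> + 0) *\<^sub>R (eta0 :: (real ^ 'i) \<times> (real ^ 'i))) at_top"
        by (intro tendsto_intros lim1 lim2)
      moreover have "\<forall>\<^sub>F t in at_top. (drift (X t) / t + mean (\<chi> j. \<epsilon> $ j * (\<omega> j t / t)) / \<alpha>) *\<^sub>R eta0
          = proj \<alpha> (rds A K \<alpha> \<beta> g f \<epsilon> t \<omega> \<phi>0) /\<^sub>R t"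
        using eventually_gt_at_top[of 0]
      proof eventually_elim
        case (elim t)
        have "(\<chi> j. \<epsilon> $ j * (\<omega> j t / t)) = inverse t *\<^sub>R noise \<omega> t" by (simp add: noise_def vec_eq_iff field_simps)
        then have "drift (X t) / t + mean (\<chi> j. \<epsilon> $ j * (\<omega> j t / t)) / \<alpha> = drift (X t + (0, noise \<omega> t)) / t"
          by (simp add: mean_simps drift_simps(1)) (simp add: drift_def mean_simps divide_inverse algebra_simps)
        then show ?case
          using rds_eq_flow[OF \<open>\<omega> \<in> space P\<close> C X less_imp_le[OF elim]] by (simp add: proj_eq_drift divide_inverse_commute)
      qed
      ultimately show "((\<lambda>t. proj \<alpha> (rds A K \<alpha> \<beta> g f \<epsilon> t \<omega> \<phi>0) /\<^sub>R t) \<longlongrightarrow> \<rho> *\<^sub>R eta0) at_top"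
        by (simp add: tendsto_cong)
    qed
  qed
  then show ?thesis by blast
qed

end

theorem corollary6p4:
  fixes A :: "real ^ ('n::finite ^ 'd::finite) ^ ('n ^ 'd)"
    and lam :: "nat \<Rightarrow> real"
    and K \<alpha> \<beta> \<delta> c1 c2 \<kappa> a L_F :: real
    and g g' :: "real \<Rightarrow> real"
    and f \<epsilon> :: "real ^ ('n ^ 'd)"
    and W :: "(real \<Rightarrow> real) measure"
  assumes N: "CARD('n) \<ge> 2"
    and params: "\<alpha> > 0" "K > 0" "0 < \<delta>" "\<delta> \<le> 1"
    and A_sym: "transpose A = A"
    and A_nonneg: "\<forall>x. 0 \<le> x \<bullet> (A *v x)"
    and A_eigenvalues: "ordered_eigenvalues A lam"
    and lam: "lam 0 = 0" "lam 0 < lam 1"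
    and A_ones: "A *v (vec 1) = lam 0 *\<^sub>R vec 1"
    and g_C1: "\<forall>x. (g has_real_derivative g' x) (at x)" "continuous_on UNIV g'"
    and g_period: "\<kappa> > 0" "\<forall>x. g (x + \<kappa>) = g x"
    and g_period_least: "\<forall>p. 0 < p \<and> p < \<kappa> \<longrightarrow> \<not> (\<forall>x. g (x + p) = g x)"
    and g_bounds: "c1 > 0" "c2 > 0" "\<forall>x. \<bar>g x\<bar> \<le> c1" "\<forall>x. \<bar>g' x\<bar> \<le> c2"
    and W: "two_sided_wiener_measure W"
    and a_def: "a = \<alpha> / 2 - \<bar>\<alpha> / 2 - \<delta> * K * lam 1 / \<alpha>\<bar>"
    and L_F_def: "L_F = 2 * c2 * \<bar>\<beta>\<bar> / \<alpha>"
    and gap: "a > 4 * L_F"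
  shows "\<exists>\<rho>::real. AE \<omega> in (Pi\<^sub>M (UNIV :: ('n ^ 'd) set) (\<lambda>_. W)).
           \<forall>\<phi>0. ((\<lambda>t. proj \<alpha> (rds A K \<alpha> \<beta> g f \<epsilon> t \<omega> \<phi>0) /\<^sub>R t) \<longlongrightarrow> \<rho> *\<^sub>R eta0) at_top"
proof -
  have lam1: "0 < lam 1" using lam by simp
  \<comment> \<open>At least two lattice sites are required for \<open>lam 1\<close> to be among the
    listed eigenvalues.\<close>
  have "2 ^ 1 \<le> CARD('n) ^ 1" using N by simp
  also have "\<dots> \<le> CARD('n) ^ CARD('d)"
    using N by (intro power_increasing) (auto simp: Suc_le_eq)
  finally have card: "CARD('n ^ 'd) \<ge> 2" by (simp add: CARD_vec)
  have A1: "A *v vec 1 = 0" using A_ones lam(1) by simp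
  have lip: "\<bar>g x - g y\<bar> \<le> c2 * \<bar>x - y\<bar>" for x y
    using field_differentiable_bound[of UNIV g g' c2 x y] g_C1(1) g_bounds(4) by simp
  define P where P_eq: "P = Pi\<^sub>M (UNIV :: ('n ^ 'd) set) (\<lambda>_. W)"
  interpret stochastic_lattice A "lam 1" K \<alpha> \<beta> \<delta> c1 c2 \<kappa> a L_F g f W P \<epsilon>
  proof unfold_locales
    show "lam 1 * (u \<bullet> u) \<le> u \<bullet> (A *v u)" if "u \<bullet> vec 1 = 0" for u
      by (rule poincare_inequality[OF A_sym A_eigenvalues card lam(1) lam1 A1 that])
  qed (use A_sym A1 params lam1 g_bounds g_period lip a_def L_F_def gap W P_eq in auto)
  show ?thesis unfolding P_eq[symmetric] by (rule rotation_number_exists)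
qed

end
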